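(* Let $H$ and $K$ be Hilbert $\mathfrak{A}$-modules over a $C^*$-algebra $\mathfrak{A}$, and suppose that $T\in\mathcal{L}(H,K)$ has the polar decomposition. Let $P=P_{\overline{\mathcal{R}(T^* )}}\in\mathcal{L}(H)$, $Q=P_{\overline{\mathcal{R}(T)}}\in\mathcal{L}(K)$, $H_1=\mathcal{R}(P)$, $H_2=\mathcal{N}(P)$, $K_1=\mathcal{R}(Q)$, $K_2=\mathcal{N}(Q)$, and assume that $H_1,H_2,K_1,K_2$ are all nonzero. Let $M=ETF^*$ with $E\in\mathcal{L}(K)$ and $F\in\mathcal{L}(H)$. Let $U_P:H\to H_1\oplus H_2$ and $U_Q:K\to K_1\oplus K_2$ be the unitary operators $U_Px=(Px,(I_H-P)x)^T$ and $U_Qy=(Qy,(I_K-Q)y)^T$, and put $$A=QTP|_{H_1}\in\mathcal{L}(H_1,K_1),\quad B=QEQ|_{K_1}\in\mathcal{L}(K_1),\quad C=(I_K-Q)EQ|_{K_1}\in\mathcal{L}(K_1,K_2),$$ $$D=PFP|_{H_1}\in\mathcal{L}(H_1),\quad G=(I_H-P)FP|_{H_1}\in\mathcal{L}(H_1,H_2),$$ $$\theta_{B,C}=(B^*B+C^*C)^{1/2}\in\mathcal{L}(K_1),\quad \theta_{D,G}=(D^*D+G^*G)^{1/2}\in\mathcal{L}(H_1),$$ $$Y=\theta_{B,C}\cdot A\cdot\theta_{D,G}\in\mathcal{L}(H_1,K_1),\quad \widetilde{X}=U_QMU_P^*\in\mathcal{L}(H_1\oplus H_2,K_1\oplus K_2).$$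 Suppose that the following conditions are satisfied: (i) $\overline{\mathcal{R}(\theta_{B,C})}$ and $\overline{\mathcal{R}(\theta_{D,G})}$ are orthogonally complemented in $K_1$ and $H_1$, respectively; (ii) $\mathcal{R}(B^* )\subseteq\mathcal{R}(\theta_{B,C})$, $\mathcal{R}(C^* )\subseteq\mathcal{R}(\theta_{B,C})$, $\mathcal{R}(D^* )\subseteq\mathcal{R}(\theta_{D,G})$ and $\mathcal{R}(G^* )\subseteq\mathcal{R}(\theta_{D,G})$; (iii) $\overline{\mathcal{R}(Y^* )}$ and $\overline{\mathcal{R}(Y)}$ are orthogonally complemented in $H_1$ and $K_1$, respectively. Then $\widetilde{X}=U_{\widetilde{X}}|\widetilde{X}|$ is the polar decomposition, where $$U_{\widetilde{X}}=\begin{pmatrix} Z_1U_YZ_3^* & Z_1U_YZ_4^*\\ Z_2U_YZ_3^* & Z_2U_YZ_4^*\end{pmatrix},$$ $Y=U_Y|Y|$ is the polar decomposition of $Y$, and $Z_1^*,Z_2^*,Z_3^*,Z_4^*$ are the reduced solutions of $$\theta_{B,C}X_1=B^*\ \big(X_1\in\mathcal{L}(K_1)\big),\quad \theta_{B,C}X_2=C^*\ \big(X_2\in\mathcal{L}(K_2,K_1)\big),$$ $$\theta_{D,G}X_3=D^*\ \big(X_3\in\mathcal{L}(H_1)\big),\quad \theta_{D,G}X_4=G^*\ \big(X_4\in\mathcal{L}(H_2,H_1)\big),$$ respectively.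
   Context: $\mathcal{L}(H,K)$ denotes the set of adjointable operators from $H$ to $K$, and $\mathcal{L}(H)=\mathcal{L}(H,H)$; $\mathcal{R}(\cdot)$ and $\mathcal{N}(\cdot)$ denote range and null space. For an adjointable operator $B$, $|B|=(B^*B)^{1/2}$. $H_1\oplus H_2$ is the Hilbert $\mathfrak{A}$-module of column pairs with inner product $\langle (x_1,y_1)^T,(x_2,y_2)^T\rangle=\langle x_1,x_2\rangle+\langle y_1,y_2\rangle$. A closed submodule $M$ of $H$ is orthogonally complemented if $H=M\dotplus M^\perp$, and then $P_M$ is the projection of $H$ onto $M$. An operator $U\in\mathcal{L}(H,K)$ is a partial isometry if $U^*U$ is a projection. Polar decomposition: for $B\in\mathcal{L}(H,K)$, "$B=U|B|$ is the polar decomposition" means that $U\in\mathcal{L}(H,K)$ is a partial isometry such that $B=U|B|$ and $U^*U=P_{\overline{\mathcal{R}(B^* )}}$ (in particular $\overline{\mathcal{R}(B^* )}$ is orthogonally complemented). Such a $U$ is unique if it exists. It is a known fact that $B$ has the polar decomposition if and only if $\overline{\mathcal{R}(B^* )}$ and $\overline{\mathcal{R}(B)}$ are both orthogonally complemented (in $H$ and $K$ respectively), so the projections $P,Q$ in the claim exist. Reduced solution: for Hilbert $\mathfrak{A}$-modules $L,H,K$, $V\in\mathcal{L}(H,K)$ and $R\in\mathcal{L}(L,K)$, an operator $N\in\mathcal{L}(L,H)$ is the reduced solution of the system $VX=R$ ($X\in\mathcal{L}(L,H)$) if $VN=R$ and $\mathcal{R}(N)\subseteq\overline{\mathcal{R}(V^*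 )}$; it is unique if it exists. It is known that if $\overline{\mathcal{R}(V^* )}$ is orthogonally complemented in $H$ and $\mathcal{R}(R)\subseteq\mathcal{R}(V)$, then the reduced solution exists. *)

theory Defs
  imports "HOL-Analysis.Analysis" "HOL-Library.FuncSet"
begin

section \<open>Complex vector spaces and \<open>C*\<close>-algebras\<close>

class scaleC =
  fixes scaleC :: "complex \<Rightarrow> 'a \<Rightarrow> 'a"  (infixr \<open>*\<^sub>C\<close> 75)

class complex_vector = real_vector + scaleC +
  assumes scaleC_add_right: "c *\<^sub>C (x + y) = c *\<^sub>C x + c *\<^sub>C y"
    and scaleC_add_left: "(c + d) *\<^sub>C x = c *\<^sub>C x + d *\<^sub>C x"
    and scaleC_scaleC: "c *\<^sub>C (d *\<^sub>C x) = (c * d) *\<^sub>C x"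
    and scaleC_one: "1 *\<^sub>C x = x"
    and scaleR_scaleC: "r *\<^sub>R x = complex_of_real r *\<^sub>C x"

instantiation prod :: (complex_vector, complex_vector) complex_vector
begin

definition scaleC_prod_def: "c *\<^sub>C p = (c *\<^sub>C fst p, c *\<^sub>C snd p)"

instance
  by standard (simp_all add: scaleC_prod_def scaleC_add_right scaleC_add_left scaleC_scaleC
      scaleC_one scaleR_scaleC prod_eq_iff)

end

text \<open>The algebra need not be unital.\<close>

class cstar_algebra = complex_vector + real_normed_algebra + complete_space +
  fixes star :: "'a \<Rightarrow> 'a"
  assumes mult_scaleC_left: "(c *\<^sub>C a) * b = c *\<^sub>C (a * b)"
    and mult_scaleC_right: "a * (c *\<^sub>C b) = c *\<^sub>C (a * b)"
    and norm_scaleC: "norm (c *\<^sub>C a) = cmod c * norm a"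
    and star_star: "star (star a) = a"
    and star_add: "star (a + b) = star a + star b"
    and star_scaleC: "star (c *\<^sub>C a) = cnj c *\<^sub>C star a"
    and star_mult: "star (a * b) = star b * star a"
    and cstar_identity: "norm (star a * a) = (norm a)\<^sup>2"

definition cstar_pos :: "'a::cstar_algebra \<Rightarrow> bool" where
  "cstar_pos a \<longleftrightarrow> (\<exists>b. a = star b * b)"


section \<open>Hilbert modules\<close>

text \<open>
  A Hilbert module is a right module over the type \<open>'a\<close> of scalars. It is carried by a subset of
  an ambient complex vector space, from which it takes addition and complex scaling; the action
  and the inner product only matter on the carrier. Submodules and direct sums then live
  on the ambient type and on the product of the ambient types.
  The inner product is linear in its second argument.
\<close>

record ('a, 'h) hmod =
  hcar :: "'h set"
  hact :: "'h \<Rightarrow> 'a \<Rightarrow> 'h"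
  hip :: "'h \<Rightarrow> 'h \<Rightarrow> 'a"

definition hnorm :: "('a::cstar_algebra, 'h::complex_vector) hmod \<Rightarrow> 'h \<Rightarrow> real" where
  "hnorm H x = sqrt (norm (hip H x x))"

definition hcomplete :: "('a::cstar_algebra, 'h::complex_vector) hmod \<Rightarrow> bool" where
  "hcomplete H \<longleftrightarrow>
    (\<forall>s. (\<forall>n. s n \<in> hcar H) \<and>
         (\<forall>e>0. \<exists>N. \<forall>m\<ge>N. \<forall>n\<ge>N. hnorm H (s m - s n) < e) \<longrightarrow>
         (\<exists>x\<in>hcar H. (\<lambda>n. hnorm H (s n - x)) \<longlonglongrightarrow> 0))"

definition submodule :: "('a::cstar_algebra, 'h::complex_vector) hmod \<Rightarrow> 'h set \<Rightarrow> bool" where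
  "submodule H M \<longleftrightarrow> M \<subseteq> hcar H \<and> 0 \<in> M \<and>
    (\<forall>x\<in>M. \<forall>y\<in>M. x + y \<in> M) \<and> (\<forall>c. \<forall>x\<in>M. c *\<^sub>C x \<in> M) \<and> (\<forall>a. \<forall>x\<in>M. hact H x a \<in> M)"

locale hilbert_module =
  fixes H :: "('a::cstar_algebra, 'h::complex_vector) hmod"
  assumes carrier: "submodule H (hcar H)"
    and act_add_left:
      "\<lbrakk>x \<in> hcar H; y \<in> hcar H\<rbrakk> \<Longrightarrow> hact H (x + y) a = hact H x a + hact H y a"
    and act_add_right: "x \<in> hcar H \<Longrightarrow> hact H x (a + b) = hact H x a + hact H x b"
    and act_mult: "x \<in> hcar H \<Longrightarrow> hact H x (a * b) = hact H (hact H x a) b"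
    and act_scaleC_left: "x \<in> hcar H \<Longrightarrow> hact H (c *\<^sub>C x) a = c *\<^sub>C hact H x a"
    and act_scaleC_right: "x \<in> hcar H \<Longrightarrow> hact H x (c *\<^sub>C a) = c *\<^sub>C hact H x a"
    and ip_add: "\<lbrakk>x \<in> hcar H; y \<in> hcar H; z \<in> hcar H\<rbrakk> \<Longrightarrow>
      hip H x (y + z) = hip H x y + hip H x z"
    and ip_scaleC: "\<lbrakk>x \<in> hcar H; y \<in> hcar H\<rbrakk> \<Longrightarrow> hip H x (c *\<^sub>C y) = c *\<^sub>C hip H x y"
    and ip_act: "\<lbrakk>x \<in> hcar H; y \<in> hcar H\<rbrakk> \<Longrightarrow> hip H x (hact H y a) = hip H x y * a"
    and ip_star: "\<lbrakk>x \<in> hcar H; y \<in> hcar H\<rbrakk> \<Longrightarrow> hip H y x = star (hip H x y)"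
    and ip_pos: "x \<in> hcar H \<Longrightarrow> cstar_pos (hip H x x)"
    and ip_definite: "\<lbrakk>x \<in> hcar H; hip H x x = 0\<rbrakk> \<Longrightarrow> x = 0"
    and complete: "hcomplete H"

definition subhmod :: "('a, 'h) hmod \<Rightarrow> 'h set \<Rightarrow> ('a, 'h) hmod" where
  "subhmod H M = H\<lparr>hcar := M\<rparr>"

definition hsum :: "('a::cstar_algebra, 'h) hmod \<Rightarrow> ('a, 'k) hmod \<Rightarrow> ('a, 'h \<times> 'k) hmod" where
  "hsum H K = \<lparr>hcar = hcar H \<times> hcar K,
    hact = (\<lambda>(x, y) a. (hact H x a, hact K y a)),
    hip = (\<lambda>(x, y) (x', y'). hip H x x' + hip K y y')\<rparr>"

definition hclosure :: "('a::cstar_algebra, 'h::complex_vector) hmod \<Rightarrow> 'h set \<Rightarrow> 'h set" where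
  "hclosure H M = {x \<in> hcar H. \<forall>e>0. \<exists>y\<in>M. hnorm H (x - y) < e}"

definition orth :: "('a::cstar_algebra, 'h) hmod \<Rightarrow> 'h set \<Rightarrow> 'h set" where
  "orth H M = {x \<in> hcar H. \<forall>y\<in>M. hip H x y = 0}"

definition orth_complemented ::
    "('a::cstar_algebra, 'h::complex_vector) hmod \<Rightarrow> 'h set \<Rightarrow> bool" where
  "orth_complemented H M \<longleftrightarrow> submodule H M \<and> hclosure H M = M \<and>
    hcar H = {x + y | x y. x \<in> M \<and> y \<in> orth H M} \<and> M \<inter> orth H M = {0}"

text \<open>Only meaningful for orthogonally complemented \<open>M\<close>.\<close>

definition proj :: "('a::cstar_algebra, 'h::complex_vector) hmod \<Rightarrow> 'h set \<Rightarrow> 'h \<Rightarrow> 'h" where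
  "proj H M = (\<lambda>x\<in>hcar H. THE y. y \<in> M \<and> x - y \<in> orth H M)"


section \<open>Adjointable operators\<close>

text \<open>
  Operators are extensional functions on the carrier, so that equality of operators is equality
  of functions; composition is \<^const>\<open>compose\<close>.
\<close>

definition adjointables ::
    "('a::cstar_algebra, 'h) hmod \<Rightarrow> ('a, 'k) hmod \<Rightarrow> ('h \<Rightarrow> 'k) set" where
  "adjointables H K = {T \<in> hcar H \<rightarrow>\<^sub>E hcar K.
    \<exists>S \<in> hcar K \<rightarrow>\<^sub>E hcar H. \<forall>x\<in>hcar H. \<forall>y\<in>hcar K. hip K (T x) y = hip H x (S y)}"

definition adj ::
    "('a::cstar_algebra, 'h) hmod \<Rightarrow> ('a, 'k) hmod \<Rightarrow> ('h \<Rightarrow> 'k) \<Rightarrow> 'k \<Rightarrow> 'h" where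
  "adj H K T = (THE S. S \<in> hcar K \<rightarrow>\<^sub>E hcar H \<and>
    (\<forall>x\<in>hcar H. \<forall>y\<in>hcar K. hip K (T x) y = hip H x (S y)))"

definition op_ran :: "('a, 'h) hmod \<Rightarrow> ('h \<Rightarrow> 'k) \<Rightarrow> 'k set" where
  "op_ran H T = T ` hcar H"

definition op_ker :: "('a, 'h) hmod \<Rightarrow> ('h \<Rightarrow> 'k::zero) \<Rightarrow> 'h set" where
  "op_ker H T = {x \<in> hcar H. T x = 0}"

text \<open>Positivity in the \<open>C*\<close>-algebra of adjointable operators on \<open>H\<close>.\<close>

definition op_pos :: "('a::cstar_algebra, 'h) hmod \<Rightarrow> ('h \<Rightarrow> 'h) \<Rightarrow> bool" where
  "op_pos H S \<longleftrightarrow> (\<exists>R \<in> adjointables H H. S = compose (hcar H) (adj H H R) R)"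

definition op_sqrt :: "('a::cstar_algebra, 'h) hmod \<Rightarrow> ('h \<Rightarrow> 'h) \<Rightarrow> 'h \<Rightarrow> 'h" where
  "op_sqrt H S = (THE R. R \<in> adjointables H H \<and> op_pos H R \<and> compose (hcar H) R R = S)"

definition op_abs ::
    "('a::cstar_algebra, 'h) hmod \<Rightarrow> ('a, 'k) hmod \<Rightarrow> ('h \<Rightarrow> 'k) \<Rightarrow> 'h \<Rightarrow> 'h" where
  "op_abs H K B = op_sqrt H (compose (hcar H) (adj H K B) B)"

definition is_projection :: "('a::cstar_algebra, 'h) hmod \<Rightarrow> ('h \<Rightarrow> 'h) \<Rightarrow> bool" where
  "is_projection H S \<longleftrightarrow> S \<in> adjointables H H \<and> compose (hcar H) S S = S \<and> adj H H S = S"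

definition partial_isometry ::
    "('a::cstar_algebra, 'h) hmod \<Rightarrow> ('a, 'k) hmod \<Rightarrow> ('h \<Rightarrow> 'k) \<Rightarrow> bool" where
  "partial_isometry H K U \<longleftrightarrow>
    U \<in> adjointables H K \<and> is_projection H (compose (hcar H) (adj H K U) U)"

text \<open>\<open>B = U |B|\<close> is the polar decomposition of \<open>B\<close>.\<close>

definition polar_decomposition ::
    "('a::cstar_algebra, 'h::complex_vector) hmod \<Rightarrow> ('a, 'k) hmod \<Rightarrow>
     ('h \<Rightarrow> 'k) \<Rightarrow> ('h \<Rightarrow> 'k) \<Rightarrow> bool" where
  "polar_decomposition H K B U \<longleftrightarrow>
    B \<in> adjointables H K \<and> partial_isometry H K U \<and>
    B = compose (hcar H) U (op_abs H K B) \<and>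
    orth_complemented H (hclosure H (op_ran K (adj H K B))) \<and>
    compose (hcar H) (adj H K U) U = proj H (hclosure H (op_ran K (adj H K B)))"

text \<open>\<open>N \<in> \<L>(L, H)\<close> is the reduced solution of \<open>V X = R\<close>, where
  \<open>V \<in> \<L>(H, K)\<close> and \<open>R \<in> \<L>(L, K)\<close>.\<close>

definition reduced_solution ::
    "('a::cstar_algebra, 'l) hmod \<Rightarrow> ('a, 'h::complex_vector) hmod \<Rightarrow> ('a, 'k) hmod \<Rightarrow>
     ('h \<Rightarrow> 'k) \<Rightarrow> ('l \<Rightarrow> 'k) \<Rightarrow> ('l \<Rightarrow> 'h) \<Rightarrow> bool" where
  "reduced_solution L H K V R N \<longleftrightarrow>
    V \<in> adjointables H K \<and> R \<in> adjointables L K \<and> N \<in> adjointables L H \<and>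
    compose (hcar L) V N = R \<and> op_ran L N \<subseteq> hclosure H (op_ran K (adj H K V))"

text \<open>The operator \<open>x \<mapsto> (P x, (I - P) x)\<close> from \<open>H\<close> to the sum of range and kernel of \<open>P\<close>.\<close>

definition split_op :: "('a, 'h::minus) hmod \<Rightarrow> ('h \<Rightarrow> 'h) \<Rightarrow> 'h \<Rightarrow> 'h \<times> 'h" where
  "split_op H P = (\<lambda>x\<in>hcar H. (P x, x - P x))"

text \<open>The operator on \<open>H\<^sub>1 \<oplus> H\<^sub>2\<close> with matrix rows \<open>(W\<^sub>1\<^sub>1, W\<^sub>1\<^sub>2)\<close> and \<open>(W\<^sub>2\<^sub>1, W\<^sub>2\<^sub>2)\<close>.\<close>

definition block_op ::
    "('a, 'h1) hmod \<Rightarrow> ('a, 'h2) hmod \<Rightarrow> ('h1 \<Rightarrow> 'k1) \<Rightarrow> ('h2 \<Rightarrow> 'k1) \<Rightarrow> ('h1 \<Rightarrow> 'k2) \<Rightarrow> ('h2 \<Rightarrow> 'k2) \<Rightarrow>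
     'h1 \<times> 'h2 \<Rightarrow> 'k1::plus \<times> 'k2::plus" where
  "block_op H1 H2 W11 W12 W21 W22 =
    (\<lambda>p\<in>hcar H1 \<times> hcar H2.
      (W11 (fst p) + W12 (snd p), W21 (fst p) + W22 (snd p)))"

text \<open>The operator \<open>(B\<^sup>*B + C\<^sup>*C)\<^sup>1\<^sup>/\<^sup>2\<close> for \<open>B \<in> \<L>(H, K)\<close> and \<open>C \<in> \<L>(H, L)\<close>.\<close>

definition theta ::
    "('a::cstar_algebra, 'h::plus) hmod \<Rightarrow> ('a, 'k) hmod \<Rightarrow> ('a, 'l) hmod \<Rightarrow>
     ('h \<Rightarrow> 'k) \<Rightarrow> ('h \<Rightarrow> 'l) \<Rightarrow> 'h \<Rightarrow> 'h" where
  "theta H K L B C = op_sqrt H (\<lambda>x\<in>hcar H. adj H K B (B x) + adj H L C (C x))"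

end

theory Submission
  imports Defs
begin

text \<open>
  The idea is to write the operator \<open>X\<close> as \<open>Z\<^sub>E Y Z\<^sub>F*\<close>, where \<open>Z\<^sub>E\<close> and \<open>Z\<^sub>F\<close> are partial isometries whose initial
  spaces contain the ranges of \<open>Y\<close> and \<open>Y*\<close>; the polar decomposition of \<open>Y\<close> then carries over to \<open>X\<close>.

  In terms of the decompositions given by \<open>P\<close> and \<open>Q\<close>, \<open>T = Q T P\<close> is concentrated in the corner \<open>A\<close>, so
  \<open>X = (B, C)\<^sup>T A (D, G)\<^sup>T*\<close>. Put \<open>\<theta> = (B* B + C* C)\<^sup>1\<^sup>/\<^sup>2\<close>. The reduced solutions satisfy
  \<open>B = Z\<^sub>1 \<theta>\<close> and \<open>C = Z\<^sub>2 \<theta>\<close>, and the column \<open>Z\<^sub>E = (Z\<^sub>1, Z\<^sub>2)\<^sup>T\<close> is isometric on the closure of the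
  range of \<open>\<theta>\<close> (\<open>theta_column_isometry\<close>). So \<open>(B, C)\<^sup>T = Z\<^sub>E \<theta>\<close>, and in the same
  way \<open>(D, G)\<^sup>T = Z\<^sub>F \<theta>'\<close> with the analogous \<open>\<theta>'\<close>. This gives \<open>X = Z\<^sub>E (\<theta> A \<theta>') Z\<^sub>F* = Z\<^sub>E Y Z\<^sub>F*\<close>, and the
  matrix in the theorem is \<open>Z\<^sub>E U\<^sub>Y Z\<^sub>F*\<close>. That such an operator has the polar decomposition
  \<open>Z\<^sub>E U\<^sub>Y Z\<^sub>F* \<cdot> Z\<^sub>F |Y| Z\<^sub>F*\<close> is a computation with adjoints (\<open>polar_transport\<close>).

  The known facts about polar decompositions and reduced solutions are
  \<open>polar_decomposition_exists\<close>, \<open>polar_range_complemented\<close> and \<open>reduced_solution_exists\<close>. The first and the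
  last extend a contraction from the range of an operator to its closure (\<open>dominated_adjoint\<close>).

  Most of the work goes into the modulus: positive operators must have exactly one positive square root, and
  \<open>T* T\<close> must be positive. Square roots are limits of an explicit iteration, and
  they inherit every intertwining relation (\<open>root_intertwine\<close>). Positivity is first treated for
  operators on modules that satisfy the Cauchy-Schwarz inequality, with no order on the scalars. Kaplansky's
  lemma \<open>kaplansky\<close>, applied to left multiplications on the algebra itself, shows that
  \<open>b* b\<close> is positive in the spectral sense. Hence positive scalars form a proper cone with monotone
  norm, Cauchy-Schwarz holds in all Hilbert modules (\<open>hilbert_module_cs\<close>), and the operator theory becomes
  available there.
\<close>

section \<open>Inner product modules over a \<open>C*\<close>-algebra\<close>

global_interpretation scaleC: vector_space "scaleC :: complex \<Rightarrow> 'a \<Rightarrow> 'a::complex_vector"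
  by unfold_locales (simp_all add: scaleC_add_right scaleC_add_left scaleC_scaleC scaleC_one)

lemma star_zero [simp]: "star (0::'a::cstar_algebra) = 0"
  using star_add[of "0::'a" 0] by simp

lemma star_minus [simp]: "star (- a) = - star (a::'a::cstar_algebra)"
  by (metis add.right_inverse add_eq_0_iff star_add star_zero)

lemma star_diff: "star (a - b) = star a - star (b::'a::cstar_algebra)"
  using star_add[of a "- b"] by simp

lemma star_scaleR: "star (r *\<^sub>R a) = r *\<^sub>R star (a::'a::cstar_algebra)"
  by (simp add: scaleR_scaleC star_scaleC)

text \<open>
  The \<open>C*\<close>-identity alone forces the involution to be isometric:
  \<open>\<parallel>a\<parallel>\<^sup>2 = \<parallel>a* a\<parallel> \<le> \<parallel>a*\<parallel> \<parallel>a\<parallel>\<close>.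
\<close>

lemma norm_le_norm_star: "norm a \<le> norm (star (a::'a::cstar_algebra))"
proof (cases "a = 0")
  case False
  have "norm a * norm a \<le> norm (star a) * norm a"
    using norm_mult_ineq[of "star a" a] by (simp add: cstar_identity power2_eq_square)
  with False show ?thesis by simp
qed simp

lemma norm_star [simp]: "norm (star a) = norm (a::'a::cstar_algebra)"
  using norm_le_norm_star[of a] norm_le_norm_star[of "star a"] by (simp add: star_star)

lemma tendsto_star:
  fixes a :: "'a::cstar_algebra"
  assumes "(f \<longlongrightarrow> a) F" shows "((\<lambda>x. star (f x)) \<longlongrightarrow> star a) F"
proof -
  have "((\<lambda>x. norm (star (f x) - star a)) \<longlongrightarrow> 0) F"
    using assms by (simp add: star_diff[symmetric] tendsto_norm_zero_iff LIM_zero_iff)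
  then show ?thesis by (simp add: tendsto_norm_zero_iff LIM_zero_iff)
qed

text \<open>
  Positivity of \<open>\<langle>x, x\<rangle>\<close> is left out of this locale, and the next one has the Cauchy-Schwarz
  inequality in its place. The scalars, as a module over themselves, satisfy that inequality for the
  trivial reason that the norm is submultiplicative. So operators on such modules can be used to establish
  the order of the scalars, which is what Cauchy-Schwarz for a general Hilbert module rests on.
\<close>

locale inner_module =
  fixes H :: "('a::cstar_algebra, 'h::complex_vector) hmod"
  assumes carrier: "submodule H (hcar H)"
    and ip_add: "\<lbrakk>x \<in> hcar H; y \<in> hcar H; z \<in> hcar H\<rbrakk> \<Longrightarrow>
      hip H x (y + z) = hip H x y + hip H x z"
    and ip_scaleC: "\<lbrakk>x \<in> hcar H; y \<in> hcar H\<rbrakk> \<Longrightarrow> hip H x (c *\<^sub>C y) = c *\<^sub>C hip H x y"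
    and ip_act: "\<lbrakk>x \<in> hcar H; y \<in> hcar H\<rbrakk> \<Longrightarrow> hip H x (hact H y a) = hip H x y * a"
    and ip_star: "\<lbrakk>x \<in> hcar H; y \<in> hcar H\<rbrakk> \<Longrightarrow> hip H y x = star (hip H x y)"
    and ip_definite: "\<lbrakk>x \<in> hcar H; hip H x x = 0\<rbrakk> \<Longrightarrow> x = 0"
    and complete: "hcomplete H"
begin

lemma car_zero [simp, intro]: "0 \<in> hcar H"
  and car_add [simp, intro]: "\<lbrakk>x \<in> hcar H; y \<in> hcar H\<rbrakk> \<Longrightarrow> x + y \<in> hcar H"
  and car_scaleC [simp, intro]: "x \<in> hcar H \<Longrightarrow> c *\<^sub>C x \<in> hcar H"
  and car_act [simp, intro]: "x \<in> hcar H \<Longrightarrow> hact H x a \<in> hcar H"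
  using carrier by (auto simp: submodule_def)

lemma car_scaleR [simp, intro]: "x \<in> hcar H \<Longrightarrow> r *\<^sub>R x \<in> hcar H"
  by (simp add: scaleR_scaleC)

lemma car_uminus [simp, intro]: "x \<in> hcar H \<Longrightarrow> - x \<in> hcar H"
  using car_scaleR[of x "-1"] by simp

lemma car_diff [simp, intro]: "\<lbrakk>x \<in> hcar H; y \<in> hcar H\<rbrakk> \<Longrightarrow> x - y \<in> hcar H"
  using car_add[of x "- y"] by simp

lemma ip_add_left:
  "\<lbrakk>x \<in> hcar H; y \<in> hcar H; z \<in> hcar H\<rbrakk> \<Longrightarrow> hip H (x + y) z = hip H x z + hip H y z"
  by (subst (1 2 3) ip_star[of z]) (auto simp: ip_add star_add)

lemma ip_scaleC_left:
  "\<lbrakk>x \<in> hcar H; y \<in> hcar H\<rbrakk> \<Longrightarrow> hip H (c *\<^sub>C x) y = cnj c *\<^sub>C hip H x y"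
  by (subst (1 2) ip_star[of y]) (auto simp: ip_scaleC star_scaleC)

lemma ip_act_left:
  "\<lbrakk>x \<in> hcar H; y \<in> hcar H\<rbrakk> \<Longrightarrow> hip H (hact H x a) y = star a * hip H x y"
  by (subst (1 2) ip_star[of y]) (auto simp: ip_act star_mult)

lemma ip_scaleR: "\<lbrakk>x \<in> hcar H; y \<in> hcar H\<rbrakk> \<Longrightarrow> hip H x (r *\<^sub>R y) = r *\<^sub>R hip H x y"
  and ip_scaleR_left: "\<lbrakk>x \<in> hcar H; y \<in> hcar H\<rbrakk> \<Longrightarrow> hip H (r *\<^sub>R x) y = r *\<^sub>R hip H x y"
  by (simp_all add: scaleR_scaleC ip_scaleC ip_scaleC_left)

lemma ip_minus: "\<lbrakk>x \<in> hcar H; y \<in> hcar H\<rbrakk> \<Longrightarrow> hip H x (- y) = - hip H x y"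
  and ip_minus_left: "\<lbrakk>x \<in> hcar H; y \<in> hcar H\<rbrakk> \<Longrightarrow> hip H (- x) y = - hip H x y"
  using ip_scaleR[of x y "-1"] ip_scaleR_left[of x y "-1"] by simp_all

lemma ip_diff:
  "\<lbrakk>x \<in> hcar H; y \<in> hcar H; z \<in> hcar H\<rbrakk> \<Longrightarrow> hip H x (y - z) = hip H x y - hip H x z"
  using ip_add[of x y "- z"] by (simp add: ip_minus)

lemma ip_diff_left:
  "\<lbrakk>x \<in> hcar H; y \<in> hcar H; z \<in> hcar H\<rbrakk> \<Longrightarrow> hip H (x - y) z = hip H x z - hip H y z"
  using ip_add_left[of x "- y" z] by (simp add: ip_minus_left)

lemma ip_zero [simp]: "x \<in> hcar H \<Longrightarrow> hip H x 0 = 0" "x \<in> hcar H \<Longrightarrow> hip H 0 x = 0"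
  using ip_scaleR[of x 0 0] ip_scaleR_left[of 0 x 0] by simp_all

lemmas ip_simps = ip_add ip_add_left ip_diff ip_diff_left ip_scaleR ip_scaleR_left
  ip_scaleC ip_scaleC_left ip_minus ip_minus_left

lemma ip_ext:
  assumes "x \<in> hcar H" "y \<in> hcar H" "\<And>z. z \<in> hcar H \<Longrightarrow> hip H z x = hip H z y"
  shows "x = y"
proof -
  have "hip H (x - y) (x - y) = 0"
    using assms(3)[of "x - y"] assms(1,2) by (simp add: ip_diff)
  then show ?thesis using ip_definite[of "x - y"] assms(1,2) by simp
qed

lemma hnorm_nonneg [simp]: "0 \<le> hnorm H x"
  by (simp add: hnorm_def)

lemma hnorm_sq: "(hnorm H x)\<^sup>2 = norm (hip H x x)"
  by (simp add: hnorm_def)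

lemma hnorm_zero [simp]: "hnorm H 0 = 0"
  by (simp add: hnorm_def)

lemma hnorm_eq_0_iff: "x \<in> hcar H \<Longrightarrow> hnorm H x = 0 \<longleftrightarrow> x = 0"
  using ip_definite[of x] by (auto simp: hnorm_def)

lemma hnorm_scaleC: "x \<in> hcar H \<Longrightarrow> hnorm H (c *\<^sub>C x) = cmod c * hnorm H x"
proof -
  assume x: "x \<in> hcar H"
  then have "norm (hip H (c *\<^sub>C x) (c *\<^sub>C x)) = (cmod c)\<^sup>2 * norm (hip H x x)"
    by (simp add: ip_scaleC ip_scaleC_left norm_scaleC power2_eq_square del: scaleC.scale_scale)
  then show ?thesis by (simp add: hnorm_def real_sqrt_mult)
qed

lemma hnorm_scaleR: "x \<in> hcar H \<Longrightarrow> hnorm H (r *\<^sub>R x) = \<bar>r\<bar> * hnorm H x"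
  by (simp add: scaleR_scaleC hnorm_scaleC)

lemma hnorm_minus: "x \<in> hcar H \<Longrightarrow> hnorm H (- x) = hnorm H x"
  using hnorm_scaleR[of x "-1"] by simp

lemma hnorm_minus_commute: "\<lbrakk>x \<in> hcar H; y \<in> hcar H\<rbrakk> \<Longrightarrow> hnorm H (x - y) = hnorm H (y - x)"
  using hnorm_minus[of "x - y"] by simp

end

locale cs_module = inner_module +
  assumes cauchy_schwarz:
    "\<lbrakk>x \<in> hcar H; y \<in> hcar H\<rbrakk> \<Longrightarrow> norm (hip H x y) \<le> hnorm H x * hnorm H y"
begin

lemma hnorm_triangle:
  assumes "x \<in> hcar H" "y \<in> hcar H"
  shows "hnorm H (x + y) \<le> hnorm H x + hnorm H y"
proof -
  have "(hnorm H (x + y))\<^sup>2 = norm ((hip H x x + hip H x y) + (hip H y x + hip H y y))"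
    using assms by (simp add: hnorm_sq ip_simps algebra_simps)
  also have "\<dots> \<le> (norm (hip H x x) + norm (hip H x y)) + (norm (hip H y x) + norm (hip H y y))"
    by (intro norm_triangle_mono norm_triangle_ineq)
  also have "\<dots> \<le> (hnorm H x + hnorm H y)\<^sup>2"
    using cauchy_schwarz[OF assms]
      cauchy_schwarz[OF assms(2,1), unfolded mult.commute[of "hnorm H y" "hnorm H x"]]
    by (simp add: power2_sum flip: hnorm_sq)
  finally show ?thesis by (rule power2_le_imp_le) simp
qed

lemma hnorm_triangle_diff:
  "\<lbrakk>x \<in> hcar H; y \<in> hcar H\<rbrakk> \<Longrightarrow> hnorm H (x - y) \<le> hnorm H x + hnorm H y"
  using hnorm_triangle[of x "- y"] by (simp add: hnorm_minus)

lemma hnorm_triangle_sub: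
  "\<lbrakk>x \<in> hcar H; y \<in> hcar H; z \<in> hcar H\<rbrakk> \<Longrightarrow> hnorm H (x - z) \<le> hnorm H (x - y) + hnorm H (y - z)"
  using hnorm_triangle[of "x - y" "y - z"] by simp

lemma hnorm_diff_abs:
  assumes "x \<in> hcar H" "y \<in> hcar H"
  shows "\<bar>hnorm H x - hnorm H y\<bar> \<le> hnorm H (x - y)"
  using hnorm_triangle[of "x - y" y] hnorm_triangle[of "y - x" x] hnorm_minus_commute[of x y] assms
  by simp

lemma tendsto_hnorm:
  assumes "\<And>n. s n \<in> hcar H" "x \<in> hcar H" "(\<lambda>n. hnorm H (s n - x)) \<longlonglongrightarrow> 0"
  shows "(\<lambda>n. hnorm H (s n)) \<longlonglongrightarrow> hnorm H x"
proof -
  have "(\<lambda>n. hnorm H (s n) - hnorm H x) \<longlonglongrightarrow> 0"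
    by (rule Lim_null_comparison[OF _ assms(3)]) (simp add: hnorm_diff_abs assms)
  then show ?thesis by (simp add: LIM_zero_iff)
qed

lemma tendsto_ip:
  assumes "\<And>n. s n \<in> hcar H" "x \<in> hcar H" "y \<in> hcar H" "(\<lambda>n. hnorm H (s n - x)) \<longlonglongrightarrow> 0"
  shows "(\<lambda>n. hip H y (s n)) \<longlonglongrightarrow> hip H y x"
proof -
  have "(\<lambda>n. hip H y (s n) - hip H y x) \<longlonglongrightarrow> 0"
  proof (rule Lim_null_comparison)
    show "\<forall>\<^sub>F n in sequentially. norm (hip H y (s n) - hip H y x) \<le> hnorm H y * hnorm H (s n - x)"
      using cauchy_schwarz[of y] assms by (simp flip: ip_diff)
    show "(\<lambda>n. hnorm H y * hnorm H (s n - x)) \<longlonglongrightarrow> 0"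
      using tendsto_mult[OF tendsto_const assms(4)] by simp
  qed
  then show ?thesis by (simp add: LIM_zero_iff)
qed

lemma tendsto_ip_left:
  assumes "\<And>n. s n \<in> hcar H" "x \<in> hcar H" "y \<in> hcar H" "(\<lambda>n. hnorm H (s n - x)) \<longlonglongrightarrow> 0"
  shows "(\<lambda>n. hip H (s n) y) \<longlonglongrightarrow> hip H x y"
  using tendsto_star[OF tendsto_ip[OF assms]] assms
  by (simp add: ip_star[of y, symmetric])

lemma hlim_unique:
  assumes "\<And>n. s n \<in> hcar H" "x \<in> hcar H" "y \<in> hcar H"
    "(\<lambda>n. hnorm H (s n - x)) \<longlonglongrightarrow> 0" "(\<lambda>n. hnorm H (s n - y)) \<longlonglongrightarrow> 0"
  shows "x = y"
  using LIMSEQ_unique[OF tendsto_ip[OF assms(1,2) _ assms(4)] tendsto_ip[OF assms(1,3) _ assms(5)]]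
  by (intro ip_ext assms)

lemma cauchy_convergent:
  assumes "\<And>n. s n \<in> hcar H"
    and "\<And>e. e > 0 \<Longrightarrow> \<exists>N. \<forall>m\<ge>N. \<forall>n\<ge>N. hnorm H (s m - s n) < e"
  shows "\<exists>x\<in>hcar H. (\<lambda>n. hnorm H (s n - x)) \<longlonglongrightarrow> 0"
  using complete assms unfolding hcomplete_def by blast

lemma hclosure_seq:
  assumes "x \<in> hclosure H M" and M: "M \<subseteq> hcar H"
  obtains s where "\<And>n. s n \<in> M" "(\<lambda>n. hnorm H (s n - x)) \<longlonglongrightarrow> 0"
proof -
  have "\<forall>n. \<exists>y\<in>M. hnorm H (x - y) < inverse (real (Suc n))"
    using assms by (auto simp: hclosure_def)
  then obtain s where s: "\<And>n. s n \<in> M" "\<And>n. hnorm H (x - s n) < inverse (real (Suc n))"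
    by metis
  have "(\<lambda>n. hnorm H (x - s n)) \<longlonglongrightarrow> 0"
    by (rule Lim_null_comparison[OF _ LIMSEQ_inverse_real_of_nat]) (simp add: less_imp_le[OF s(2)] del: of_nat_Suc)
  moreover have "x \<in> hcar H" using assms by (simp add: hclosure_def)
  ultimately show thesis
    using that[of s] s M hnorm_minus_commute[of "s _" x] by (simp add: subset_iff)
qed

lemma hclosure_seqI:
  assumes "\<And>n. s n \<in> M" "M \<subseteq> hcar H" "x \<in> hcar H" "(\<lambda>n. hnorm H (s n - x)) \<longlonglongrightarrow> 0"
  shows "x \<in> hclosure H M"
  unfolding hclosure_def
proof (intro CollectI conjI allI impI)
  fix e :: real assume "e > 0"
  then obtain n where "hnorm H (s n - x) < e"
    using order_tendstoD(2)[OF assms(4)] by (auto simp: eventually_sequentially)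
  then show "\<exists>y\<in>M. hnorm H (x - y) < e"
    using assms hnorm_minus_commute[of x "s n"] by (intro bexI[of _ "s n"]) (auto simp: subset_iff)
qed fact

lemma subset_hclosure: "M \<subseteq> hcar H \<Longrightarrow> M \<subseteq> hclosure H M"
  by (auto simp: hclosure_def intro!: bexI)

end

section \<open>Adjoint pairs of functions\<close>

text \<open>
  Adjointability for plain functions, whose values outside the carriers are arbitrary. Intermediate
  operators can then be written as lambda terms, without \<^const>\<open>compose\<close> and \<^const>\<open>restrict\<close>;
  extensionality is only restored when the constants of the theorem are reached.
\<close>

definition adjp ::
    "('a::cstar_algebra, 'h) hmod \<Rightarrow> ('a, 'k) hmod \<Rightarrow> ('h \<Rightarrow> 'k) \<Rightarrow> ('k \<Rightarrow> 'h) \<Rightarrow> bool" where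
  "adjp H K T S \<longleftrightarrow> (\<forall>x\<in>hcar H. T x \<in> hcar K) \<and> (\<forall>y\<in>hcar K. S y \<in> hcar H) \<and>
    (\<forall>x\<in>hcar H. \<forall>y\<in>hcar K. hip K (T x) y = hip H x (S y))"

lemma adjpI:
  assumes "\<And>x. x \<in> hcar H \<Longrightarrow> T x \<in> hcar K" "\<And>y. y \<in> hcar K \<Longrightarrow> S y \<in> hcar H"
    "\<And>x y. \<lbrakk>x \<in> hcar H; y \<in> hcar K\<rbrakk> \<Longrightarrow> hip K (T x) y = hip H x (S y)"
  shows "adjp H K T S"
  using assms by (simp add: adjp_def)

lemma adjp_car: "\<lbrakk>adjp H K T S; x \<in> hcar H\<rbrakk> \<Longrightarrow> T x \<in> hcar K"
  and adjp_car': "\<lbrakk>adjp H K T S; y \<in> hcar K\<rbrakk> \<Longrightarrow> S y \<in> hcar H"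
  and adjp_ip: "\<lbrakk>adjp H K T S; x \<in> hcar H; y \<in> hcar K\<rbrakk> \<Longrightarrow> hip K (T x) y = hip H x (S y)"
  by (simp_all add: adjp_def)

lemma adjp_sym:
  assumes "inner_module H" "inner_module K" "adjp H K T S"
  shows "adjp K H S T"
proof (rule adjpI)
  fix y x assume "y \<in> hcar K" "x \<in> hcar H"
  then show "hip H (S y) x = hip K y (T x)"
    using adjp_ip[OF assms(3), of x y] inner_module.ip_star[OF assms(1), of x "S y"]
      inner_module.ip_star[OF assms(2), of "T x" y] assms(3) by (simp add: adjp_def)
qed (use assms in \<open>auto simp: adjp_def\<close>)

lemma adjp_cong:
  assumes "adjp H K T S" "\<And>x. x \<in> hcar H \<Longrightarrow> T' x = T x" "\<And>x. x \<in> hcar K \<Longrightarrow> S' x = S x"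
  shows "adjp H K T' S'"
  using assms by (simp add: adjp_def)

lemma adjp_comp:
  assumes "adjp H K T S" "adjp K L T' S'"
  shows "adjp H L (\<lambda>x. T' (T x)) (\<lambda>y. S (S' y))"
  using assms by (simp add: adjp_def)

lemma adjp_id: "adjp H H (\<lambda>x. x) (\<lambda>x. x)"
  by (simp add: adjp_def)

context
  fixes H :: "('a::cstar_algebra, 'h::complex_vector) hmod" and K :: "('a, 'k::complex_vector) hmod"
  assumes H: "inner_module H" and K: "inner_module K"
begin

interpretation H: inner_module H by (rule H)
interpretation K: inner_module K by (rule K)

lemma adjp_plus:
  assumes "adjp H K T S" "adjp H K T' S'"
  shows "adjp H K (\<lambda>x. T x + T' x) (\<lambda>y. S y + S' y)"
  using assms by (simp add: adjp_def H.ip_simps K.ip_simps)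

lemma adjp_minus:
  assumes "adjp H K T S" "adjp H K T' S'"
  shows "adjp H K (\<lambda>x. T x - T' x) (\<lambda>y. S y - S' y)"
  using assms by (simp add: adjp_def H.ip_simps K.ip_simps)

lemma adjp_scaleR:
  assumes "adjp H K T S"
  shows "adjp H K (\<lambda>x. r *\<^sub>R T x) (\<lambda>y. r *\<^sub>R S y)"
  using assms by (simp add: adjp_def H.ip_simps K.ip_simps)

lemma adjp_scaleC:
  assumes "adjp H K T S"
  shows "adjp H K (\<lambda>x. c *\<^sub>C T x) (\<lambda>y. cnj c *\<^sub>C S y)"
  using assms by (simp add: adjp_def H.ip_simps K.ip_simps)

lemma adjp_zero: "adjp H K (\<lambda>x. 0) (\<lambda>x. 0)"
  by (simp add: adjp_def)

context
  fixes T S assumes T: "adjp H K T S"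
begin

lemma adjp_unique:
  assumes "adjp H K T S'" "y \<in> hcar K" shows "S' y = S y"
  using T assms by (intro H.ip_ext) (auto simp: adjp_def)

lemma adjp_add_eq: "\<lbrakk>x \<in> hcar H; y \<in> hcar H\<rbrakk> \<Longrightarrow> T (x + y) = T x + T y"
  and adjp_diff_eq: "\<lbrakk>x \<in> hcar H; y \<in> hcar H\<rbrakk> \<Longrightarrow> T (x - y) = T x - T y"
  and adjp_scaleR_eq: "x \<in> hcar H \<Longrightarrow> T (r *\<^sub>R x) = r *\<^sub>R T x"
  and adjp_scaleC_eq: "x \<in> hcar H \<Longrightarrow> T (c *\<^sub>C x) = c *\<^sub>C T x"
  and adjp_act_eq: "x \<in> hcar H \<Longrightarrow> T (hact H x a) = hact K (T x) a"
  and adjp_zero_eq: "T 0 = 0"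
proof -
  note [simp] = adjp_ip[OF adjp_sym[OF H K T], symmetric] adjp_car[OF T] adjp_car'[OF T]
  show "\<lbrakk>x \<in> hcar H; y \<in> hcar H\<rbrakk> \<Longrightarrow> T (x + y) = T x + T y"
    by (rule K.ip_ext) (simp_all add: K.ip_simps H.ip_simps)
  show "\<lbrakk>x \<in> hcar H; y \<in> hcar H\<rbrakk> \<Longrightarrow> T (x - y) = T x - T y"
    by (rule K.ip_ext) (simp_all add: K.ip_simps H.ip_simps)
  show "x \<in> hcar H \<Longrightarrow> T (r *\<^sub>R x) = r *\<^sub>R T x"
    by (rule K.ip_ext) (simp_all add: K.ip_simps H.ip_simps)
  show "x \<in> hcar H \<Longrightarrow> T (c *\<^sub>C x) = c *\<^sub>C T x"
    by (rule K.ip_ext) (simp_all add: K.ip_simps H.ip_simps)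
  show "x \<in> hcar H \<Longrightarrow> T (hact H x a) = hact K (T x) a"
    by (rule K.ip_ext) (simp_all add: K.ip_act H.ip_act)
  show "T 0 = 0"
    by (rule K.ip_ext) simp_all
qed

lemma adjp_minus_eq: "x \<in> hcar H \<Longrightarrow> T (- x) = - T x"
  using adjp_scaleR_eq[of x "-1"] by simp

lemmas adjp_linear = adjp_add_eq adjp_diff_eq adjp_scaleR_eq adjp_scaleC_eq adjp_zero_eq
  adjp_minus_eq adjp_car[OF T] adjp_car'[OF T]

end
end

section \<open>Square roots by iteration\<close>

text \<open>
  If \<open>Y\<close> satisfies \<open>Y = (W + Y\<^sup>2) / 2\<close> then \<open>(1 - Y)\<^sup>2 = 1 - W\<close>. The iterates of this fixed point
  equation are polynomials in \<open>W\<close> with nonnegative coefficients. Hence for \<open>\<parallel>W\<parallel> \<le> 1\<close> their growth is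
  dominated by the same iteration for the number \<open>1\<close> in place of \<open>W\<close>, which increases to \<open>1\<close>.
\<close>

primrec root_iter :: "('h \<Rightarrow> 'h) \<Rightarrow> nat \<Rightarrow> 'h \<Rightarrow> 'h::real_vector" where
  "root_iter W 0 = (\<lambda>x. 0)"
| "root_iter W (Suc n) = (\<lambda>x. (1/2) *\<^sub>R (W x + root_iter W n (root_iter W n x)))"

primrec root_bound :: "nat \<Rightarrow> real" where
  "root_bound 0 = 0"
| "root_bound (Suc n) = (1 + (root_bound n)\<^sup>2) / 2"

lemma root_bound_nonneg: "0 \<le> root_bound n"
  by (cases n) simp_all

lemma root_bound_le_1: "root_bound n \<le> 1"
proof (induction n)
  case (Suc n)
  then show ?case using root_bound_nonneg[of n] by (simp add: power_le_one)
qed simp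

lemma root_bound_Suc: "root_bound n \<le> root_bound (Suc n)"
  using sum_squares_ge_zero[of "1 - root_bound n" 0] by (simp add: power2_eq_square algebra_simps)

lemma root_bound_mono: "n \<le> m \<Longrightarrow> root_bound n \<le> root_bound m"
  by (rule lift_Suc_mono_le[of root_bound]) (rule root_bound_Suc)

lemma root_bound_lim: "root_bound \<longlonglongrightarrow> 1"
proof -
  obtain l where l: "root_bound \<longlonglongrightarrow> l"
    by (rule incseq_convergent[of root_bound 1]) (auto simp: incseq_def root_bound_mono root_bound_le_1)
  have "(\<lambda>n. root_bound (Suc n)) \<longlonglongrightarrow> (1 + l\<^sup>2) / 2"
    unfolding root_bound.simps by (intro tendsto_intros l) simp
  with l have "l = (1 + l\<^sup>2) / 2"
    using LIMSEQ_Suc LIMSEQ_unique by blast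
  then have "2 * l = 1 + l\<^sup>2" by (simp add: field_simps)
  then have "(l - 1)\<^sup>2 = 0" by (simp add: power2_diff)
  with l show ?thesis by simp
qed

definition hlim :: "('a::cstar_algebra, 'h::complex_vector) hmod \<Rightarrow> (nat \<Rightarrow> 'h) \<Rightarrow> 'h" where
  "hlim H s = (THE x. x \<in> hcar H \<and> (\<lambda>n. hnorm H (s n - x)) \<longlonglongrightarrow> 0)"

definition root_lim :: "('a::cstar_algebra, 'h::complex_vector) hmod \<Rightarrow> ('h \<Rightarrow> 'h) \<Rightarrow> 'h \<Rightarrow> 'h" where
  "root_lim H W x = hlim H (\<lambda>n. root_iter W n x)"

definition sa_contraction :: "('a::cstar_algebra, 'h) hmod \<Rightarrow> ('h::complex_vector \<Rightarrow> 'h) \<Rightarrow> bool" where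
  "sa_contraction H W \<longleftrightarrow> adjp H H W W \<and> (\<forall>x\<in>hcar H. hnorm H (W x) \<le> hnorm H x)"

context cs_module
begin

lemma hlim_eq:
  assumes "\<And>n. s n \<in> hcar H" "x \<in> hcar H" "(\<lambda>n. hnorm H (s n - x)) \<longlonglongrightarrow> 0"
  shows "hlim H s = x"
  unfolding hlim_def by (rule the_equality) (use assms hlim_unique[of s] in auto)

lemma inner: "inner_module H" ..

lemmas op_linear = adjp_linear[OF inner inner]

lemma selfadj_ip: "\<lbrakk>adjp H H T T; x \<in> hcar H; y \<in> hcar H\<rbrakk> \<Longrightarrow> hip H (T x) y = hip H x (T y)"
  by (rule adjp_ip)

context
  fixes W
  assumes sa_W: "sa_contraction H W"
begin

private lemma W: "adjp H H W W"
  and W_le: "x \<in> hcar H \<Longrightarrow> hnorm H (W x) \<le> hnorm H x"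
  using sa_W by (simp_all add: sa_contraction_def)

lemma root_iter_adjp: "adjp H H (root_iter W n) (root_iter W n)"
proof (induction n)
  case (Suc n)
  show ?case
    unfolding root_iter.simps
    by (intro adjp_scaleR adjp_plus W adjp_comp[OF Suc Suc] inner)
qed (simp add: adjp_zero inner)

lemmas root_iter_lin = op_linear[OF root_iter_adjp]

lemma root_iter_le: "x \<in> hcar H \<Longrightarrow> hnorm H (root_iter W n x) \<le> root_bound n * hnorm H x"
proof (induction n arbitrary: x)
  case (Suc n)
  let ?Y = "root_iter W n" and ?b = "root_bound n"
  have "hnorm H (?Y (?Y x)) \<le> ?b * hnorm H (?Y x)"
    using Suc by (simp add: root_iter_lin)
  also have "\<dots> \<le> ?b * (?b * hnorm H x)"
    using Suc by (intro mult_left_mono root_bound_nonneg)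
  finally have "hnorm H (?Y (?Y x)) \<le> ?b\<^sup>2 * hnorm H x"
    by (simp add: power2_eq_square mult.assoc)
  moreover have "hnorm H (root_iter W (Suc n) x) = (1/2) * hnorm H (W x + ?Y (?Y x))"
    using Suc.prems by (simp add: hnorm_scaleR root_iter_lin op_linear[OF W])
  ultimately show ?case
    using hnorm_triangle[of "W x" "?Y (?Y x)"] W_le[of x] Suc.prems
    by (simp add: root_iter_lin op_linear[OF W] algebra_simps)
qed simp

text \<open>
  The difference of consecutive squares is \<open>Z\<^sup>2 - Y\<^sup>2 = Z (Z - Y) + (Z - Y) Y\<close>, so the bounds for
  \<open>Z\<close>, \<open>Y\<close> and \<open>Z - Y\<close> combine to \<open>(b + a) (b - a) = b\<^sup>2 - a\<^sup>2\<close>, as for numbers.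
\<close>

lemma root_iter_step:
  "x \<in> hcar H \<Longrightarrow> hnorm H (root_iter W (Suc n) x - root_iter W n x)
    \<le> (root_bound (Suc n) - root_bound n) * hnorm H x"
proof (induction n arbitrary: x)
  case 0
  then show ?case using W_le[of x] by (simp add: hnorm_scaleR op_linear[OF W])
next
  case (Suc n)
  let ?Y = "root_iter W n" and ?Z = "root_iter W (Suc n)"
  let ?a = "root_bound n" and ?b = "root_bound (Suc n)"
  note [simp] = root_iter_lin
  note [simp del] = root_iter.simps(2) root_bound.simps(2)
  have x: "x \<in> hcar H" by fact
  have "root_iter W (Suc (Suc n)) x - ?Z x = (1/2) *\<^sub>R (?Z (?Z x) - ?Y (?Y x))"
    by (simp add: root_iter.simps(2)[of W "Suc n"] root_iter.simps(2)[of W n] algebra_simps)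
  also have "\<dots> = (1/2) *\<^sub>R (?Z (?Z x - ?Y x) + (?Z (?Y x) - ?Y (?Y x)))"
    using x by simp
  finally have eq: "root_iter W (Suc (Suc n)) x - ?Z x
      = (1/2) *\<^sub>R (?Z (?Z x - ?Y x) + (?Z (?Y x) - ?Y (?Y x)))" .
  have "hnorm H (?Z (?Z x - ?Y x)) \<le> ?b * hnorm H (?Z x - ?Y x)"
    by (intro root_iter_le) (simp add: x)
  also have "\<dots> \<le> ?b * ((?b - ?a) * hnorm H x)"
    by (intro mult_left_mono Suc.IH root_bound_nonneg x)
  finally have 1: "hnorm H (?Z (?Z x - ?Y x)) \<le> ?b * (?b - ?a) * hnorm H x" by simp
  have "hnorm H (?Z (?Y x) - ?Y (?Y x)) \<le> (?b - ?a) * hnorm H (?Y x)"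
    by (intro Suc.IH) (simp add: x)
  also have "\<dots> \<le> (?b - ?a) * (?a * hnorm H x)"
    using root_bound_Suc[of n] by (intro mult_left_mono root_iter_le x) simp
  finally have 2: "hnorm H (?Z (?Y x) - ?Y (?Y x)) \<le> ?a * (?b - ?a) * hnorm H x"
    by (simp add: ac_simps)
  have "hnorm H (root_iter W (Suc (Suc n)) x - ?Z x)
      \<le> (1/2) * (?b * (?b - ?a) * hnorm H x + ?a * (?b - ?a) * hnorm H x)"
    unfolding eq using 1 2 hnorm_triangle[of "?Z (?Z x - ?Y x)" "?Z (?Y x) - ?Y (?Y x)"] x
    by (simp add: hnorm_scaleR)
  also have "\<dots> = (root_bound (Suc (Suc n)) - ?b) * hnorm H x"
    by (simp add: root_bound.simps(2)[of "Suc n"] root_bound.simps(2)[of n] power2_eq_square field_simps)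
  finally show ?case .
qed

lemma root_iter_diff:
  assumes x: "x \<in> hcar H" and "n \<le> m"
  shows "hnorm H (root_iter W m x - root_iter W n x) \<le> (root_bound m - root_bound n) * hnorm H x"
  using \<open>n \<le> m\<close>
proof (induction m rule: dec_induct)
  case (step m)
  have "hnorm H (root_iter W (Suc m) x - root_iter W n x)
      \<le> hnorm H (root_iter W (Suc m) x - root_iter W m x) + hnorm H (root_iter W m x - root_iter W n x)"
    by (intro hnorm_triangle_sub) (simp_all add: root_iter_lin x del: root_iter.simps)
  also have "\<dots> \<le> (root_bound (Suc m) - root_bound m) * hnorm H x + (root_bound m - root_bound n) * hnorm H x"
    using step root_iter_step[OF x] by (intro add_mono)
  finally show ?case by (simp add: algebra_simps)
qed simp

lemma root_lim:
  assumes x: "x \<in> hcar H"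
  shows root_lim_car: "root_lim H W x \<in> hcar H"
    and root_lim_tendsto: "(\<lambda>n. hnorm H (root_iter W n x - root_lim H W x)) \<longlonglongrightarrow> 0"
proof -
  have "\<exists>l\<in>hcar H. (\<lambda>n. hnorm H (root_iter W n x - l)) \<longlonglongrightarrow> 0"
  proof (rule cauchy_convergent)
    fix e :: real assume e: "e > 0"
    have "Cauchy root_bound" using root_bound_lim by (rule LIMSEQ_imp_Cauchy)
    then obtain N where N: "\<And>m n. \<lbrakk>m \<ge> N; n \<ge> N\<rbrakk> \<Longrightarrow> \<bar>root_bound m - root_bound n\<bar> < e / (hnorm H x + 1)"
      using e unfolding Cauchy_def dist_real_def by (metis add_nonneg_pos divide_pos_pos hnorm_nonneg zero_less_one)
    have main: "hnorm H (root_iter W m x - root_iter W n x) < e" if "n \<le> m" "m \<ge> N" "n \<ge> N" for m n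
    proof -
      have "hnorm H (root_iter W m x - root_iter W n x) \<le> (root_bound m - root_bound n) * hnorm H x"
        by (rule root_iter_diff) (use x that in auto)
      also have "\<dots> \<le> e / (hnorm H x + 1) * hnorm H x"
        using N[OF that(2,3)] by (intro mult_right_mono) auto
      also have "\<dots> < e"
        using e hnorm_nonneg[of x] by (simp add: divide_less_eq add_nonneg_pos distrib_left)
      finally show ?thesis .
    qed
    show "\<exists>N. \<forall>m\<ge>N. \<forall>n\<ge>N. hnorm H (root_iter W m x - root_iter W n x) < e"
    proof (intro exI[of _ N] allI impI)
      fix m n assume "m \<ge> N" "n \<ge> N"
      then show "hnorm H (root_iter W m x - root_iter W n x) < e"
        using main[of n m] main[of m n] hnorm_minus_commute[of "root_iter W m x" "root_iter W n x"] x
        by (cases "n \<le> m") (simp_all add: root_iter_lin)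
    qed
  qed (simp add: root_iter_lin x)
  then obtain l where l: "l \<in> hcar H" "(\<lambda>n. hnorm H (root_iter W n x - l)) \<longlonglongrightarrow> 0" by blast
  have "root_lim H W x = l"
    unfolding root_lim_def by (rule hlim_eq[OF _ l]) (simp add: root_iter_lin x)
  with l show "root_lim H W x \<in> hcar H" "(\<lambda>n. hnorm H (root_iter W n x - root_lim H W x)) \<longlonglongrightarrow> 0"
    by simp_all
qed

lemma root_lim_adjp: "adjp H H (root_lim H W) (root_lim H W)"
proof (rule adjpI)
  fix x y assume xy: "x \<in> hcar H" "y \<in> hcar H"
  have "(\<lambda>n. hip H (root_iter W n x) y) \<longlonglongrightarrow> hip H (root_lim H W x) y"
    using xy by (intro tendsto_ip_left root_lim) (simp_all add: root_iter_lin)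
  moreover have "(\<lambda>n. hip H x (root_iter W n y)) \<longlonglongrightarrow> hip H x (root_lim H W y)"
    using xy by (intro tendsto_ip root_lim) (simp_all add: root_iter_lin)
  ultimately show "hip H (root_lim H W x) y = hip H x (root_lim H W y)"
    using xy by (simp add: selfadj_ip[OF root_iter_adjp] LIMSEQ_unique)
qed (simp_all add: root_lim)

lemma root_lim_le:
  assumes x: "x \<in> hcar H" shows "hnorm H (root_lim H W x) \<le> hnorm H x"
proof (rule LIMSEQ_le_const2)
  show "(\<lambda>n. hnorm H (root_iter W n x)) \<longlonglongrightarrow> hnorm H (root_lim H W x)"
    using x by (intro tendsto_hnorm root_lim) (simp_all add: root_iter_lin)
  have "hnorm H (root_iter W n x) \<le> hnorm H x" for n
    using root_iter_le[OF x, of n] mult_right_mono[OF root_bound_le_1[of n] hnorm_nonneg[of x]] by simp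
  then show "\<exists>N. \<forall>n\<ge>N. hnorm H (root_iter W n x) \<le> hnorm H x" by blast
qed

text \<open>
  The limit is only pointwise, but the iterates are uniformly bounded by \<open>1\<close>, so squaring passes to
  the limit.
\<close>

lemma root_lim_fixpoint:
  assumes x: "x \<in> hcar H"
  shows "root_lim H W (root_lim H W x) = 2 *\<^sub>R root_lim H W x - W x"
proof -
  let ?L = "root_lim H W" and ?Y = "root_iter W"
  note [simp] = root_iter_lin root_lim_car op_linear[OF W] x
  have *: "(\<lambda>n. hnorm H (?Y n (?Y n x) - ?L (?L x))) \<longlonglongrightarrow> 0"
  proof (rule Lim_null_comparison)
    show "\<forall>\<^sub>F n in sequentially. norm (hnorm H (?Y n (?Y n x) - ?L (?L x)))
       \<le> hnorm H (?Y n x - ?L x) + hnorm H (?Y n (?L x) - ?L (?L x))"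
    proof (intro always_eventually allI)
      fix n
      have "hnorm H (?Y n (?Y n x - ?L x)) \<le> root_bound n * hnorm H (?Y n x - ?L x)"
        by (rule root_iter_le) simp
      also have "\<dots> \<le> hnorm H (?Y n x - ?L x)"
        using mult_right_mono[OF root_bound_le_1[of n] hnorm_nonneg] by simp
      finally show "norm (hnorm H (?Y n (?Y n x) - ?L (?L x)))
         \<le> hnorm H (?Y n x - ?L x) + hnorm H (?Y n (?L x) - ?L (?L x))"
        using hnorm_triangle_sub[of "?Y n (?Y n x)" "?Y n (?L x)" "?L (?L x)"] by simp
    qed
    show "(\<lambda>n. hnorm H (?Y n x - ?L x) + hnorm H (?Y n (?L x) - ?L (?L x))) \<longlonglongrightarrow> 0"
      using tendsto_add[OF root_lim_tendsto[of x] root_lim_tendsto[of "?L x"]] by simp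
  qed
  have "(\<lambda>n. hnorm H (?Y (Suc n) x - (1/2) *\<^sub>R (W x + ?L (?L x)))) \<longlonglongrightarrow> 0"
  proof -
    have "?Y (Suc n) x - (1/2) *\<^sub>R (W x + ?L (?L x)) = (1/2) *\<^sub>R (?Y n (?Y n x) - ?L (?L x))" for n
      by (simp add: algebra_simps)
    then show ?thesis using tendsto_mult[OF tendsto_const[of "1/2"] *] by (simp add: hnorm_scaleR)
  qed
  moreover have "(\<lambda>n. hnorm H (?Y (Suc n) x - ?L x)) \<longlonglongrightarrow> 0"
    using LIMSEQ_Suc[OF root_lim_tendsto[of x]] by simp
  ultimately have "?L x = (1/2) *\<^sub>R (W x + ?L (?L x))"
    by (intro hlim_unique[where s = "\<lambda>n. ?Y (Suc n) x"]) (simp_all del: root_iter.simps)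
  then have "2 *\<^sub>R ?L x = 2 *\<^sub>R ((1/2) *\<^sub>R (W x + ?L (?L x)))" by (rule arg_cong)
  then show ?thesis by (simp only: scaleR_scaleR) simp
qed

end
end

text \<open>
  Intertwining passes from \<open>W\<close> to every iterate. Tested against a vector \<open>k\<close> through the adjoint of
  \<open>V\<close>, it passes to the limit. With \<open>H = K\<close> and \<open>W = W'\<close> this says that the limit
  commutes with whatever commutes with \<open>W\<close>.
\<close>

lemma root_lim_intertwine:
  assumes H: "cs_module H" and K: "cs_module K"
    and W: "sa_contraction H W" and W': "sa_contraction K W'"
    and V: "adjp H K V V'" and VW: "\<And>x. x \<in> hcar H \<Longrightarrow> V (W x) = W' (V x)"
    and x: "x \<in> hcar H"
  shows "V (root_lim H W x) = root_lim K W' (V x)"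
proof -
  interpret H: cs_module H by fact
  interpret K: cs_module K by fact
  have "adjp H H W W" "adjp K K W' W'" using W W' by (simp_all add: sa_contraction_def)
  note [simp] = adjp_linear[OF H.inner K.inner V] H.op_linear[OF this(1)] K.op_linear[OF this(2)]
    H.root_iter_lin[OF W] K.root_iter_lin[OF W'] H.root_lim_car[OF W] K.root_lim_car[OF W']
  have it: "V (root_iter W n x) = root_iter W' n (V x)" if "x \<in> hcar H" for n x
    using that by (induction n arbitrary: x) (simp_all add: VW)
  show ?thesis
  proof (rule K.ip_ext)
    fix k assume k: "k \<in> hcar K"
    have "(\<lambda>n. hip H (V' k) (root_iter W n x)) \<longlonglongrightarrow> hip H (V' k) (root_lim H W x)"
      using x k by (intro H.tendsto_ip H.root_lim_tendsto W) auto
    moreover have "(\<lambda>n. hip K k (root_iter W' n (V x))) \<longlonglongrightarrow> hip K k (root_lim K W' (V x))"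
      using x k by (intro K.tendsto_ip K.root_lim_tendsto W') auto
    ultimately show "hip K k (V (root_lim H W x)) = hip K k (root_lim K W' (V x))"
      using x k by (simp add: adjp_ip[OF adjp_sym[OF H.inner K.inner V]] LIMSEQ_unique flip: it)
  qed (use x in auto)
qed

section \<open>Positive operators and the uniqueness of their square roots\<close>

text \<open>
  A Banach-Steinhaus argument. The sets \<open>{x. \<parallel>T x\<parallel> \<le> n}\<close> cover the module, and they are closed
  because \<open>T\<close> is weakly continuous through its adjoint. By Baire one of them contains a ball.
\<close>

lemma adjp_bounded:
  assumes H: "cs_module H" and K: "cs_module K" and T: "adjp H K T S"
  obtains c where "c > 0" "\<And>x. x \<in> hcar H \<Longrightarrow> hnorm K (T x) \<le> c * hnorm H x"
proof -
  interpret H: cs_module H by fact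
  interpret K: cs_module K by fact
  note [simp] = adjp_linear[OF H.inner K.inner T]
  define d where "d x y = (if x \<in> hcar H \<and> y \<in> hcar H then hnorm H (x - y) else 0)" for x y
  interpret M: Metric_space "hcar H" d
  proof
    show "d x y = d y x" for x y by (simp add: d_def H.hnorm_minus_commute)
    show "x \<in> hcar H \<Longrightarrow> y \<in> hcar H \<Longrightarrow> (d x y = 0) = (x = y)" for x y
      by (simp add: d_def H.hnorm_eq_0_iff)
    show "x \<in> hcar H \<Longrightarrow> y \<in> hcar H \<Longrightarrow> z \<in> hcar H \<Longrightarrow> d x z \<le> d x y + d y z" for x y z
      by (simp add: d_def H.hnorm_triangle_sub)
  qed (simp add: d_def)
  have complete: "M.mcomplete"
    unfolding M.mcomplete_def
  proof (intro allI impI)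
    fix s assume s: "M.MCauchy s"
    then have car: "s n \<in> hcar H" for n by (auto simp: M.MCauchy_def)
    obtain l where l: "l \<in> hcar H" "(\<lambda>n. hnorm H (s n - l)) \<longlonglongrightarrow> 0"
      using H.cauchy_convergent[of s] s car by (auto simp: M.MCauchy_def d_def)
    have "limitin M.mtopology s l sequentially"
      unfolding M.limitin_metric
      using order_tendstoD(2)[OF l(2)] l(1) car by (simp add: d_def)
    then show "\<exists>x. limitin M.mtopology s x sequentially" ..
  qed
  define A where "A n = {x \<in> hcar H. hnorm K (T x) \<le> real n}" for n
  have closed: "closedin M.mtopology (A n)" for n
    unfolding M.closedin_metric
  proof (intro conjI allI impI)
    fix x assume "x \<in> hcar H - A n"
    then have x: "x \<in> hcar H" and Tx: "real n < hnorm K (T x)" by (auto simp: A_def)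
    let ?y = "T x"
    (* For z within e of x the pairing of T z with T x still has norm above n times that of T x. *)
    define e where "e = (hnorm K ?y - real n) * hnorm K ?y / (hnorm H (S ?y) + 1)"
    have pos: "hnorm H (S ?y) + 1 > 0" by (simp add: add_nonneg_pos)
    have y: "hnorm K ?y > 0" using Tx by (meson of_nat_0_le_iff order_le_less_trans)
    have "e > 0" unfolding e_def using Tx pos y by (intro divide_pos_pos mult_pos_pos) auto
    have "hnorm K (T z) > real n" if z: "z \<in> hcar H" "hnorm H (x - z) < e" for z
    proof -
      have "(hnorm K ?y)\<^sup>2 = norm (hip K ?y (T z) + hip K ?y (T (x - z)))"
        using x z by (simp add: K.hnorm_sq K.ip_diff)
      also have "\<dots> \<le> norm (hip K ?y (T z)) + norm (hip K ?y (T (x - z)))"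
        by (rule norm_triangle_ineq)
      also have "hip K ?y (T (x - z)) = hip H (S ?y) (x - z)"
        using adjp_ip[OF adjp_sym[OF H.inner K.inner T], of ?y "x - z"] x z by simp
      also have "norm (hip K ?y (T z)) + norm (hip H (S ?y) (x - z))
          \<le> hnorm K ?y * hnorm K (T z) + hnorm H (S ?y) * hnorm H (x - z)"
        using x z by (intro add_mono K.cauchy_schwarz H.cauchy_schwarz) auto
      also have "\<dots> \<le> hnorm K ?y * hnorm K (T z) + (hnorm H (S ?y) + 1) * hnorm H (x - z)"
        by (intro add_left_mono mult_right_mono) simp_all
      also have "\<dots> < hnorm K ?y * hnorm K (T z) + (hnorm H (S ?y) + 1) * e"
        using z pos by simp
      also have "(hnorm H (S ?y) + 1) * e = (hnorm K ?y - real n) * hnorm K ?y"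
        using pos by (simp add: e_def)
      finally have "hnorm K ?y * real n < hnorm K ?y * hnorm K (T z)"
        by (simp add: power2_eq_square algebra_simps)
      then show ?thesis using y by simp
    qed
    then show "\<exists>r>0. disjnt (A n) (M.mball x r)"
      using \<open>e > 0\<close> by (intro exI[of _ e]) (force simp: disjnt_def A_def d_def x)
  qed (auto simp: A_def)
  have union: "\<Union>(range A) = hcar H"
    using real_arch_simple by (auto simp: A_def)
  have "M.mtopology interior_of (hcar H) = hcar H"
    using interior_of_topspace[of M.mtopology] by simp
  then have "M.mtopology interior_of \<Union>(range A) \<noteq> {}"
    unfolding union using H.car_zero by blast
  then obtain n where "M.mtopology interior_of (A n) \<noteq> {}"
    using M.metric_Baire_category_alt[OF complete, of "range A"] closed by auto
  then obtain x0 where "x0 \<in> M.mtopology interior_of (A n)" by blast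
  then obtain U where U: "openin M.mtopology U" "x0 \<in> U" "U \<subseteq> A n" by (auto simp: interior_of_def)
  then obtain r where r: "r > 0" "M.mball x0 r \<subseteq> A n"
    unfolding M.openin_mtopology by (meson subset_trans)
  have x0: "x0 \<in> hcar H" using U by (auto simp: A_def)
  have ball: "hnorm K (T (x0 + z)) \<le> real n" if "z \<in> hcar H" "hnorm H z < r" for z
    using r(2) that x0 H.hnorm_minus[of z] by (auto simp: A_def d_def dest!: subsetD[of _ _ "x0 + z"])
  have small: "hnorm K (T z) \<le> 2 * real n" if z: "z \<in> hcar H" "hnorm H z < r" for z
  proof -
    have "hnorm K (T (x0 + z) - T (x0 + 0)) \<le> hnorm K (T (x0 + z)) + hnorm K (T (x0 + 0))"
      using z x0 by (intro K.hnorm_triangle_diff) auto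
    then show ?thesis using ball[OF z] ball[of 0] r(1) z x0 by simp
  qed
  define c where "c = 4 * real n / r"
  have "hnorm K (T x) \<le> (c + 1) * hnorm H x" if x: "x \<in> hcar H" for x
  proof (cases "x = 0")
    case False
    then have hx: "hnorm H x > 0" using H.hnorm_eq_0_iff[OF x] H.hnorm_nonneg[of x] by linarith
    (* Rescaled to norm r / 2, the vector lies inside the ball. *)
    let ?c = "r / (2 * hnorm H x)"
    have "hnorm K (T (?c *\<^sub>R x)) \<le> 2 * real n"
      using x hx r(1) by (intro small) (simp_all add: H.hnorm_scaleR)
    then have "?c * hnorm K (T x) \<le> 2 * real n"
      using x hx r(1) by (simp add: K.hnorm_scaleR)
    then have "hnorm K (T x) \<le> c * hnorm H x"
      using hx r(1) by (simp add: c_def field_simps)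
    then show ?thesis by (simp add: distrib_right add_increasing2)
  qed simp
  moreover have "c \<ge> 0" using r(1) by (simp add: c_def)
  ultimately show thesis by (intro that[of "c + 1"]) auto
qed

text \<open>
  Spectral positivity phrased with the norm: a self-adjoint \<open>a\<close> is positive iff
  \<open>\<parallel>t - a\<parallel> \<le> t\<close> for some \<open>t > 0\<close>, since this places the spectrum in \<open>[0, 2t]\<close>. In this form sums
  of positive operators are positive by the triangle inequality. The index \<open>t\<close> is recorded because the
  square root below depends on it as a term, and two operators can only be compared with a common \<open>t\<close>.
\<close>

definition posop_at :: "('a::cstar_algebra, 'h::complex_vector) hmod \<Rightarrow> real \<Rightarrow> ('h \<Rightarrow> 'h) \<Rightarrow> bool" where
  "posop_at H t a \<longleftrightarrow> adjp H H a a \<and> 0 < t \<and> (\<forall>x\<in>hcar H. hnorm H (t *\<^sub>R x - a x) \<le> t * hnorm H x)"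

definition posop :: "('a::cstar_algebra, 'h::complex_vector) hmod \<Rightarrow> ('h \<Rightarrow> 'h) \<Rightarrow> bool" where
  "posop H a \<longleftrightarrow> (\<exists>t. posop_at H t a)"

text \<open>
  The contraction \<open>W\<close> with \<open>a = t (1 - W)\<close>, so that \<open>a\<close> has the square root
  \<open>t\<^sup>1\<^sup>/\<^sup>2 (1 - Y)\<close> with \<open>(1 - Y)\<^sup>2 = 1 - W\<close>.
\<close>

definition root_defect :: "real \<Rightarrow> ('h \<Rightarrow> 'h) \<Rightarrow> 'h \<Rightarrow> 'h::real_vector" where
  "root_defect t a x = x - (1/t) *\<^sub>R a x"

definition pos_root :: "('a::cstar_algebra, 'h::complex_vector) hmod \<Rightarrow> real \<Rightarrow> ('h \<Rightarrow> 'h) \<Rightarrow> 'h \<Rightarrow> 'h" where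
  "pos_root H t a x = sqrt t *\<^sub>R (x - root_lim H (root_defect t a) x)"

context cs_module
begin

lemma cs: "cs_module H" ..

lemma posop_at_mono:
  assumes "posop_at H t a" "t \<le> t'" shows "posop_at H t' a"
  unfolding posop_at_def
proof (intro conjI ballI)
  fix x assume x: "x \<in> hcar H"
  have a: "adjp H H a a" using assms by (simp add: posop_at_def)
  have eq: "t' *\<^sub>R x - a x = (t' - t) *\<^sub>R x + (t *\<^sub>R x - a x)" by (simp add: algebra_simps)
  have "hnorm H (t' *\<^sub>R x - a x) \<le> hnorm H ((t' - t) *\<^sub>R x) + hnorm H (t *\<^sub>R x - a x)"
    unfolding eq using x by (intro hnorm_triangle) (simp_all add: op_linear[OF a])
  also have "\<dots> \<le> (t' - t) * hnorm H x + t * hnorm H x"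
    using assms x by (intro add_mono) (auto simp: posop_at_def hnorm_scaleR)
  finally show "hnorm H (t' *\<^sub>R x - a x) \<le> t' * hnorm H x" by (simp add: algebra_simps)
qed (use assms in \<open>auto simp: posop_at_def\<close>)

lemma posop_selfadj: "posop H a \<Longrightarrow> adjp H H a a"
  by (auto simp: posop_def posop_at_def)

lemma posop_common:
  assumes "posop H a" "posop H b"
  obtains t where "posop_at H t a" "posop_at H t b"
proof -
  from assms obtain s t where "posop_at H s a" "posop_at H t b" by (auto simp: posop_def)
  then show thesis using posop_at_mono[of _ _ "max s t"] by (intro that[of "max s t"]) auto
qed

lemma posop_plus:
  assumes "posop H a" "posop H b" shows "posop H (\<lambda>x. a x + b x)"
proof -
  obtain t where t: "posop_at H t a" "posop_at H t b" using posop_common[OF assms] .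
  then have ab: "adjp H H a a" "adjp H H b b" by (auto simp: posop_at_def)
  have "hnorm H ((t + t) *\<^sub>R x - (a x + b x)) \<le> (t + t) * hnorm H x" if x: "x \<in> hcar H" for x
  proof -
    have eq: "(t + t) *\<^sub>R x - (a x + b x) = (t *\<^sub>R x - a x) + (t *\<^sub>R x - b x)"
      unfolding scaleR_left_distrib by simp
    have "hnorm H ((t + t) *\<^sub>R x - (a x + b x)) \<le> hnorm H (t *\<^sub>R x - a x) + hnorm H (t *\<^sub>R x - b x)"
      unfolding eq using x by (intro hnorm_triangle) (simp_all add: op_linear[OF ab(1)] op_linear[OF ab(2)])
    also have "\<dots> \<le> t * hnorm H x + t * hnorm H x"
      using t x by (intro add_mono) (auto simp: posop_at_def)
    finally show ?thesis by (simp add: algebra_simps)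
  qed
  then show ?thesis using t ab unfolding posop_def posop_at_def
    by (intro exI[of _ "t + t"]) (auto intro: adjp_plus inner)
qed

lemma posop_cong:
  assumes "posop H a" "\<And>x. x \<in> hcar H \<Longrightarrow> b x = a x" shows "posop H b"
  using assms unfolding posop_def posop_at_def by (auto intro: adjp_cong)

lemma root_defect:
  assumes "posop_at H t a"
  shows "sa_contraction H (root_defect t a)"
  unfolding sa_contraction_def
proof (intro conjI ballI)
  have a: "adjp H H a a" "t > 0" using assms by (auto simp: posop_at_def)
  show "adjp H H (root_defect t a) (root_defect t a)"
    by (rule adjp_cong[OF adjp_minus[OF inner inner adjp_id adjp_scaleR[OF inner inner a(1), of "1/t"]]])
      (simp_all add: root_defect_def)
  fix x assume x: "x \<in> hcar H"
  have "root_defect t a x = (1/t) *\<^sub>R (t *\<^sub>R x - a x)"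
    using a(2) by (simp add: root_defect_def algebra_simps)
  then have "hnorm H (root_defect t a x) = (1/t) * hnorm H (t *\<^sub>R x - a x)"
    using x a(2) by (simp add: hnorm_scaleR op_linear[OF a(1)])
  also have "\<dots> \<le> (1/t) * (t * hnorm H x)"
    using assms x by (intro mult_left_mono) (auto simp: posop_at_def)
  finally show "hnorm H (root_defect t a x) \<le> hnorm H x" using a(2) by simp
qed

lemma root:
  assumes a: "posop_at H t a"
  shows root_adjp: "adjp H H (pos_root H t a) (pos_root H t a)"
    and root_posop_at: "posop_at H (sqrt t) (pos_root H t a)"
    and root_square: "x \<in> hcar H \<Longrightarrow> pos_root H t a (pos_root H t a x) = a x"
proof -
  note d = root_defect[OF a]
  note L = root_lim_adjp[OF d] root_lim_le[OF d] root_lim_fixpoint[OF d]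
  have t: "t > 0" and sa: "adjp H H a a" using a by (auto simp: posop_at_def)
  show adj: "adjp H H (pos_root H t a) (pos_root H t a)"
    by (rule adjp_cong[OF adjp_scaleR[OF inner inner adjp_minus[OF inner inner adjp_id L(1)], of "sqrt t"]])
      (simp_all add: pos_root_def)
  show "posop_at H (sqrt t) (pos_root H t a)"
    unfolding posop_at_def
  proof (intro conjI ballI)
    fix x assume x: "x \<in> hcar H"
    then have "hnorm H (sqrt t *\<^sub>R x - pos_root H t a x) = sqrt t * hnorm H (root_lim H (root_defect t a) x)"
      using t by (simp add: pos_root_def algebra_simps hnorm_scaleR op_linear[OF L(1)])
    then show "hnorm H (sqrt t *\<^sub>R x - pos_root H t a x) \<le> sqrt t * hnorm H x"
      using L(2)[OF x] t by simp
  qed (use adj t in auto)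
  assume x: "x \<in> hcar H"
  have "pos_root H t a (pos_root H t a x) = (sqrt t * sqrt t) *\<^sub>R root_defect t (\<lambda>x. t *\<^sub>R root_defect t a x) x"
    using x t by (simp add: pos_root_def root_defect_def op_linear[OF L(1)] L(3) op_linear[OF sa] algebra_simps scaleR_2)
  also have "\<dots> = a x" using t by (simp add: root_defect_def algebra_simps)
  finally show "pos_root H t a (pos_root H t a x) = a x" .
qed

end

lemma root_intertwine:
  assumes H: "cs_module H" and K: "cs_module K"
    and a: "posop_at H t a" and b: "posop_at K t b"
    and V: "adjp H K V V'" and VW: "\<And>x. x \<in> hcar H \<Longrightarrow> V (a x) = b (V x)"
    and x: "x \<in> hcar H"
  shows "V (pos_root H t a x) = pos_root K t b (V x)"
proof -
  interpret H: cs_module H by fact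
  interpret K: cs_module K by fact
  note Vl = adjp_linear[OF H.inner K.inner V]
  have sa: "adjp H H a a" using a by (simp add: posop_at_def)
  have "V (root_lim H (root_defect t a) x) = root_lim K (root_defect t b) (V x)"
    by (rule root_lim_intertwine[OF H K H.root_defect[OF a] K.root_defect[OF b] V _ x])
      (simp_all add: root_defect_def Vl VW H.op_linear[OF sa])
  then show ?thesis
    using x by (simp add: pos_root_def Vl H.root_lim_car[OF H.root_defect[OF a]])
qed

context cs_module
begin

lemma adjp_comp_commute:
  assumes "adjp H H a a" "adjp H H b b" "\<And>x. x \<in> hcar H \<Longrightarrow> a (b x) = b (a x)"
  shows "adjp H H (\<lambda>x. a (b x)) (\<lambda>x. a (b x))"
  by (rule adjp_cong[OF adjp_comp[OF assms(2,1)]]) (simp_all add: assms(3))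

text \<open>
  For commuting self-adjoint \<open>h\<close>, \<open>k\<close> the operator \<open>n = h + ik\<close> is normal and
  \<open>n* n = n n* = h\<^sup>2 + k\<^sup>2\<close>. The next two lemmas read off bounds for \<open>h\<close> and \<open>k\<close> from this, because
  \<open>2h = n + n*\<close> and \<open>2ik = n - n*\<close>.
\<close>

lemma commuting_cartesian_ip:
  assumes h: "adjp H H h h" "adjp H H k k" and comm: "\<And>x. x \<in> hcar H \<Longrightarrow> h (k x) = k (h x)"
    and x: "x \<in> hcar H"
  shows "hip H (h x + \<i> *\<^sub>C k x) (h x + \<i> *\<^sub>C k x) = hip H x (h (h x) + k (k x))"
    and "hip H (h x - \<i> *\<^sub>C k x) (h x - \<i> *\<^sub>C k x) = hip H x (h (h x) + k (k x))"
  using x by (simp_all add: ip_simps op_linear[OF h(1)] op_linear[OF h(2)] selfadj_ip[OF h(1)] selfadj_ip[OF h(2)] comm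
      algebra_simps)

lemma commuting_squares_zero:
  assumes h: "adjp H H h h" "adjp H H k k" and comm: "\<And>x. x \<in> hcar H \<Longrightarrow> h (k x) = k (h x)"
    and z: "\<And>x. x \<in> hcar H \<Longrightarrow> h (h x) + k (k x) = 0" and x: "x \<in> hcar H"
  shows "h x = 0" "k x = 0"
proof -
  note [simp] = op_linear[OF h(1)] op_linear[OF h(2)] x
  have 1: "h x + \<i> *\<^sub>C k x = 0"
    using commuting_cartesian_ip(1)[OF h comm x] z[OF x] by (intro ip_definite) auto
  have 2: "h x - \<i> *\<^sub>C k x = 0"
    using commuting_cartesian_ip(2)[OF h comm x] z[OF x] by (intro ip_definite) auto
  have "2 *\<^sub>R h x = (h x + \<i> *\<^sub>C k x) + (h x - \<i> *\<^sub>C k x)"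
    by (simp add: scaleR_2)
  then show h0: "h x = 0" using 1 2 by simp
  show "k x = 0" using 1 h0 by simp
qed

lemma commuting_contraction:
  assumes h: "adjp H H h h" "adjp H H k k" and comm: "\<And>x. x \<in> hcar H \<Longrightarrow> h (k x) = k (h x)"
    and z: "\<And>x. x \<in> hcar H \<Longrightarrow> h (h x) + k (k x) = x" and x: "x \<in> hcar H"
  shows "hnorm H (h x) \<le> hnorm H x" "hnorm H (k x) \<le> hnorm H x"
proof -
  note [simp] = op_linear[OF h(1)] op_linear[OF h(2)] x
  have 1: "hnorm H (h x + \<i> *\<^sub>C k x) = hnorm H x"
    using commuting_cartesian_ip(1)[OF h comm x] z[OF x] by (simp add: hnorm_def)
  have 2: "hnorm H (h x - \<i> *\<^sub>C k x) = hnorm H x"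
    using commuting_cartesian_ip(2)[OF h comm x] z[OF x] by (simp add: hnorm_def)
  have "hnorm H (2 *\<^sub>R h x) \<le> hnorm H (h x + \<i> *\<^sub>C k x) + hnorm H (h x - \<i> *\<^sub>C k x)"
    using hnorm_triangle[of "h x + \<i> *\<^sub>C k x" "h x - \<i> *\<^sub>C k x"] by (simp add: scaleR_2)
  then show "hnorm H (h x) \<le> hnorm H x" using 1 2 by (simp add: hnorm_scaleR)
  have "(h x + \<i> *\<^sub>C k x) - (h x - \<i> *\<^sub>C k x) = (2 * \<i>) *\<^sub>C k x"
    by (simp add: scaleC.scale_left_distrib[of \<i> \<i>, symmetric] del: scaleC.scale_left_distrib)
  then have "hnorm H ((2 * \<i>) *\<^sub>C k x) \<le> hnorm H (h x + \<i> *\<^sub>C k x) + hnorm H (h x - \<i> *\<^sub>C k x)"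
    using hnorm_triangle_diff[of "h x + \<i> *\<^sub>C k x" "h x - \<i> *\<^sub>C k x"] by simp
  then show "hnorm H (k x) \<le> hnorm H x" using 1 2 by (simp add: hnorm_scaleC norm_mult)
qed

text \<open>
  With \<open>s = (1 - a\<^sup>2)\<^sup>1\<^sup>/\<^sup>2\<close> the operator \<open>a + is\<close> is unitary, hence \<open>s\<close> is a contraction and so is
  \<open>s\<^sup>2 = 1 - a\<^sup>2\<close>. This is where squares are seen to be positive.
\<close>

lemma contraction_square:
  assumes a: "adjp H H a a" and le: "\<And>x. x \<in> hcar H \<Longrightarrow> hnorm H (a x) \<le> hnorm H x" and x: "x \<in> hcar H"
  shows "hnorm H (x - a (a x)) \<le> hnorm H x"
proof -
  let ?W = "\<lambda>x. a (a x)"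
  have W: "adjp H H ?W ?W" by (rule adjp_comp[OF a a])
  have "hnorm H (?W x) \<le> hnorm H x" if "x \<in> hcar H" for x
    using le[OF that] le[of "a x"] that by (simp add: op_linear[OF a])
  with W have W: "sa_contraction H ?W" by (simp add: sa_contraction_def)
  let ?s = "\<lambda>x. x - root_lim H ?W x"
  note L = root_lim_adjp[OF W]
  note [simp] = op_linear[OF L] op_linear[OF a]
  have s: "adjp H H ?s ?s" by (intro adjp_minus inner adjp_id L)
  have ss: "?s (?s x) = x - a (a x)" if "x \<in> hcar H" for x
    using that by (simp add: root_lim_fixpoint[OF W] scaleR_2)
  have "a (root_lim H ?W x) = root_lim H ?W (a x)" if "x \<in> hcar H" for x
    by (rule root_lim_intertwine[OF cs cs W W a _ that]) simp_all
  then have comm: "a (?s x) = ?s (a x)" if "x \<in> hcar H" for x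
    using that by simp
  have one: "a (a x) + ?s (?s x) = x" if "x \<in> hcar H" for x
    unfolding ss[OF that] by simp
  have "hnorm H (?s x) \<le> hnorm H x" if "x \<in> hcar H" for x
    by (rule commuting_contraction(2)[of a ?s, OF a s comm one that])
  from order_trans[OF this[of "?s x"] this[of x]] show ?thesis
    unfolding ss[OF x] using x by simp
qed

lemma square_posop_at:
  assumes a: "adjp H H a a" and c: "c > 0" and le: "\<And>x. x \<in> hcar H \<Longrightarrow> hnorm H (a x) \<le> c * hnorm H x"
  shows "posop_at H (c\<^sup>2) (\<lambda>x. a (a x))"
  unfolding posop_at_def
proof (intro conjI ballI)
  fix x assume x: "x \<in> hcar H"
  let ?b = "\<lambda>x. (1/c) *\<^sub>R a x"
  have b: "adjp H H ?b ?b" by (intro adjp_scaleR inner a)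
  have "hnorm H (x - ?b (?b x)) \<le> hnorm H x"
    by (rule contraction_square[OF b _ x])
      (use le c in \<open>simp add: hnorm_scaleR op_linear[OF a] pos_divide_le_eq mult.commute\<close>)
  moreover have "c\<^sup>2 *\<^sub>R x - a (a x) = c\<^sup>2 *\<^sub>R (x - ?b (?b x))"
    using c x by (simp add: algebra_simps op_linear[OF a] power2_eq_square)
  ultimately show "hnorm H (c\<^sup>2 *\<^sub>R x - a (a x)) \<le> c\<^sup>2 * hnorm H x"
    using x by (simp add: hnorm_scaleR op_linear[OF a] op_linear[OF b] mult_left_mono)
qed (use c in \<open>auto intro: adjp_comp[OF a a]\<close>)

lemma square_posop:
  assumes "adjp H H a a" shows "posop H (\<lambda>x. a (a x))"
proof -
  obtain c where "c > 0" "\<And>x. x \<in> hcar H \<Longrightarrow> hnorm H (a x) \<le> c * hnorm H x"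
    by (rule adjp_bounded[OF cs cs assms]) (rule that)
  then show ?thesis using square_posop_at[OF assms] by (auto simp: posop_def)
qed

text \<open>
  Let \<open>r\<close> be the constructed root and \<open>D = r - q\<close>. All operators involved commute, and
  \<open>D r D + D q D = D (r\<^sup>2 - q\<^sup>2) = 0\<close>. Both summands are squares, of \<open>r\<^sup>1\<^sup>/\<^sup>2 D\<close> and \<open>q\<^sup>1\<^sup>/\<^sup>2 D\<close>, so both
  vanish; then \<open>r D = q D = 0\<close> and \<open>D\<^sup>2 = 0\<close>.
\<close>

lemma root_unique:
  assumes q: "posop H q" and qq: "\<And>x. x \<in> hcar H \<Longrightarrow> q (q x) = a x" and t: "posop_at H t a"
    and x: "x \<in> hcar H"
  shows "q x = pos_root H t a x"
proof -
  let ?r = "pos_root H t a"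
  obtain u where u: "posop_at H u q" using q by (auto simp: posop_def)
  define f where "f = pos_root H u q"
  define g where "g = pos_root H (sqrt t) ?r"
  note r = root[OF t]
  note g = root[OF r(2), folded g_def]
  note f = root[OF u, folded f_def]
  have sq: "adjp H H q q" using q by (rule posop_selfadj)
  define D where "D x = ?r x - q x" for x
  have D: "adjp H H D D" unfolding D_def by (intro adjp_minus inner r sq)
  note [simp] = op_linear[OF r(1)] op_linear[OF g(1)] op_linear[OF f(1)] op_linear[OF sq] r(3) g(3) f(3) qq
  have qr: "q (?r x) = ?r (q x)" if "x \<in> hcar H" for x
    by (rule root_intertwine[OF cs cs t t sq _ that]) (simp flip: qq)
  have rf: "?r (f x) = f (?r x)" if "x \<in> hcar H" for x
    unfolding f_def by (rule root_intertwine[OF cs cs u u r(1) _ that]) (simp add: qr)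
  have fg: "f (g x) = g (f x)" if "x \<in> hcar H" for x
    unfolding g_def by (rule root_intertwine[OF cs cs r(2) r(2) f(1) _ that]) (simp add: rf)
  have qg: "q (g x) = g (q x)" if "x \<in> hcar H" for x
    unfolding g_def by (rule root_intertwine[OF cs cs r(2) r(2) sq _ that]) (simp add: qr)
  have rg: "?r (g x) = g (?r x)" if "x \<in> hcar H" for x
    using that by (simp flip: g(3))
  have qf: "q (f x) = f (q x)" if "x \<in> hcar H" for x
    using that by (simp flip: f(3))
  have gD: "g (D x) = D (g x)" if "x \<in> hcar H" for x using that by (simp add: D_def rg qg)
  have fD: "f (D x) = D (f x)" if "x \<in> hcar H" for x using that by (simp add: D_def rf qf)
  have h: "adjp H H (\<lambda>x. g (D x)) (\<lambda>x. g (D x))" by (rule adjp_comp_commute[of g D, OF g(1) D gD])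
  have k: "adjp H H (\<lambda>x. f (D x)) (\<lambda>x. f (D x))" by (rule adjp_comp_commute[of f D, OF f(1) D fD])
  have hk: "g (D (f (D x))) = f (D (g (D x)))" if "x \<in> hcar H" for x
    using that by (simp add: gD fD fg op_linear[OF D])
  have sum: "g (D (g (D x))) + f (D (f (D x))) = 0" if "x \<in> hcar H" for x
  proof -
    have "g (D (g (D x))) + f (D (f (D x))) = D (?r (D x) + q (D x))"
      using that by (simp add: gD fD op_linear[OF D]) (simp add: D_def qr)
    also have "?r (D x) + q (D x) = 0"
      using that by (simp add: D_def qr)
    finally show ?thesis by (simp add: op_linear[OF D])
  qed
  have z: "g (D x) = 0" "f (D x) = 0" if "x \<in> hcar H" for x
    using commuting_squares_zero[of "\<lambda>x. g (D x)" "\<lambda>x. f (D x)", OF h k hk sum that] by auto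
  have "?r (D x) = 0" using g(3)[of "D x"] z(1)[OF x] x by (simp add: op_linear[OF D])
  moreover have "q (D x) = 0" using f(3)[of "D x"] z(2)[OF x] x by (simp add: op_linear[OF D])
  ultimately have "D (D x) = 0" by (simp add: D_def[of "D x"])
  then have "hip H (D x) (D x) = 0" using selfadj_ip[OF D x, of "D x"] x by (simp add: op_linear[OF D])
  then have "D x = 0" using x by (intro ip_definite) (simp_all add: op_linear[OF D])
  then show ?thesis by (simp add: D_def)
qed

lemma posop_unique_root:
  assumes "posop H q" "posop H r" "\<And>x. x \<in> hcar H \<Longrightarrow> q (q x) = a x" "\<And>x. x \<in> hcar H \<Longrightarrow> r (r x) = a x"
    and x: "x \<in> hcar H"
  shows "q x = r x"
proof -
  have "posop H (\<lambda>x. r (r x))"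
    using assms(2) by (intro square_posop posop_selfadj)
  then obtain t where t: "posop_at H t (\<lambda>x. r (r x))" by (auto simp: posop_def)
  show ?thesis
    using root_unique[OF assms(1) _ t x] root_unique[OF assms(2) _ t x] assms(3,4) by simp
qed

lemma ip_kernel: "\<lbrakk>adjp H K T S; inner_module K; x \<in> hcar H; S (T x) = 0\<rbrakk> \<Longrightarrow> T x = 0"
  using adjp_ip[of H K T S x "T x"] adjp_car[of H K T S x] inner_module.ip_definite[of K "T x"] by simp

lemma posop_scaleR:
  assumes "posop H a" "r > 0" shows "posop H (\<lambda>x. r *\<^sub>R a x)"
proof -
  from assms obtain t where t: "posop_at H t a" by (auto simp: posop_def)
  then have a: "adjp H H a a" "t > 0" by (auto simp: posop_at_def)
  have "hnorm H ((r * t) *\<^sub>R x - r *\<^sub>R a x) \<le> (r * t) * hnorm H x" if x: "x \<in> hcar H" for x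
  proof -
    have "hnorm H ((r * t) *\<^sub>R x - r *\<^sub>R a x) = hnorm H (r *\<^sub>R (t *\<^sub>R x - a x))"
      by (simp add: algebra_simps)
    also have "\<dots> = r * hnorm H (t *\<^sub>R x - a x)"
      using x assms(2) by (simp add: hnorm_scaleR op_linear[OF a(1)])
    also have "\<dots> \<le> r * (t * hnorm H x)"
      using t x assms(2) by (intro mult_left_mono) (auto simp: posop_at_def)
    finally show ?thesis by (simp add: mult.assoc)
  qed
  then show ?thesis using a assms(2) unfolding posop_def posop_at_def
    by (intro exI[of _ "r * t"]) (auto intro: adjp_scaleR inner)
qed

lemma bounded_imp_posop_diff:
  assumes a: "adjp H H a a" and "t > 0" and le: "\<And>x. x \<in> hcar H \<Longrightarrow> hnorm H (a x) \<le> t * hnorm H x"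
  shows "posop H (\<lambda>x. t *\<^sub>R x - a x)"
  unfolding posop_def posop_at_def
  using assms by (intro exI[of _ t]) (auto intro!: adjp_minus adjp_scaleR adjp_id inner)

text \<open>
  Take \<open>h\<close> and \<open>k\<close> to be the roots of \<open>p / t\<close> and \<open>1 - p / t\<close>. They commute and \<open>h\<^sup>2 + k\<^sup>2 = 1\<close>, so
  \<open>h\<close> is a contraction.
\<close>

lemma posop_le_imp_bounded:
  assumes p: "posop H p" and tp: "posop H (\<lambda>x. t *\<^sub>R x - p x)" and "t > 0" and x: "x \<in> hcar H"
  shows "hnorm H (p x) \<le> t * hnorm H x"
proof -
  obtain u where u: "posop_at H u p" "posop_at H u (\<lambda>x. t *\<^sub>R x - p x)" using posop_common[OF p tp] .
  define f where "f = pos_root H u p"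
  define g where "g = pos_root H u (\<lambda>x. t *\<^sub>R x - p x)"
  note f = root[OF u(1), folded f_def] and g = root[OF u(2), folded g_def]
  have sp: "adjp H H p p" using p by (rule posop_selfadj)
  note [simp] = op_linear[OF f(1)] op_linear[OF g(1)] op_linear[OF sp] f(3) g(3)
  have pf: "p (f x) = f (p x)" if "x \<in> hcar H" for x
    using that by (simp flip: f(3))
  have fg: "f (g x) = g (f x)" if "x \<in> hcar H" for x
    unfolding g_def by (rule root_intertwine[OF cs cs u(2) u(2) f(1) _ that]) (simp add: pf)
  let ?c = "1 / sqrt t"
  have cc: "?c * ?c = 1 / t" using \<open>t > 0\<close> by simp
  let ?h = "\<lambda>x. ?c *\<^sub>R f x" and ?k = "\<lambda>x. ?c *\<^sub>R g x"
  have h: "adjp H H ?h ?h" and k: "adjp H H ?k ?k" by (intro adjp_scaleR inner f g)+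
  have "?h (?h x) + ?k (?k x) = x" if "x \<in> hcar H" for x
    using that \<open>t > 0\<close> by (simp add: cc scaleR_right_diff_distrib)
  then have le: "hnorm H (?h x) \<le> hnorm H x" if "x \<in> hcar H" for x
    using commuting_contraction(1)[of ?h ?k, OF h k _ _ that] fg by simp
  have "p x = t *\<^sub>R ?h (?h x)" using x \<open>t > 0\<close> by (simp add: cc)
  moreover have "hnorm H (?h (?h x)) \<le> hnorm H x"
    using order_trans[OF le[of "?h x"] le[OF x]] x by simp
  ultimately show ?thesis using x \<open>t > 0\<close> by (simp add: hnorm_scaleR pos_divide_le_eq mult.commute)
qed

end

section \<open>Positivity of \<open>R* R\<close>\<close>

text \<open>
  Here \<open>n\<close> is the negative part \<open>(|a| - a) / 2\<close> and \<open>r = |a|\<^sup>1\<^sup>/\<^sup>2\<close>. On the range of \<open>n\<close> the operator \<open>a\<close> acts as \<open>- |a|\<close>, and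
  if \<open>|a|\<close> vanishes there then \<open>n\<^sup>2 = 0\<close>, so \<open>a = |a|\<close>.
\<close>

lemma negative_part:
  assumes H: "cs_module H" and a: "adjp H H a a"
  obtains n r where "adjp H H n n" "adjp H H r r"
    "\<And>x. x \<in> hcar H \<Longrightarrow> n (r x) = r (n x)"
    "\<And>x. x \<in> hcar H \<Longrightarrow> a (n x) = - r (r (n x))"
    "(\<And>x. x \<in> hcar H \<Longrightarrow> r (n x) = 0) \<Longrightarrow> posop H a"
proof -
  interpret cs_module H by fact
  obtain t where t: "posop_at H t (\<lambda>x. a (a x))"
    using square_posop[OF a] by (auto simp: posop_def)
  define m where "m = pos_root H t (\<lambda>x. a (a x))"
  note m = root[OF t, folded m_def]
  define r where "r = pos_root H (sqrt t) m"
  note r = root[OF m(2), folded r_def]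
  note [simp] = op_linear[OF m(1)] op_linear[OF r(1)] op_linear[OF a] m(3)
  have am: "a (m x) = m (a x)" if "x \<in> hcar H" for x
    unfolding m_def by (rule root_intertwine[OF H H t t a _ that]) simp
  have ar: "a (r x) = r (a x)" if "x \<in> hcar H" for x
    unfolding r_def by (rule root_intertwine[OF H H m(2) m(2) a _ that]) (simp add: am)
  have mr: "m (r x) = r (m x)" if "x \<in> hcar H" for x
    using that by (simp flip: r(3))
  define n where "n x = (1/2) *\<^sub>R (m x - a x)" for x
  have n: "adjp H H n n" unfolding n_def by (intro adjp_scaleR adjp_minus inner m a)
  have pm: "posop H m" using m(2) by (auto simp: posop_def)
  show thesis
  proof (rule that[OF n r(1)])
    fix x assume x: "x \<in> hcar H"
    then show "n (r x) = r (n x)" by (simp add: n_def ar mr)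
    from x show an: "a (n x) = - r (r (n x))" by (simp add: r(3) op_linear[OF n]) (simp add: n_def am algebra_simps)
  next
    assume z: "\<And>x. x \<in> hcar H \<Longrightarrow> r (n x) = 0"
    have "a x = m x" if x: "x \<in> hcar H" for x
    proof -
      have mn: "m (n x) = 0" using r(3)[of "n x"] z[OF x] x by (simp add: op_linear[OF n])
      have an: "a (n x) = - m (n x)" using x by (simp add: n_def am algebra_simps)
      have "n (n x) = 0" unfolding n_def[of "n x"] using mn an by simp
      then have "n x = 0" by (rule ip_kernel[OF n inner x])
      then show ?thesis by (simp add: n_def)
    qed
    then show "posop H a" by (rule posop_cong[OF pm])
  qed
qed

text \<open>
  Kaplansky's argument, with functional calculus reduced to square roots. Let \<open>n\<close> be the negative
  part of \<open>R* R\<close> and \<open>c = R n\<close>. Then \<open>c* c = - p\<close> with \<open>p\<close> a square, and \<open>q = c c*\<close> is positive,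
  being \<open>p\<close> plus the sum of squares \<open>c* c + c c*\<close>. Now \<open>c p = - q c\<close>, so \<open>c p\<^sup>2 = q\<^sup>2 c\<close>, and taking square roots gives
  \<open>c p = q c\<close>. Thus \<open>q c = 0\<close>, hence \<open>c = 0\<close>, \<open>p = 0\<close> and finally \<open>n = 0\<close>.
\<close>

lemma kaplansky:
  assumes H: "cs_module H" and R: "adjp H H R R'"
  shows "posop H (\<lambda>x. R' (R x))"
proof -
  interpret cs_module H by fact
  note R' = adjp_sym[OF inner inner R]
  let ?a = "\<lambda>x. R' (R x)"
  have a: "adjp H H ?a ?a" by (rule adjp_comp[OF R R'])
  obtain n r where n: "adjp H H n n" and r: "adjp H H r r"
    and nr: "\<And>x. x \<in> hcar H \<Longrightarrow> n (r x) = r (n x)"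
    and an: "\<And>x. x \<in> hcar H \<Longrightarrow> R' (R (n x)) = - r (r (n x))"
    and goal: "(\<And>x. x \<in> hcar H \<Longrightarrow> r (n x) = 0) \<Longrightarrow> posop H ?a"
    using negative_part[OF H a] by blast
  note [simp] = op_linear[OF R] op_linear[OF R'] op_linear[OF n] op_linear[OF r]
  define c where "c x = R (n x)" for x
  define c' where "c' x = n (R' x)" for x
  define h where "h x = r (n x)" for x
  have c: "adjp H H c c'" unfolding c_def c'_def by (rule adjp_comp[OF n R])
  have c': "adjp H H c' c" by (rule adjp_sym[OF inner inner c])
  have h: "adjp H H h h" unfolding h_def by (rule adjp_comp_commute[OF r n]) (simp add: nr)
  note [simp] = op_linear[OF c] op_linear[OF c'] op_linear[OF h]
  have c'c: "c' (c x) = - h (h x)" if "x \<in> hcar H" for x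
    using that by (simp add: c_def c'_def h_def an nr)
  define p where "p x = h (h x)" for x
  define q where "q x = c (c' x)" for x
  have p: "posop H p" unfolding p_def by (rule square_posop[OF h])
  have q: "posop H q"
  proof -
    (* Up to scaling, u and v are the real and imaginary parts of c:
       u^2 + v^2 = 2 (c' c + c c'). *)
    define u where "u x = c x + c' x" for x
    define v where "v x = \<i> *\<^sub>C (c x - c' x)" for x
    have u: "adjp H H u u"
      by (rule adjp_cong[OF adjp_plus[OF inner inner c c']]) (simp_all add: u_def add.commute)
    have v: "adjp H H v v"
      by (rule adjp_cong[OF adjp_scaleC[OF inner inner adjp_minus[OF inner inner c c'], of \<i>]])
        (simp_all add: v_def scaleC_add_right scaleC.scale_right_diff_distrib)
    have "posop H (\<lambda>x. (u (u x) + v (v x)) + (p x + p x))"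
      by (intro posop_plus square_posop u v p)
    moreover have "(u (u x) + v (v x)) + (p x + p x) = 2 *\<^sub>R q x" if "x \<in> hcar H" for x
      using that by (simp add: u_def v_def p_def q_def c'c scaleR_2 scaleC.scale_right_diff_distrib)
    ultimately have "posop H (\<lambda>x. 2 *\<^sub>R q x)" by (auto elim!: posop_cong)
    from posop_scaleR[OF this, of "1/2"] show ?thesis by simp
  qed
  have sp: "adjp H H p p" and sq: "adjp H H q q" using p q by (auto intro: posop_selfadj)
  note [simp] = op_linear[OF sp] op_linear[OF sq]
  have cp: "c (p x) = - q (c x)" if "x \<in> hcar H" for x
    using that c'c[OF that] by (simp add: p_def q_def)
  have pp: "posop H (\<lambda>x. p (p x))" "posop H (\<lambda>x. q (q x))"
    by (intro square_posop sp sq)+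
  obtain t where t: "posop_at H t (\<lambda>x. p (p x))" "posop_at H t (\<lambda>x. q (q x))"
    using posop_common[OF pp] .
  have cpq: "c (p x) = q (c x)" if x: "x \<in> hcar H" for x
  proof -
    have "c (pos_root H t (\<lambda>x. p (p x)) x) = pos_root H t (\<lambda>x. q (q x)) (c x)"
      by (rule root_intertwine[OF H H t c _ x]) (simp add: cp)
    moreover have "p x = pos_root H t (\<lambda>x. p (p x)) x" by (rule root_unique[OF p _ t(1) x]) simp
    moreover have "q (c x) = pos_root H t (\<lambda>x. q (q x)) (c x)" by (rule root_unique[OF q _ t(2)]) (simp_all add: x)
    ultimately show ?thesis by simp
  qed
  have qc: "q (c x) = 0" if "x \<in> hcar H" for x
  proof -
    have "q (c x) = - q (c x)" using cp[OF that] cpq[OF that] by simp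
    then have "2 *\<^sub>R q (c x) = 0" by (metis scaleR_2 add.right_inverse)
    then show ?thesis by simp
  qed
  have q0: "q x = 0" if x: "x \<in> hcar H" for x
    by (rule ip_kernel[OF sq inner x]) (use qc[of "c' x"] x in \<open>simp add: q_def[of x]\<close>)
  have c'0: "c' x = 0" if x: "x \<in> hcar H" for x
    by (rule ip_kernel[OF c' inner x]) (use q0[OF x] in \<open>simp add: q_def\<close>)
  have "h x = 0" if x: "x \<in> hcar H" for x
    by (rule ip_kernel[OF h inner x]) (use c'c[OF x] c'0[of "c x"] x in simp)
  then show ?thesis by (intro goal) (simp add: h_def)
qed

section \<open>The order of the scalars and the Cauchy-Schwarz inequality\<close>

definition self_mod :: "('a::cstar_algebra, 'a) hmod" where
  "self_mod = \<lparr>hcar = UNIV, hact = (*), hip = (\<lambda>a b. star a * b)\<rparr>"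

lemma self_mod_simps [simp]:
  "hcar self_mod = UNIV" "hact self_mod = (*)" "hip self_mod a b = star a * b"
  by (simp_all add: self_mod_def)

lemma hnorm_self_mod [simp]: "hnorm self_mod a = norm (a::'a::cstar_algebra)"
  by (simp add: hnorm_def cstar_identity)

lemma star_mult_self_eq_0: "star a * a = 0 \<longleftrightarrow> a = (0::'a::cstar_algebra)"
  using cstar_identity[of a] by auto

interpretation self: cs_module "self_mod :: ('a::cstar_algebra, 'a) hmod"
proof
  show "hcomplete (self_mod :: ('a, 'a) hmod)"
    unfolding hcomplete_def
  proof (intro allI impI)
    fix s :: "nat \<Rightarrow> 'a"
    assume "(\<forall>n. s n \<in> hcar self_mod) \<and>
      (\<forall>e>0. \<exists>N. \<forall>m\<ge>N. \<forall>n\<ge>N. hnorm self_mod (s m - s n) < e)"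
    then have "Cauchy s" by (simp add: Cauchy_def dist_norm)
    then obtain l where "s \<longlonglongrightarrow> l" using Cauchy_convergent convergent_def by blast
    then show "\<exists>x\<in>hcar self_mod. (\<lambda>n. hnorm self_mod (s n - x)) \<longlonglongrightarrow> 0"
      by (auto simp: LIM_zero_iff tendsto_norm_zero_iff intro!: exI[of _ l])
  qed
next
  fix x y :: 'a
  show "norm (hip self_mod x y) \<le> hnorm self_mod x * hnorm self_mod y"
    using norm_mult_ineq[of "star x" y] by simp
qed (simp_all add: submodule_def distrib_left mult_scaleC_right mult.assoc star_mult star_star
    star_mult_self_eq_0)

lemma left_mult_eqI:
  assumes "\<And>x. a * x = b * x" shows "a = (b::'a::cstar_algebra)"
proof -
  have "star (star (a - b)) * star (a - b) = 0"
    using assms by (simp add: star_star left_diff_distrib)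
  then have "star (a - b) = 0" by (simp only: star_mult_self_eq_0)
  then show ?thesis by (metis eq_iff_diff_eq_0 star_star star_zero)
qed

lemma norm_left_mult_le:
  assumes "0 \<le> c" "\<And>x. norm (a * x) \<le> c * norm x" shows "norm (a::'a::cstar_algebra) \<le> c"
proof (cases "a = 0")
  case False
  have "norm a * norm a \<le> c * norm a"
    using assms(2)[of "star a"] cstar_identity[of "star a"] by (simp add: star_star power2_eq_square)
  then show ?thesis using False by simp
qed (use assms(1) in simp)

lemma adjp_left_mult: "adjp self_mod self_mod ((*) a) ((*) (star a))"
  by (rule adjpI) (simp_all add: star_mult mult.assoc)

lemma adjp_left_mult_iff: "adjp self_mod self_mod ((*) a) ((*) a) \<longleftrightarrow> star a = (a::'a::cstar_algebra)"
proof
  assume a: "adjp self_mod self_mod ((*) a) ((*) a)"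
  show "star a = a"
    by (rule left_mult_eqI) (simp add: adjp_unique[OF self.inner self.inner a adjp_left_mult])
next
  assume a: "star a = a"
  show "adjp self_mod self_mod ((*) a) ((*) a)" using adjp_left_mult[of a] unfolding a .
qed

text \<open>
  Without a unit the iterates \<open>Y\<close> are not multiplications by elements of the algebra, but they are of
  the form \<open>y - b\<close> with a number \<open>y\<close> and an element \<open>b\<close>. Since \<open>y\<close> tends to \<open>1\<close>, the number disappears from
  \<open>1 - Y\<close> in the limit and the square root is multiplication by an element of the algebra.
\<close>

lemma posop_left_mult_imp_square:
  assumes "posop self_mod ((*) a)"
  obtains r where "star r = r" "a = r * (r::'a::cstar_algebra)"
proof -
  obtain t where t: "posop_at self_mod t ((*) a)" using assms by (auto simp: posop_def)
  then have "t > 0" by (simp add: posop_at_def)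
  note d = self.root_defect[OF t]
  let ?Y = "root_iter (root_defect t ((*) a))"
  define b where "b = rec_nat 0 (\<lambda>n b. (1/2) *\<^sub>R ((1/t) *\<^sub>R a + (2 * root_bound n) *\<^sub>R b - b * b))"
  have b0: "b 0 = 0"
    and bS: "b (Suc n) = (1/2) *\<^sub>R ((1/t) *\<^sub>R a + (2 * root_bound n) *\<^sub>R b n - b n * b n)" for n
    by (simp_all add: b_def)
  have Y: "?Y n x = root_bound n *\<^sub>R x - b n * x" for n x
  proof (induction n arbitrary: x)
    case (Suc n)
    let ?r = "root_bound n"
    have "?Y (Suc n) x = (1/2) *\<^sub>R (x - (1/t) *\<^sub>R (a * x) + ?Y n (?Y n x))"
      by (simp add: root_defect_def)
    also have "?Y n (?Y n x) = ?r *\<^sub>R (?r *\<^sub>R x - b n * x) - b n * (?r *\<^sub>R x - b n * x)"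
      by (simp only: Suc)
    also have "(1/2) *\<^sub>R (x - (1/t) *\<^sub>R (a * x) + \<dots>) = root_bound (Suc n) *\<^sub>R x - b (Suc n) * x"
      by (simp add: bS algebra_simps power2_eq_square add_divide_distrib) (simp flip: scaleR_add_left)
    finally show ?case .
  qed (simp add: b0)
  have diff: "norm (b m - b n) \<le> 2 * (root_bound m - root_bound n)" if "n \<le> m" for m n
  proof (rule norm_left_mult_le)
    fix x
    have "(b m - b n) * x = (root_bound m - root_bound n) *\<^sub>R x - (?Y m x - ?Y n x)"
      unfolding Y by (simp add: algebra_simps)
    also have "norm \<dots> \<le> norm ((root_bound m - root_bound n) *\<^sub>R x) + norm (?Y m x - ?Y n x)"
      by (rule norm_triangle_ineq4)
    also have "norm ((root_bound m - root_bound n) *\<^sub>R x) = (root_bound m - root_bound n) * norm x"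
      using root_bound_mono[OF that] by simp
    also have "(root_bound m - root_bound n) * norm x + norm (?Y m x - ?Y n x)
        \<le> (root_bound m - root_bound n) * norm x + (root_bound m - root_bound n) * norm x"
      using self.root_iter_diff[OF d _ that, of x] by (intro add_left_mono) simp
    also have "\<dots> = 2 * (root_bound m - root_bound n) * norm x" by simp
    finally show "norm ((b m - b n) * x) \<le> 2 * (root_bound m - root_bound n) * norm x" .
  qed (simp add: root_bound_mono[OF that])
  have "Cauchy b"
  proof (rule metric_CauchyI)
    fix e :: real assume "e > 0"
    then obtain N where N: "\<And>m n. \<lbrakk>m \<ge> N; n \<ge> N\<rbrakk> \<Longrightarrow> \<bar>root_bound m - root_bound n\<bar> < e / 2"
      using LIMSEQ_imp_Cauchy[OF root_bound_lim] unfolding Cauchy_def dist_real_def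
      by (metis half_gt_zero)
    have "dist (b m) (b n) < e" if "m \<ge> N" "n \<ge> N" for m n
    proof -
      have "norm (b m - b n) \<le> 2 * \<bar>root_bound m - root_bound n\<bar>"
      proof (cases "n \<le> m")
        case True
        then show ?thesis using diff[OF True] root_bound_mono[OF True] by simp
      next
        case False
        then have "m \<le> n" by simp
        then show ?thesis using diff[of m n] root_bound_mono[of m n] by (simp add: norm_minus_commute)
      qed
      also have "\<dots> < 2 * (e / 2)" using N[OF that] by (intro mult_strict_left_mono) simp_all
      finally show ?thesis by (simp add: dist_norm)
    qed
    then show "\<exists>N. \<forall>m\<ge>N. \<forall>n\<ge>N. dist (b m) (b n) < e" by blast
  qed
  then obtain l where l: "b \<longlonglongrightarrow> l" using Cauchy_convergent convergent_def by blast
  have "root_lim self_mod (root_defect t ((*) a)) x = x - l * x" for x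
    unfolding root_lim_def
  proof (rule self.hlim_eq)
    have "(\<lambda>n. ?Y n x) \<longlonglongrightarrow> 1 *\<^sub>R x - l * x"
      unfolding Y by (intro tendsto_intros root_bound_lim l)
    then show "(\<lambda>n. hnorm self_mod (?Y n x - (x - l * x))) \<longlonglongrightarrow> 0"
      by (simp add: tendsto_norm_zero_iff LIM_zero_iff)
  qed simp_all
  then have root: "pos_root self_mod t ((*) a) = (*) (sqrt t *\<^sub>R l)"
    by (simp add: pos_root_def fun_eq_iff)
  show thesis
  proof (rule that)
    show "star (sqrt t *\<^sub>R l) = sqrt t *\<^sub>R l"
      using self.root_adjp[OF t] unfolding root adjp_left_mult_iff .
    show "a = (sqrt t *\<^sub>R l) * (sqrt t *\<^sub>R l)"
      by (rule left_mult_eqI) (use self.root_square[OF t] in \<open>simp add: root mult.assoc\<close>)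
  qed
qed

lemma cstar_pos_iff_posop: "cstar_pos a \<longleftrightarrow> posop self_mod ((*) (a::'a::cstar_algebra))"
proof
  assume "cstar_pos a"
  then obtain b where "a = star b * b" by (auto simp: cstar_pos_def)
  then show "posop self_mod ((*) a)"
    using kaplansky[OF self.cs adjp_left_mult, of b]
    by (rule_tac self.posop_cong) (auto simp: mult.assoc)
next
  assume "posop self_mod ((*) a)"
  then show "cstar_pos a"
    by (metis posop_left_mult_imp_square cstar_pos_def)
qed

lemma cstar_pos_selfadj: "cstar_pos a \<Longrightarrow> star a = a"
  by (auto simp: cstar_pos_def star_mult star_star)

lemma cstar_pos_star_mult: "cstar_pos (star a * a)"
  by (auto simp: cstar_pos_def)

lemma cstar_pos_add: "\<lbrakk>cstar_pos a; cstar_pos b\<rbrakk> \<Longrightarrow> cstar_pos (a + b)"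
  unfolding cstar_pos_iff_posop
  by (drule (1) self.posop_plus) (simp add: distrib_right[symmetric])

lemma cstar_pos_scaleR: "\<lbrakk>cstar_pos a; r \<ge> 0\<rbrakk> \<Longrightarrow> cstar_pos (r *\<^sub>R a)"
proof -
  assume "cstar_pos a" "r \<ge> 0"
  then obtain b where "a = star b * b" by (auto simp: cstar_pos_def)
  then have "r *\<^sub>R a = star (sqrt r *\<^sub>R b) * (sqrt r *\<^sub>R b)" using \<open>r \<ge> 0\<close> by (simp add: star_scaleR)
  then show ?thesis by (metis cstar_pos_star_mult)
qed

text \<open>
  Both \<open>a\<close> and \<open>- a\<close> are positive roots of \<open>a\<^sup>2\<close>.
\<close>

lemma cstar_pos_antisym:
  assumes "cstar_pos a" "cstar_pos (- a)" shows "a = 0"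
proof -
  have eq: "a * x = - (a * x)" for x
    using self.posop_unique_root[of "(*) a" "(*) (- a)" "\<lambda>x. a * (a * x)" x] assms
    by (simp add: cstar_pos_iff_posop)
  have "2 *\<^sub>R (a * x) = 0" for x by (metis eq[of x] scaleR_2 add.right_inverse)
  then have "2 *\<^sub>R a * x = 0 * x" for x by simp
  then have "2 *\<^sub>R a = 0" by (rule left_mult_eqI)
  then show ?thesis by simp
qed

text \<open>
  With \<open>t = \<parallel>p + q\<parallel>\<close>, the operator \<open>t - p = (t - (p + q)) + q\<close> is positive, so \<open>p\<close> is
  bounded by \<open>t\<close>.
\<close>

lemma cstar_pos_norm_mono:
  assumes p: "cstar_pos p" and q: "cstar_pos q"
  shows "norm p \<le> norm (p + q)"
proof (cases "p + q = 0")
  case True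
  then have "q = - p" by (simp add: add_eq_0_iff)
  with cstar_pos_antisym[OF p] q show ?thesis by simp
next
  case False
  let ?t = "norm (p + q)"
  have "posop self_mod (\<lambda>x. ?t *\<^sub>R x - (p + q) * x)"
    using False cstar_pos_selfadj[OF cstar_pos_add[OF p q]]
    by (intro self.bounded_imp_posop_diff) (simp_all add: adjp_left_mult_iff norm_mult_ineq)
  then have "posop self_mod (\<lambda>x. ?t *\<^sub>R x - (p + q) * x + q * x)"
    using q by (intro self.posop_plus) (simp_all add: cstar_pos_iff_posop)
  then have "posop self_mod (\<lambda>x. ?t *\<^sub>R x - p * x)" by (simp add: algebra_simps)
  then show ?thesis
    using self.posop_le_imp_bounded[of "(*) p" ?t] p False
    by (rule_tac norm_left_mult_le) (simp_all add: cstar_pos_iff_posop)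
qed

lemma cstar_pos_compress:
  assumes "star c = (c::'a::cstar_algebra)" shows "cstar_pos (norm c *\<^sub>R (star a * a) - star a * (c * a))"
proof (cases "c = 0")
  case False
  then have "posop self_mod (\<lambda>x. norm c *\<^sub>R x - c * x)"
    using assms by (intro self.bounded_imp_posop_diff) (simp_all add: adjp_left_mult_iff norm_mult_ineq)
  then obtain t where t: "posop_at self_mod t (\<lambda>x. norm c *\<^sub>R x - c * x)" by (auto simp: posop_def)
  define r where "r = pos_root self_mod t (\<lambda>x. norm c *\<^sub>R x - c * x)"
  note r = self.root[OF t, folded r_def]
  have "star (r a) * r a = star a * r (r a)"
    using adjp_ip[OF r(1), of a "r a"] by simp
  also have "\<dots> = norm c *\<^sub>R (star a * a) - star a * (c * a)"
    using r(3) by (simp add: right_diff_distrib)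
  finally show ?thesis by (metis cstar_pos_star_mult)
qed (use cstar_pos_star_mult[of 0] in simp)

lemma hilbert_module_inner: "hilbert_module H \<Longrightarrow> inner_module H"
  unfolding hilbert_module_def inner_module_def by blast

text \<open>
  With \<open>a = \<langle>x, y\<rangle>\<close> and \<open>k = \<parallel>x\<parallel>\<^sup>2\<close>, expand \<open>\<langle>k y - x a, k y - x a\<rangle> \<ge> 0\<close> and use
  \<open>a* \<langle>x, x\<rangle> a \<le> k a* a\<close> to obtain \<open>k a* a \<le> k\<^sup>2 \<langle>y, y\<rangle>\<close>; then take norms.
\<close>

lemma hilbert_module_cs:
  assumes "hilbert_module H" shows "cs_module H"
proof -
  interpret inner_module H using assms by (rule hilbert_module_inner)
  have pos: "cstar_pos (hip H x x)" if "x \<in> hcar H" for x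
    using assms that by (rule hilbert_module.ip_pos)
  show ?thesis
  proof
    fix x y assume x: "x \<in> hcar H" and y: "y \<in> hcar H"
    show "norm (hip H x y) \<le> hnorm H x * hnorm H y"
    proof (cases "hip H x x = 0")
      case True
      then have "x = 0" using ip_definite x by blast
      then show ?thesis using y by simp
    next
      case False
      define c where "c = hip H x x"
      define k where "k = norm c"
      define a where "a = hip H x y"
      have k: "k > 0" using False by (simp add: k_def c_def)
      have a': "hip H y x = star a" using ip_star[OF x y] by (simp add: a_def)
      let ?z = "k *\<^sub>R y - hact H x a"
      have "cstar_pos (hip H ?z ?z)" using x y by (intro pos) simp
      moreover have "cstar_pos (k *\<^sub>R (star a * a) - star a * (c * a))"
        unfolding k_def using ip_star[OF x x] by (intro cstar_pos_compress) (simp add: c_def)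
      ultimately have "cstar_pos (hip H ?z ?z + (k *\<^sub>R (star a * a) - star a * (c * a)))"
        by (rule cstar_pos_add)
      moreover have "hip H ?z ?z + (k *\<^sub>R (star a * a) - star a * (c * a))
          = k\<^sup>2 *\<^sub>R hip H y y - k *\<^sub>R (star a * a)"
        using x y by (simp add: ip_simps ip_act ip_act_left a' mult.assoc algebra_simps power2_eq_square
            flip: a_def c_def)
      ultimately have "cstar_pos (k\<^sup>2 *\<^sub>R hip H y y - k *\<^sub>R (star a * a))" by simp
      from cstar_pos_norm_mono[OF cstar_pos_scaleR[OF cstar_pos_star_mult[of a], of k] this] k
      have "k * (norm a)\<^sup>2 \<le> k\<^sup>2 * norm (hip H y y)"
        by (simp add: cstar_identity)
      then have "(norm a)\<^sup>2 \<le> k * norm (hip H y y)"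
        using k by (simp add: power2_eq_square mult.assoc)
      also have "\<dots> = (hnorm H x * hnorm H y)\<^sup>2"
        by (simp add: power_mult_distrib hnorm_sq k_def c_def)
      finally show ?thesis unfolding a_def by (rule power2_le_imp_le) simp
    qed
  qed
qed

section \<open>Adjointable operators, their square roots and moduli\<close>

text \<open>
  On the negative part \<open>n\<close> of \<open>a\<close> the hypothesis reads \<open>- \<langle>r n x, r n x\<rangle> \<ge> 0\<close>, so \<open>r n = 0\<close>. Unlike
  Kaplansky's lemma this also covers \<open>T* T\<close> for \<open>T\<close> between different modules.
\<close>

lemma positive_ip_imp_posop:
  assumes H: "hilbert_module H" and a: "adjp H H a a"
    and pos: "\<And>x. x \<in> hcar H \<Longrightarrow> cstar_pos (hip H x (a x))"
  shows "posop H a"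
proof -
  interpret cs_module H using H by (rule hilbert_module_cs)
  obtain n r where n: "adjp H H n n" and r: "adjp H H r r"
    and "\<And>x. x \<in> hcar H \<Longrightarrow> n (r x) = r (n x)"
    and an: "\<And>x. x \<in> hcar H \<Longrightarrow> a (n x) = - r (r (n x))"
    and goal: "(\<And>x. x \<in> hcar H \<Longrightarrow> r (n x) = 0) \<Longrightarrow> posop H a"
    using negative_part[OF cs a] by blast
  note [simp] = op_linear[OF n] op_linear[OF r] op_linear[OF a]
  show ?thesis
  proof (rule goal)
    fix x assume x: "x \<in> hcar H"
    have "hip H (n x) (a (n x)) = - hip H (r (n x)) (r (n x))"
      using x by (simp add: an ip_minus selfadj_ip[OF r])
    then have "cstar_pos (- hip H (r (n x)) (r (n x)))"
      using pos[of "n x"] x by simp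
    moreover have "cstar_pos (hip H (r (n x)) (r (n x)))"
      using x by (intro hilbert_module.ip_pos[OF H]) simp
    ultimately have "hip H (r (n x)) (r (n x)) = 0" by (intro cstar_pos_antisym)
    then show "r (n x) = 0" using x by (intro ip_definite) simp_all
  qed
qed

lemma posop_imp_positive_ip:
  assumes H: "hilbert_module H" and a: "posop H a" and x: "x \<in> hcar H"
  shows "cstar_pos (hip H x (a x))"
proof -
  interpret cs_module H using H by (rule hilbert_module_cs)
  obtain t where t: "posop_at H t a" using a by (auto simp: posop_def)
  have "hip H x (a x) = hip H (pos_root H t a x) (pos_root H t a x)"
    using x by (simp add: selfadj_ip[OF root_adjp[OF t]] op_linear[OF root_adjp[OF t]] root_square[OF t])
  then show ?thesis
    using x hilbert_module.ip_pos[OF H, of "pos_root H t a x"] by (simp add: op_linear[OF root_adjp[OF t]])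
qed

lemma adj_eq:
  assumes "inner_module H" "inner_module K" "adjp H K T S"
  shows "adj H K T = restrict S (hcar K)"
  unfolding adj_def
proof (rule the_equality)
  show "restrict S (hcar K) \<in> hcar K \<rightarrow>\<^sub>E hcar H \<and>
    (\<forall>x\<in>hcar H. \<forall>y\<in>hcar K. hip K (T x) y = hip H x (restrict S (hcar K) y))"
    using assms(3) by (auto simp: adjp_def)
next
  fix S' assume S': "S' \<in> hcar K \<rightarrow>\<^sub>E hcar H \<and>
    (\<forall>x\<in>hcar H. \<forall>y\<in>hcar K. hip K (T x) y = hip H x (S' y))"
  then have "adjp H K T S'" using assms(3) by (auto simp: adjp_def)
  then show "S' = restrict S (hcar K)"
    using adjp_unique[OF assms] S' by (intro extensionalityI[of _ "hcar K"]) (auto simp: PiE_def)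
qed

lemma adj_apply:
  assumes "inner_module H" "inner_module K" "adjp H K T S" "y \<in> hcar K"
  shows "adj H K T y = S y"
  using adj_eq[OF assms(1-3)] assms(4) by simp

lemma adjointables_extensional: "T \<in> adjointables H K \<Longrightarrow> T \<in> extensional (hcar H)"
  by (auto simp: adjointables_def PiE_def)

lemma adjointables_adjp:
  assumes "inner_module H" "inner_module K" "T \<in> adjointables H K"
  shows "adjp H K T (adj H K T)"
proof -
  obtain S where S: "adjp H K T S"
    using assms(3) unfolding adjointables_def adjp_def by (auto simp: PiE_iff)
  show ?thesis by (rule adjp_cong[OF S]) (simp_all add: adj_apply[OF assms(1,2) S])
qed

lemma adjp_restrict_adjointables:
  assumes "adjp H K T S" shows "restrict T (hcar H) \<in> adjointables H K"
  using assms unfolding adjointables_def adjp_def by (intro CollectI conjI bexI[of _ "restrict S (hcar K)"]) auto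

lemma adjointablesI:
  assumes "adjp H K T S" "T \<in> extensional (hcar H)" shows "T \<in> adjointables H K"
  using adjp_restrict_adjointables[OF assms(1)] extensional_restrict[OF assms(2)] by simp

lemma adj_adjointables:
  assumes "inner_module H" "inner_module K" "T \<in> adjointables H K"
  shows "adj H K T \<in> adjointables K H"
proof -
  note T = adjointables_adjp[OF assms]
  show ?thesis
    using adjp_restrict_adjointables[OF adjp_sym[OF assms(1,2) T]] adj_eq[OF assms(1,2) T] by metis
qed

lemma op_pos_iff_posop:
  assumes H: "hilbert_module H" and R: "R \<in> adjointables H H"
  shows "op_pos H R \<longleftrightarrow> posop H R"
proof -
  interpret cs_module H using H by (rule hilbert_module_cs)
  show ?thesis
  proof
    assume "op_pos H R"
    then obtain V where V: "V \<in> adjointables H H" "R = compose (hcar H) (adj H H V) V"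
      by (auto simp: op_pos_def)
    note V' = adjointables_adjp[OF inner inner V(1)]
    show "posop H R"
      by (rule posop_cong[OF kaplansky[OF cs V']]) (simp add: V(2) compose_eq)
  next
    assume "posop H R"
    then obtain t where t: "posop_at H t R" by (auto simp: posop_def)
    define V where "V = restrict (pos_root H t R) (hcar H)"
    note r = root[OF t]
    have V: "adjp H H V V" by (rule adjp_cong[OF r(1)]) (simp_all add: V_def)
    have "R = compose (hcar H) (adj H H V) V"
    proof (rule extensionalityI[of _ "hcar H"])
      show "R x = compose (hcar H) (adj H H V) V x" if x: "x \<in> hcar H" for x
        using x r(3)[OF x] op_linear[OF r(1)]
        by (simp add: compose_eq adj_apply[OF inner inner V] op_linear[OF V]) (simp add: V_def)
    qed (simp_all add: adjointables_extensional[OF R] compose_extensional)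
    moreover have "V \<in> adjointables H H" unfolding V_def by (rule adjp_restrict_adjointables[OF r(1)])
    ultimately show "op_pos H R" by (auto simp: op_pos_def)
  qed
qed

lemma op_sqrt_eqI:
  assumes H: "hilbert_module H" and S: "S \<in> extensional (hcar H)"
    and R: "posop H R" and RR: "\<And>x. x \<in> hcar H \<Longrightarrow> R (R x) = S x"
  shows "op_sqrt H S = restrict R (hcar H)"
proof -
  interpret cs_module H using H by (rule hilbert_module_cs)
  let ?R = "restrict R (hcar H)"
  have R': "?R \<in> adjointables H H" by (rule adjp_restrict_adjointables[OF posop_selfadj[OF R]])
  have pR: "posop H ?R" by (rule posop_cong[OF R]) simp
  show ?thesis
    unfolding op_sqrt_def
  proof (rule the_equality)
    show "?R \<in> adjointables H H \<and> op_pos H ?R \<and> compose (hcar H) ?R ?R = S"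
      using R' pR op_pos_iff_posop[OF H R'] S RR op_linear[OF posop_selfadj[OF R]]
      by (auto intro!: extensionalityI[of _ "hcar H"] simp: compose_eq)
  next
    fix V assume V: "V \<in> adjointables H H \<and> op_pos H V \<and> compose (hcar H) V V = S"
    then have pV: "posop H V" using op_pos_iff_posop[OF H] by blast
    have VV: "V (V x) = S x" if "x \<in> hcar H" for x
      using V that by (auto simp: compose_eq)
    show "V = ?R"
    proof (rule extensionalityI[of _ "hcar H"])
      show "V \<in> extensional (hcar H)" using V by (blast intro: adjointables_extensional)
      fix x assume x: "x \<in> hcar H"
      have "V x = R x" by (rule posop_unique_root[OF pV R VV RR x])
      then show "V x = ?R x" using x by simp
    qed simp
  qed
qed

lemma op_sqrt:
  assumes H: "hilbert_module H" and S: "S \<in> extensional (hcar H)" and pS: "posop H S"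
  shows op_sqrt_posop: "posop H (op_sqrt H S)"
    and op_sqrt_square: "x \<in> hcar H \<Longrightarrow> op_sqrt H S (op_sqrt H S x) = S x"
    and op_sqrt_adjointables: "op_sqrt H S \<in> adjointables H H"
proof -
  interpret cs_module H using H by (rule hilbert_module_cs)
  obtain t where t: "posop_at H t S" using pS by (auto simp: posop_def)
  let ?R = "pos_root H t S"
  note r = root[OF t]
  have pR: "posop H ?R" using r(2) by (auto simp: posop_def)
  have eq: "op_sqrt H S = restrict ?R (hcar H)"
    by (rule op_sqrt_eqI[OF H S pR r(3)])
  show "posop H (op_sqrt H S)" unfolding eq by (rule posop_cong[OF pR]) simp
  show "x \<in> hcar H \<Longrightarrow> op_sqrt H S (op_sqrt H S x) = S x"
    unfolding eq using r(3) by (simp add: op_linear[OF r(1)])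
  show "op_sqrt H S \<in> adjointables H H"
    unfolding eq by (rule adjp_restrict_adjointables[OF r(1)])
qed

lemma posop_adjoint_square:
  assumes H: "hilbert_module H" and K: "hilbert_module K" and T: "adjp H K T S"
  shows "posop H (\<lambda>x. S (T x))"
proof (rule positive_ip_imp_posop[OF H])
  have i: "inner_module H" "inner_module K" using H K by (auto intro: hilbert_module_inner)
  show "adjp H H (\<lambda>x. S (T x)) (\<lambda>x. S (T x))" by (rule adjp_comp[OF T adjp_sym[OF i T]])
  show "cstar_pos (hip H x (S (T x)))" if "x \<in> hcar H" for x
    using that hilbert_module.ip_pos[OF K, of "T x"] adjp_ip[OF T, of x "T x"] adjp_car[OF T] by simp
qed

lemma op_abs:
  assumes H: "hilbert_module H" and K: "hilbert_module K" and T: "T \<in> adjointables H K"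
  shows op_abs_posop: "posop H (op_abs H K T)"
    and op_abs_square: "x \<in> hcar H \<Longrightarrow> op_abs H K T (op_abs H K T x) = adj H K T (T x)"
    and op_abs_adjointables: "op_abs H K T \<in> adjointables H H"
    and op_abs_eqI: "\<lbrakk>posop H R; \<And>x. x \<in> hcar H \<Longrightarrow> R (R x) = adj H K T (T x)\<rbrakk>
      \<Longrightarrow> op_abs H K T = restrict R (hcar H)"
proof -
  have i: "inner_module H" "inner_module K" using H K by (auto intro: hilbert_module_inner)
  interpret cs_module H using H by (rule hilbert_module_cs)
  have pos: "posop H (compose (hcar H) (adj H K T) T)"
    by (rule posop_cong[OF posop_adjoint_square[OF H K adjointables_adjp[OF i T]]]) (simp add: compose_eq)
  note s = op_sqrt[OF H compose_extensional pos, folded op_abs_def]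
  show "posop H (op_abs H K T)" "op_abs H K T \<in> adjointables H H" using s by auto
  show "x \<in> hcar H \<Longrightarrow> op_abs H K T (op_abs H K T x) = adj H K T (T x)"
    using s(2) by (simp add: compose_eq)
  show "\<lbrakk>posop H R; \<And>x. x \<in> hcar H \<Longrightarrow> R (R x) = adj H K T (T x)\<rbrakk>
      \<Longrightarrow> op_abs H K T = restrict R (hcar H)"
    unfolding op_abs_def by (rule op_sqrt_eqI[OF H]) (auto simp: compose_eq)
qed

section \<open>Orthogonal complements and projections\<close>

lemma adjp_tendsto:
  assumes H: "cs_module H" and K: "cs_module K" and T: "adjp H K T S"
    and s: "\<And>n. s n \<in> hcar H" "x \<in> hcar H" "(\<lambda>n. hnorm H (s n - x)) \<longlonglongrightarrow> 0"
  shows "(\<lambda>n. hnorm K (T (s n) - T x)) \<longlonglongrightarrow> 0"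
proof -
  interpret H: cs_module H by fact
  interpret K: cs_module K by fact
  obtain c where c: "\<And>x. x \<in> hcar H \<Longrightarrow> hnorm K (T x) \<le> c * hnorm H x"
    using adjp_bounded[OF H K T] by blast
  show ?thesis
  proof (rule Lim_null_comparison)
    show "\<forall>\<^sub>F n in sequentially. norm (hnorm K (T (s n) - T x)) \<le> c * hnorm H (s n - x)"
      using c[of "s n - x" for n] s(1,2) by (simp add: adjp_linear[OF H.inner K.inner T])
    show "(\<lambda>n. c * hnorm H (s n - x)) \<longlonglongrightarrow> 0"
      using tendsto_mult[OF tendsto_const s(3)] by simp
  qed
qed

context cs_module
begin

lemma orth_subset: "orth H M \<subseteq> hcar H"
  by (auto simp: orth_def)

lemma orthD: "\<lbrakk>x \<in> orth H M; y \<in> M\<rbrakk> \<Longrightarrow> hip H x y = 0"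
  by (simp add: orth_def)

lemma orthD': "\<lbrakk>x \<in> orth H M; y \<in> M; M \<subseteq> hcar H\<rbrakk> \<Longrightarrow> hip H y x = 0"
  using ip_star[of x y] by (auto simp: orth_def)

lemma orth_diff: "\<lbrakk>M \<subseteq> hcar H; x \<in> orth H M; y \<in> orth H M\<rbrakk> \<Longrightarrow> x - y \<in> orth H M"
  by (auto simp: orth_def subset_iff ip_diff_left)

lemma submodule_orth: "M \<subseteq> hcar H \<Longrightarrow> submodule H (orth H M)"
  unfolding submodule_def orth_def by (auto simp: subset_iff ip_simps ip_act_left)

lemma hclosure_mono: "M \<subseteq> N \<Longrightarrow> hclosure H M \<subseteq> hclosure H N"
  unfolding hclosure_def by blast

lemma hclosure_hclosure:
  assumes "M \<subseteq> hcar H" shows "hclosure H (hclosure H M) \<subseteq> hclosure H M"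
proof
  fix x assume x: "x \<in> hclosure H (hclosure H M)"
  show "x \<in> hclosure H M"
    unfolding hclosure_def
  proof (intro CollectI conjI allI impI)
    show "x \<in> hcar H" using x by (simp add: hclosure_def)
    fix e :: real assume "e > 0"
    then have "e / 2 > 0" by simp
    then obtain y where y: "y \<in> hclosure H M" "hnorm H (x - y) < e / 2"
      using x unfolding hclosure_def by blast
    then obtain z where z: "z \<in> M" "hnorm H (y - z) < e / 2"
      using \<open>e / 2 > 0\<close> unfolding hclosure_def by blast
    have "hnorm H (x - z) \<le> hnorm H (x - y) + hnorm H (y - z)"
      using x y z assms by (intro hnorm_triangle_sub) (auto simp: hclosure_def)
    also have "\<dots> < e / 2 + e / 2" by (intro add_strict_mono y z)
    finally show "\<exists>y\<in>M. hnorm H (x - y) < e" using z by auto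
  qed
qed

lemma orth_hclosure:
  assumes M: "M \<subseteq> hcar H" shows "orth H (hclosure H M) = orth H M"
proof
  show "orth H (hclosure H M) \<subseteq> orth H M"
    using subset_hclosure[OF M] by (auto simp: orth_def)
  show "orth H M \<subseteq> orth H (hclosure H M)"
  proof
    fix x assume x: "x \<in> orth H M"
    have "hip H x y = 0" if y: "y \<in> hclosure H M" for y
    proof -
      obtain s where s: "\<And>n. s n \<in> M" "(\<lambda>n. hnorm H (s n - y)) \<longlonglongrightarrow> 0"
        by (rule hclosure_seq[OF y M]) (rule that)
      have "(\<lambda>n. hip H x (s n)) \<longlonglongrightarrow> hip H x y"
        using s M x y by (intro tendsto_ip) (auto simp: orth_def hclosure_def)
      then show ?thesis using x s by (simp add: orth_def LIMSEQ_const_iff)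
    qed
    then show "x \<in> orth H (hclosure H M)" using x by (auto simp: orth_def)
  qed
qed

lemma hclosure_orth:
  assumes M: "M \<subseteq> hcar H" shows "hclosure H (orth H M) = orth H M"
proof
  show "hclosure H (orth H M) \<subseteq> orth H M"
  proof
    fix x assume x: "x \<in> hclosure H (orth H M)"
    then obtain s where s: "\<And>n. s n \<in> orth H M" "(\<lambda>n. hnorm H (s n - x)) \<longlonglongrightarrow> 0"
      using hclosure_seq orth_subset by blast
    have "hip H x y = 0" if y: "y \<in> M" for y
    proof -
      have "(\<lambda>n. hip H (s n) y) \<longlonglongrightarrow> hip H x y"
        using s M x y orth_subset by (intro tendsto_ip_left) (auto simp: hclosure_def)
      then show ?thesis using s y by (simp add: orth_def LIMSEQ_const_iff)
    qed
    then show "x \<in> orth H M" using x by (auto simp: orth_def hclosure_def)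
  qed
qed (intro subset_hclosure orth_subset)

lemma hclosure_inter_orth:
  assumes "M \<subseteq> hcar H" "x \<in> hclosure H M" "x \<in> orth H M" shows "x = 0"
proof -
  have "x \<in> orth H (hclosure H M)" using assms orth_hclosure by blast
  then have "hip H x x = 0" "x \<in> hcar H" using assms(2) by (auto simp: orth_def)
  then show ?thesis by (rule ip_definite[rotated])
qed

context
  fixes M assumes M: "orth_complemented H M"
begin

lemma complemented_subset: "M \<subseteq> hcar H"
  using M by (auto simp: orth_complemented_def submodule_def)

lemma complemented_closed: "hclosure H M = M"
  using M by (simp add: orth_complemented_def)

lemma complemented_diff: "\<lbrakk>x \<in> M; y \<in> M\<rbrakk> \<Longrightarrow> x - y \<in> M"
proof -
  assume xy: "x \<in> M" "y \<in> M"
  have "x + (-1) *\<^sub>C y \<in> M" using M xy unfolding orth_complemented_def submodule_def by blast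
  then show ?thesis by simp
qed

lemma proj_eqI:
  assumes x: "x \<in> hcar H" and y: "y \<in> M" "x - y \<in> orth H M"
  shows "proj H M x = y"
proof -
  have uniq: "z = y" if z: "z \<in> M" "x - z \<in> orth H M" for z
  proof -
    have "z - y \<in> M" by (rule complemented_diff) fact+
    moreover have "z - y \<in> orth H M"
    proof -
      have "z - y = (x - y) - (x - z)" by simp
      also have "\<dots> \<in> orth H M"
        by (rule orth_diff) (fact complemented_subset y(2) z(2))+
      finally show ?thesis .
    qed
    ultimately have "z - y = 0" using M unfolding orth_complemented_def by blast
    then show ?thesis by simp
  qed
  have "(THE y. y \<in> M \<and> x - y \<in> orth H M) = y"
    by (rule the_equality) (use y uniq in blast)+
  then show ?thesis using x by (simp add: proj_def)
qed

lemma proj_props: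
  assumes x: "x \<in> hcar H"
  shows proj_in: "proj H M x \<in> M" and proj_diff_orth: "x - proj H M x \<in> orth H M"
proof -
  have "x \<in> {x + y |x y. x \<in> M \<and> y \<in> orth H M}"
    using M x unfolding orth_complemented_def by blast
  then obtain y z where yz: "y \<in> M" "z \<in> orth H M" "x = y + z" by blast
  then have "proj H M x = y" by (intro proj_eqI x) simp_all
  then show "proj H M x \<in> M" "x - proj H M x \<in> orth H M" using yz by simp_all
qed

lemma proj_car: "x \<in> hcar H \<Longrightarrow> proj H M x \<in> hcar H"
  using proj_in complemented_subset by blast

lemma proj_of_mem: "x \<in> M \<Longrightarrow> proj H M x = x"
  using complemented_subset by (intro proj_eqI) (auto simp: orth_def subset_iff)

lemma proj_proj: "x \<in> hcar H \<Longrightarrow> proj H M (proj H M x) = proj H M x"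
  by (intro proj_of_mem proj_in)

lemma proj_eq_0_iff: "x \<in> hcar H \<Longrightarrow> proj H M x = 0 \<longleftrightarrow> x \<in> orth H M"
  using proj_diff_orth[of x] proj_eqI[of x 0] M
  by (auto simp: orth_complemented_def submodule_def)

lemma proj_adjp: "adjp H H (proj H M) (proj H M)"
proof (rule adjpI)
  fix x y assume xy: "x \<in> hcar H" "y \<in> hcar H"
  have "hip H (proj H M x) (y - proj H M y) = 0"
    using proj_diff_orth[OF xy(2)] proj_in[OF xy(1)] complemented_subset by (rule orthD')
  moreover have "hip H (x - proj H M x) (proj H M y) = 0"
    using proj_diff_orth[OF xy(1)] proj_in[OF xy(2)] by (rule orthD)
  ultimately show "hip H (proj H M x) y = hip H x (proj H M y)"
    using xy proj_car by (simp add: ip_diff ip_diff_left)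
qed (simp_all add: proj_car)

lemma proj_extensional: "proj H M \<in> extensional (hcar H)"
  by (simp add: proj_def)

lemma op_ran_proj: "op_ran H (proj H M) = M"
  unfolding op_ran_def using proj_in proj_of_mem complemented_subset by (auto simp: image_iff) (metis subsetD)

lemma op_ker_proj: "op_ker H (proj H M) = orth H M"
  unfolding op_ker_def using proj_eq_0_iff orth_subset by auto

end

text \<open>
  The way complemented submodules are produced below: as ranges of explicit self-adjoint idempotents.
\<close>

lemma idempotent_complemented:
  assumes p: "adjp H H p p" and pp: "\<And>x. x \<in> hcar H \<Longrightarrow> p (p x) = p x"
  shows "orth_complemented H (p ` hcar H)" and "x \<in> hcar H \<Longrightarrow> proj H (p ` hcar H) x = p x"
proof -
  note [simp] = op_linear[OF p]
  let ?M = "p ` hcar H"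
  have sub: "?M \<subseteq> hcar H" by auto
  have fix_p: "p y = y" if "y \<in> ?M" for y using that pp by auto
  have orth: "x - p x \<in> orth H ?M" if "x \<in> hcar H" for x
    using that by (auto simp: orth_def ip_diff_left selfadj_ip[OF p] pp)
  have "hclosure H ?M \<subseteq> ?M"
  proof
    fix x assume x: "x \<in> hclosure H ?M"
    then have xc: "x \<in> hcar H" by (simp add: hclosure_def)
    obtain s where s: "\<And>n. s n \<in> ?M" "(\<lambda>n. hnorm H (s n - x)) \<longlonglongrightarrow> 0"
      by (rule hclosure_seq[OF x sub]) (rule that)
    then have sc: "s n \<in> hcar H" for n using sub by blast
    have "(\<lambda>n. hnorm H (p (s n) - p x)) \<longlonglongrightarrow> 0"
      by (rule adjp_tendsto[OF cs cs p sc xc s(2)])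
    then have "(\<lambda>n. hnorm H (s n - p x)) \<longlonglongrightarrow> 0" by (simp only: fix_p[OF s(1)])
    from hlim_unique[OF sc xc _ s(2) this] have "x = p x" using xc by simp
    then show "x \<in> ?M" using xc by (rule image_eqI)
  qed
  then have closed: "hclosure H ?M = ?M" using subset_hclosure[OF sub] by blast
  have subm: "submodule H ?M"
    unfolding submodule_def
  proof (intro conjI ballI allI)
    show "0 \<in> ?M" by (rule image_eqI[of _ p 0]) simp_all
    fix x y assume "x \<in> ?M" "y \<in> ?M"
    then show "x + y \<in> ?M" by (auto simp flip: op_linear(1)[OF p])
  next
    fix c x assume "x \<in> ?M"
    then show "c *\<^sub>C x \<in> ?M" by (auto simp flip: op_linear(4)[OF p])
  next
    fix a x assume "x \<in> ?M"
    then show "hact H x a \<in> ?M" by (auto simp flip: adjp_act_eq[OF inner inner p])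
  qed (rule sub)
  have "hcar H = {x + y |x y. x \<in> ?M \<and> y \<in> orth H ?M}"
  proof (intro equalityI subsetI)
    fix x assume x: "x \<in> hcar H"
    then have "x = p x + (x - p x)" "p x \<in> ?M" "x - p x \<in> orth H ?M" using orth by auto
    then show "x \<in> {x + y |x y. x \<in> ?M \<and> y \<in> orth H ?M}" by blast
  qed (use sub orth_subset in auto)
  moreover have "?M \<inter> orth H ?M = {0}"
    using hclosure_inter_orth[OF sub] submodule_orth[OF sub] subm closed by (auto simp: submodule_def)
  ultimately show M: "orth_complemented H ?M" using subm closed by (simp add: orth_complemented_def)
  show "proj H ?M x = p x" if "x \<in> hcar H"
    using that orth by (intro proj_eqI[OF M]) auto
qed

lemma fixed_on_closure:
  assumes T: "adjp H H T S" and M: "M \<subseteq> hcar H" and fixed: "\<And>y. y \<in> M \<Longrightarrow> T y = y" and x: "x \<in> hclosure H M"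
  shows "T x = x"
proof -
  have xc: "x \<in> hcar H" using x by (simp add: hclosure_def)
  obtain s where s: "\<And>n. s n \<in> M" "(\<lambda>n. hnorm H (s n - x)) \<longlonglongrightarrow> 0" by (rule hclosure_seq[OF x M]) (rule that)
  then have sc: "s n \<in> hcar H" for n using M by blast
  have "(\<lambda>n. hnorm H (T (s n) - T x)) \<longlonglongrightarrow> 0" by (rule adjp_tendsto[OF cs cs T sc xc s(2)])
  then show ?thesis using s fixed sc xc by (intro hlim_unique[of s]) (simp_all add: adjp_car[OF T])
qed

end

lemma hclosure_image:
  assumes H: "cs_module H" and K: "cs_module K" and T: "adjp H K T S" and M: "M \<subseteq> hcar H"
    and x: "x \<in> hclosure H M"
  shows "T x \<in> hclosure K (T ` M)"
proof -
  interpret H: cs_module H by fact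
  interpret K: cs_module K by fact
  obtain s where s: "\<And>n. s n \<in> M" "(\<lambda>n. hnorm H (s n - x)) \<longlonglongrightarrow> 0" by (rule H.hclosure_seq[OF x M]) (rule that)
  have xc: "x \<in> hcar H" using x by (simp add: hclosure_def)
  have "(\<lambda>n. hnorm K (T (s n) - T x)) \<longlonglongrightarrow> 0"
    using s M by (intro adjp_tendsto[OF H K T _ xc]) auto
  with s M xc adjp_car[OF T] show ?thesis by (intro K.hclosure_seqI[of "\<lambda>n. T (s n)"]) auto
qed

lemma adjp_ker_iff:
  assumes H: "cs_module H" and K: "cs_module K" and T: "adjp H K T S" and x: "x \<in> hcar H"
  shows "T x = 0 \<longleftrightarrow> x \<in> orth H (hclosure H (S ` hcar K))"
proof -
  interpret H: cs_module H by fact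
  interpret K: cs_module K by fact
  have S: "S ` hcar K \<subseteq> hcar H" using adjp_car'[OF T] by auto
  have "T x = 0 \<longleftrightarrow> (\<forall>y\<in>hcar K. hip K (T x) y = 0)"
    using K.ip_definite[of "T x"] adjp_car[OF T x] by auto
  also have "\<dots> \<longleftrightarrow> x \<in> orth H (S ` hcar K)"
    using adjp_ip[OF T x] x by (auto simp: orth_def)
  finally show ?thesis by (simp add: H.orth_hclosure[OF S])
qed

section \<open>Polar decompositions and reduced solutions: existence\<close>

text \<open>
  If \<open>\<parallel>b x\<parallel> \<le> \<parallel>a x\<parallel>\<close> then \<open>a x \<mapsto> b x\<close> is well defined and contractive. Its extension to the closure of
  the range of \<open>a\<close> is recorded through approximating sequences.
\<close>

lemma dominated_extension:
  assumes L: "cs_module L" and H: "cs_module H" and K: "cs_module K"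
    and a: "adjp L H a a'" and b: "adjp L K b b'"
    and le: "\<And>x. x \<in> hcar L \<Longrightarrow> hnorm K (b x) \<le> hnorm H (a x)"
    and z: "z \<in> hclosure H (a ` hcar L)"
  shows "\<exists>w\<in>hcar K. \<exists>s. (\<forall>n. s n \<in> hcar L) \<and> (\<lambda>n. hnorm H (a (s n) - z)) \<longlonglongrightarrow> 0
    \<and> (\<lambda>n. hnorm K (b (s n) - w)) \<longlonglongrightarrow> 0"
proof -
  interpret L: cs_module L by fact
  interpret H: cs_module H by fact
  interpret K: cs_module K by fact
  note [simp] = adjp_linear[OF L.inner H.inner a] adjp_linear[OF L.inner K.inner b]
  have zc: "z \<in> hcar H" using z by (simp add: hclosure_def)
  obtain y where y: "\<And>n. y n \<in> a ` hcar L" "(\<lambda>n. hnorm H (y n - z)) \<longlonglongrightarrow> 0"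
    using H.hclosure_seq[OF z] by (metis adjp_car[OF a] image_subsetI)
  then have "\<forall>n. \<exists>x\<in>hcar L. y n = a x" by blast
  then obtain s where s: "\<And>n. s n \<in> hcar L" "\<And>n. y n = a (s n)" by metis
  have "\<exists>w\<in>hcar K. (\<lambda>n. hnorm K (b (s n) - w)) \<longlonglongrightarrow> 0"
  proof (rule K.cauchy_convergent)
    fix e :: real assume e: "e > 0"
    then obtain N where N: "\<And>n. n \<ge> N \<Longrightarrow> hnorm H (y n - z) < e / 2"
      using order_tendstoD(2)[OF y(2), of "e / 2"] by (auto simp: eventually_sequentially)
    have "hnorm K (b (s m) - b (s n)) < e" if "m \<ge> N" "n \<ge> N" for m n
    proof -
      have "hnorm K (b (s m) - b (s n)) \<le> hnorm H (y m - y n)"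
        using le[of "s m - s n"] s by simp
      also have "\<dots> \<le> hnorm H (y m - z) + hnorm H (z - y n)"
        using s zc by (intro H.hnorm_triangle_sub) auto
      also have "hnorm H (z - y n) = hnorm H (y n - z)"
        using s zc by (intro H.hnorm_minus_commute) auto
      also have "hnorm H (y m - z) + hnorm H (y n - z) < e / 2 + e / 2"
        by (intro add_strict_mono N that)
      finally show ?thesis by simp
    qed
    then show "\<exists>N. \<forall>m\<ge>N. \<forall>n\<ge>N. hnorm K (b (s m) - b (s n)) < e" by blast
  qed (simp add: s)
  then obtain w where "w \<in> hcar K" "(\<lambda>n. hnorm K (b (s n) - w)) \<longlonglongrightarrow> 0" by blast
  then show ?thesis using s y(2) by (intro bexI[of _ w] exI[of _ s]) simp_all
qed

text \<open>
  The extension of \<open>a x \<mapsto> b x\<close> by zero on the orthogonal complement need not be adjointable; it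
  is when a candidate \<open>V\<close> for the adjoint is supplied that is correct on the range of \<open>a\<close>. Partial isometries
  and reduced solutions both arise from this lemma.
\<close>

lemma dominated_adjoint:
  assumes L: "cs_module L" and H: "cs_module H" and K: "cs_module K"
    and a: "adjp L H a a'" and b: "adjp L K b b'"
    and le: "\<And>x. x \<in> hcar L \<Longrightarrow> hnorm K (b x) \<le> hnorm H (a x)"
    and M: "M = hclosure H (a ` hcar L)" "orth_complemented H M"
    and V: "\<And>k. k \<in> hcar K \<Longrightarrow> V k \<in> M"
    and aV: "\<And>x k. \<lbrakk>x \<in> hcar L; k \<in> hcar K\<rbrakk> \<Longrightarrow> hip H (a x) (V k) = hip K (b x) k"
  shows "\<exists>W. adjp H K W V \<and> (\<forall>x\<in>hcar L. W (a x) = b x)"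
proof -
  interpret L: cs_module L by fact
  interpret H: cs_module H by fact
  interpret K: cs_module K by fact
  have Vc: "V k \<in> hcar H" if "k \<in> hcar K" for k
    using V[OF that] H.complemented_subset[OF M(2)] by blast
  have "\<forall>z\<in>hcar H. \<exists>w\<in>hcar K. \<exists>s. (\<forall>n. s n \<in> hcar L) \<and> (\<lambda>n. hnorm H (a (s n) - proj H M z)) \<longlonglongrightarrow> 0
    \<and> (\<lambda>n. hnorm K (b (s n) - w)) \<longlonglongrightarrow> 0"
    using H.proj_in[OF M(2)] unfolding M(1) by (intro ballI dominated_extension[OF L H K a b le])
  then obtain W where W: "\<And>z. z \<in> hcar H \<Longrightarrow> W z \<in> hcar K"
    "\<And>z. z \<in> hcar H \<Longrightarrow> \<exists>s. (\<forall>n. s n \<in> hcar L) \<and> (\<lambda>n. hnorm H (a (s n) - proj H M z)) \<longlonglongrightarrow> 0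
    \<and> (\<lambda>n. hnorm K (b (s n) - W z)) \<longlonglongrightarrow> 0" by metis
  have adj: "adjp H K W V"
  proof (rule adjpI)
    fix z k assume z: "z \<in> hcar H" and k: "k \<in> hcar K"
    obtain s where s: "\<And>n. s n \<in> hcar L" "(\<lambda>n. hnorm H (a (s n) - proj H M z)) \<longlonglongrightarrow> 0"
      "(\<lambda>n. hnorm K (b (s n) - W z)) \<longlonglongrightarrow> 0" using W(2)[OF z] by blast
    have "(\<lambda>n. hip K (b (s n)) k) \<longlonglongrightarrow> hip K (W z) k"
      using s W(1)[OF z] k adjp_car[OF b] by (intro K.tendsto_ip_left) auto
    moreover have "(\<lambda>n. hip H (a (s n)) (V k)) \<longlonglongrightarrow> hip H (proj H M z) (V k)"
      using s Vc[OF k] adjp_car[OF a] H.proj_car[OF M(2) z] by (intro H.tendsto_ip_left) auto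
    ultimately have "hip K (W z) k = hip H (proj H M z) (V k)"
      using aV[OF s(1) k] by (simp add: LIMSEQ_unique)
    also have "\<dots> = hip H z (proj H M (V k))"
      by (rule adjp_ip[OF H.proj_adjp[OF M(2)] z Vc[OF k]])
    also have "proj H M (V k) = V k" by (rule H.proj_of_mem[OF M(2) V[OF k]])
    finally show "hip K (W z) k = hip H z (V k)" .
  qed (use W(1) Vc in auto)
  have "W (a x) = b x" if x: "x \<in> hcar L" for x
  proof (rule K.ip_ext)
    fix k assume k: "k \<in> hcar K"
    have "hip K (W (a x)) k = hip K (b x) k"
      using adjp_ip[OF adj adjp_car[OF a x] k] aV[OF x k] by simp
    then show "hip K k (W (a x)) = hip K k (b x)"
      using K.ip_star[of "W (a x)" k] K.ip_star[of "b x" k] k W(1)[OF adjp_car[OF a x]] adjp_car[OF b x] by simp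
  qed (use W(1)[OF adjp_car[OF a x]] adjp_car[OF b x] in auto)
  with adj show ?thesis by blast
qed

lemma is_projection_proj:
  assumes H: "hilbert_module H" and M: "orth_complemented H M"
  shows "is_projection H (proj H M)"
proof -
  interpret cs_module H using H by (rule hilbert_module_cs)
  note p = proj_adjp[OF M] proj_extensional[OF M]
  have "compose (hcar H) (proj H M) (proj H M) = proj H M"
    using p(2) proj_proj[OF M] by (intro extensionalityI[of _ "hcar H"]) (auto simp: compose_eq)
  moreover have "adj H H (proj H M) = proj H M"
    using adj_eq[OF inner inner p(1)] extensional_restrict[OF p(2)] by simp
  ultimately show ?thesis using adjointablesI[OF p] by (simp add: is_projection_def)
qed

lemma op_abs_ip:
  assumes H: "hilbert_module H" and K: "hilbert_module K" and T: "T \<in> adjointables H K"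
    and x: "x \<in> hcar H" and y: "y \<in> hcar H"
  shows "hip H (op_abs H K T x) (op_abs H K T y) = hip K (T x) (T y)"
proof -
  interpret H: cs_module H using H by (rule hilbert_module_cs)
  interpret K: cs_module K using K by (rule hilbert_module_cs)
  note m = H.posop_selfadj[OF op_abs_posop[OF H K T]]
  note T' = adjointables_adjp[OF H.inner K.inner T]
  show ?thesis
    using x y adjp_ip[OF m x, of "op_abs H K T y"] adjp_ip[OF T' x, of "T y"]
      adjp_car[OF m] adjp_car[OF T'] op_abs_square[OF H K T y] by simp
qed

lemma op_abs_eq_0_iff:
  assumes H: "hilbert_module H" and K: "hilbert_module K" and T: "T \<in> adjointables H K"
    and x: "x \<in> hcar H"
  shows "op_abs H K T x = 0 \<longleftrightarrow> T x = 0"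
proof -
  interpret H: cs_module H using H by (rule hilbert_module_cs)
  interpret K: cs_module K using K by (rule hilbert_module_cs)
  note m = H.posop_selfadj[OF op_abs_posop[OF H K T]]
  note T' = adjointables_adjp[OF H.inner K.inner T]
  have "hnorm H (op_abs H K T x) = hnorm K (T x)"
    using op_abs_ip[OF H K T x x] by (simp add: hnorm_def)
  then show ?thesis
    using H.hnorm_eq_0_iff[OF adjp_car[OF m x]] K.hnorm_eq_0_iff[OF adjp_car[OF T' x]] by simp
qed

text \<open>
  Both closures have the same orthogonal complement, the kernel of \<open>T\<close>, but in Hilbert modules this
  alone does not make them equal. One inclusion uses the projection onto the closure of the range of \<open>T*\<close>. For the other one,
  the projection onto the closure of the range of \<open>T\<close> exhibits \<open>T* k\<close> as a limit of vectors \<open>T* T x = |T|\<^sup>2 x\<close>.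
\<close>

lemma closure_ran_op_abs:
  assumes H: "hilbert_module H" and K: "hilbert_module K" and T: "T \<in> adjointables H K"
    and M: "orth_complemented H (hclosure H (op_ran K (adj H K T)))"
    and N: "orth_complemented K (hclosure K (op_ran H T))"
  shows "hclosure H (op_abs H K T ` hcar H) = hclosure H (op_ran K (adj H K T))"
proof -
  interpret H: cs_module H using H by (rule hilbert_module_cs)
  interpret K: cs_module K using K by (rule hilbert_module_cs)
  let ?m = "op_abs H K T" and ?S = "adj H K T"
  let ?M = "hclosure H (op_ran K ?S)" and ?N = "hclosure K (op_ran H T)"
  note T' = adjointables_adjp[OF H.inner K.inner T]
  note S' = adjp_sym[OF H.inner K.inner T']
  note m = H.posop_selfadj[OF op_abs_posop[OF H K T]]
  note [simp] = adjp_linear[OF H.inner K.inner T'] adjp_linear[OF K.inner H.inner S'] H.op_linear[OF m]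
  have ran_m: "?m ` hcar H \<subseteq> hcar H" by auto
  have ran_T: "op_ran H T \<subseteq> hcar K" by (auto simp: op_ran_def)
  show ?thesis
  proof
    have "?m x \<in> ?M" if x: "x \<in> hcar H" for x
    proof -
      have "proj H ?M (?m x) = ?m x"
      proof (rule H.ip_ext)
        fix z assume z: "z \<in> hcar H"
        have c: "z - proj H ?M z \<in> hcar H" using z H.proj_car[OF M z] by simp
        have "z - proj H ?M z \<in> orth H (hclosure H (?S ` hcar K))"
          using H.proj_diff_orth[OF M z] by (simp add: op_ran_def)
        then have "T (z - proj H ?M z) = 0"
          by (rule iffD2[OF adjp_ker_iff[OF H.cs K.cs T' c]])
        then have "?m (z - proj H ?M z) = 0"
          using op_abs_eq_0_iff[OF H K T] z H.proj_car[OF M z] by (metis H.car_diff)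
        then have "?m (proj H ?M z) = ?m z" using z H.proj_car[OF M z] by simp
        then show "hip H z (proj H ?M (?m x)) = hip H z (?m x)"
          using z x H.proj_car[OF M z] by (simp flip: H.selfadj_ip[OF m] adjp_ip[OF H.proj_adjp[OF M]])
      qed (use x H.proj_car[OF M] in auto)
      then show ?thesis using H.proj_in[OF M, of "?m x"] x by simp
    qed
    then show "hclosure H (?m ` hcar H) \<subseteq> ?M"
      using H.hclosure_mono[of "?m ` hcar H" ?M] H.complemented_closed[OF M] by blast
    have "?S k \<in> hclosure H (?m ` hcar H)" if k: "k \<in> hcar K" for k
    proof -
      let ?q = "proj K ?N k"
      have c: "k - ?q \<in> hcar K" using k K.proj_car[OF N k] by simp
      have "k - ?q \<in> orth K (hclosure K (T ` hcar H))"
        using K.proj_diff_orth[OF N k] by (simp add: op_ran_def)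
      then have "?S (k - ?q) = 0"
        by (rule iffD2[OF adjp_ker_iff[OF K.cs H.cs S' c]])
      then have "?S k = ?S ?q" using k K.proj_car[OF N k] by simp
      also have "\<dots> \<in> hclosure H (?S ` op_ran H T)"
        by (rule hclosure_image[OF K.cs H.cs S' ran_T K.proj_in[OF N k]])
      also have "\<dots> \<subseteq> hclosure H (?m ` hcar H)"
        by (rule H.hclosure_mono) (auto simp: op_ran_def simp flip: op_abs_square[OF H K T])
      finally show ?thesis .
    qed
    then have "op_ran K ?S \<subseteq> hclosure H (?m ` hcar H)" by (auto simp: op_ran_def)
    moreover have "hclosure H (hclosure H (?m ` hcar H)) \<subseteq> hclosure H (?m ` hcar H)"
      by (rule H.hclosure_hclosure[OF ran_m])
    ultimately show "?M \<subseteq> hclosure H (?m ` hcar H)"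
      using H.hclosure_mono by blast
  qed
qed

text \<open>
  The isometry \<open>|Y| x \<mapsto> Y x\<close> and its inverse \<open>Y x \<mapsto> |Y| x\<close>, each extended by zero, are adjoint to
  each other. The first needs the closure of the range of \<open>|Y|\<close> to be complemented, the second that of \<open>Y\<close>.
\<close>

lemma polar_decomposition_exists:
  assumes H: "hilbert_module H" and K: "hilbert_module K" and Y: "Y \<in> adjointables H K"
    and M: "orth_complemented H (hclosure H (op_ran K (adj H K Y)))"
    and N: "orth_complemented K (hclosure K (op_ran H Y))"
  shows "\<exists>U. polar_decomposition H K Y U"
proof -
  interpret H: cs_module H using H by (rule hilbert_module_cs)
  interpret K: cs_module K using K by (rule hilbert_module_cs)
  define m where "m = op_abs H K Y"
  define M' where "M' = hclosure H (m ` hcar H)"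
  define N' where "N' = hclosure K (Y ` hcar H)"
  have M'_eq: "M' = hclosure H (op_ran K (adj H K Y))"
    unfolding M'_def m_def by (rule closure_ran_op_abs[OF H K Y M N])
  have M': "orth_complemented H M'" using M unfolding M'_eq .
  have N': "orth_complemented K N'" using N by (simp add: N'_def op_ran_def)
  have m: "adjp H H m m" unfolding m_def by (rule H.posop_selfadj[OF op_abs_posop[OF H K Y]])
  note Y' = adjointables_adjp[OF H.inner K.inner Y]
  note [simp] = H.op_linear[OF m] adjp_linear[OF H.inner K.inner Y']
  have ran_m: "m ` hcar H \<subseteq> hcar H" and ran_Y: "Y ` hcar H \<subseteq> hcar K" by auto
  have ip: "hip H (m x) (m y) = hip K (Y x) (Y y)" if "x \<in> hcar H" "y \<in> hcar H" for x y
    unfolding m_def by (rule op_abs_ip[OF H K Y that])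
  then have norm: "hnorm H (m x) = hnorm K (Y x)" if "x \<in> hcar H" for x
    using that by (simp add: hnorm_def)
  have "\<forall>k\<in>hcar K. \<exists>v\<in>hcar H. \<exists>s. (\<forall>n. s n \<in> hcar H) \<and> (\<lambda>n. hnorm K (Y (s n) - proj K N' k)) \<longlonglongrightarrow> 0
    \<and> (\<lambda>n. hnorm H (m (s n) - v)) \<longlonglongrightarrow> 0"
    using K.proj_in[OF N'] unfolding N'_def
    by (intro ballI dominated_extension[OF H.cs K.cs H.cs Y' m]) (simp_all add: norm)
  then obtain V where Vc: "\<And>k. k \<in> hcar K \<Longrightarrow> V k \<in> hcar H"
    and V: "\<And>k. k \<in> hcar K \<Longrightarrow> \<exists>s. (\<forall>n. s n \<in> hcar H) \<and> (\<lambda>n. hnorm K (Y (s n) - proj K N' k)) \<longlonglongrightarrow> 0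
    \<and> (\<lambda>n. hnorm H (m (s n) - V k)) \<longlonglongrightarrow> 0" by metis
  have VM: "V k \<in> M'" if k: "k \<in> hcar K" for k
  proof -
    obtain s where s: "\<And>n. s n \<in> hcar H" "(\<lambda>n. hnorm H (m (s n) - V k)) \<longlonglongrightarrow> 0" using V[OF k] by blast
    then show ?thesis unfolding M'_def using Vc[OF k]
      by (intro H.hclosure_seqI[of "\<lambda>n. m (s n)"]) auto
  qed
  have mV: "hip H (m x) (V k) = hip K (Y x) k" if x: "x \<in> hcar H" and k: "k \<in> hcar K" for x k
  proof -
    obtain s where s: "\<And>n. s n \<in> hcar H" "(\<lambda>n. hnorm K (Y (s n) - proj K N' k)) \<longlonglongrightarrow> 0"
      "(\<lambda>n. hnorm H (m (s n) - V k)) \<longlonglongrightarrow> 0" using V[OF k] by blast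
    have "(\<lambda>n. hip H (m x) (m (s n))) \<longlonglongrightarrow> hip H (m x) (V k)"
      using s x Vc[OF k] by (intro H.tendsto_ip) auto
    moreover have "(\<lambda>n. hip K (Y x) (Y (s n))) \<longlonglongrightarrow> hip K (Y x) (proj K N' k)"
      using s x K.proj_car[OF N' k] by (intro K.tendsto_ip) auto
    ultimately have "hip H (m x) (V k) = hip K (Y x) (proj K N' k)"
      using ip[OF x s(1)] by (simp add: LIMSEQ_unique)
    also have "\<dots> = hip K (proj K N' (Y x)) k"
      using x k by (simp add: adjp_ip[OF K.proj_adjp[OF N']])
    also have "proj K N' (Y x) = Y x"
      using x K.subset_hclosure[OF ran_Y] by (intro K.proj_of_mem[OF N']) (auto simp: N'_def)
    finally show ?thesis .
  qed
  obtain W where W: "adjp H K W V" and Wm: "\<And>x. x \<in> hcar H \<Longrightarrow> W (m x) = Y x"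
    using dominated_adjoint[OF H.cs H.cs K.cs m Y' _ M'_def M' VM mV] norm by auto
  note W' = adjp_sym[OF H.inner K.inner W]
  define U where "U = restrict W (hcar H)"
  have U: "adjp H K U V" by (rule adjp_cong[OF W]) (simp_all add: U_def)
  have adjU: "adj H K U k = V k" if "k \<in> hcar K" for k by (rule adj_apply[OF H.inner K.inner U that])
  have VY: "V (Y x) = m x" if x: "x \<in> hcar H" for x
  proof -
    have "V (Y x) - m x \<in> M'"
      using x H.subset_hclosure[OF ran_m] VM by (intro H.complemented_diff[OF M']) (auto simp: M'_def)
    moreover have "V (Y x) - m x \<in> orth H (m ` hcar H)"
      unfolding orth_def
    proof (intro CollectI conjI ballI)
      show "V (Y x) - m x \<in> hcar H" using x Vc by simp
      fix y assume "y \<in> m ` hcar H"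
      then obtain z where z: "z \<in> hcar H" "y = m z" by blast
      have "hip H (V (Y x)) (m z) = hip K (Y x) (Y z)"
        using adjp_ip[OF W', of "Y x" "m z"] x z(1) Wm[OF z(1)] by simp
      then show "hip H (V (Y x) - m x) y = 0" using x z ip[OF x z(1)] Vc by (simp add: H.ip_diff_left)
    qed
    ultimately have "V (Y x) - m x = 0"
      unfolding M'_def by (intro H.hclosure_inter_orth[OF ran_m])
    then show ?thesis by simp
  qed
  have VW: "V (W z) = proj H M' z" if z: "z \<in> hcar H" for z
  proof (rule H.proj_eqI[OF M' z, symmetric])
    have Wz: "W z \<in> hcar K" by (rule adjp_car[OF W z])
    show "V (W z) \<in> M'" by (rule VM[OF Wz])
    have "hip H (z - V (W z)) y = 0" if y: "y \<in> m ` hcar H" for y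
    proof -
      obtain x where x: "x \<in> hcar H" "y = m x" using y by blast
      have "hip H (V (W z)) (m x) = hip K (W z) (Y x)"
        using adjp_ip[OF W' Wz, of "m x"] x(1) Wm[OF x(1)] by simp
      also have "\<dots> = hip H z (m x)"
        using adjp_ip[OF W z, of "Y x"] VY[OF x(1)] x(1) by simp
      finally show ?thesis using x z Vc[OF Wz] by (simp add: H.ip_diff_left)
    qed
    then have "z - V (W z) \<in> orth H (m ` hcar H)" using z Vc[OF Wz] by (simp add: orth_def)
    then show "z - V (W z) \<in> orth H M'" unfolding M'_def by (simp add: H.orth_hclosure[OF ran_m])
  qed
  have U_eq: "U x = W x" if "x \<in> hcar H" for x using that by (simp add: U_def)
  have UU: "compose (hcar H) (adj H K U) U = proj H M'"
    using H.proj_extensional[OF M'] adjp_car[OF W] VW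
    by (intro extensionalityI[of _ "hcar H"]) (auto simp: compose_eq adjU U_eq)
  have "polar_decomposition H K Y U"
    unfolding polar_decomposition_def partial_isometry_def M'_eq[symmetric] UU
  proof (intro conjI Y M' refl is_projection_proj[OF H M'])
    show "U \<in> adjointables H K" unfolding U_def by (rule adjp_restrict_adjointables[OF W])
    show "Y = compose (hcar H) U (op_abs H K Y)"
      using adjointables_extensional[OF Y] Wm
      by (intro extensionalityI[of _ "hcar H"]) (auto simp: compose_eq U_def simp flip: m_def)
  qed
  then show ?thesis by blast
qed

lemma polar_decompositionD:
  assumes H: "hilbert_module H" and K: "hilbert_module K" and p: "polar_decomposition H K Y U"
  defines "M \<equiv> hclosure H (op_ran K (adj H K Y))"
  shows "Y \<in> adjointables H K" "U \<in> adjointables H K" "orth_complemented H M"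
    and "\<And>x. x \<in> hcar H \<Longrightarrow> U (op_abs H K Y x) = Y x"
    and "\<And>x. x \<in> hcar H \<Longrightarrow> adj H K U (U x) = proj H M x"
    and "\<And>x. x \<in> hcar H \<Longrightarrow> U (proj H M x) = U x"
    and "\<And>k. k \<in> hcar K \<Longrightarrow> proj H M (adj H K U k) = adj H K U k"
    and "\<And>k. k \<in> hcar K \<Longrightarrow> adj H K Y k = op_abs H K Y (adj H K U k)"
proof -
  interpret H: cs_module H using H by (rule hilbert_module_cs)
  interpret K: cs_module K using K by (rule hilbert_module_cs)
  note d = p[unfolded polar_decomposition_def partial_isometry_def, folded M_def]
  show Y: "Y \<in> adjointables H K" and U: "U \<in> adjointables H K" and M: "orth_complemented H M"
    using d by blast+
  note Y' = adjointables_adjp[OF H.inner K.inner Y] and U' = adjointables_adjp[OF H.inner K.inner U]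
  note Us = adjp_sym[OF H.inner K.inner U'] and Ys = adjp_sym[OF H.inner K.inner Y']
  have m: "adjp H H (op_abs H K Y) (op_abs H K Y)" by (rule H.posop_selfadj[OF op_abs_posop[OF H K Y]])
  note pM = H.proj_adjp[OF M]
  show Um: "U (op_abs H K Y x) = Y x" if "x \<in> hcar H" for x
    using d that by (metis compose_eq)
  show UU: "adj H K U (U x) = proj H M x" if "x \<in> hcar H" for x
    using d that by (metis compose_eq)
  show Up: "U (proj H M x) = U x" if x: "x \<in> hcar H" for x
  proof -
    have c: "x - proj H M x \<in> hcar H" using x H.proj_car[OF M] by simp
    have "adj H K U (U (x - proj H M x)) = proj H M (x - proj H M x)" by (rule UU[OF c])
    also have "\<dots> = 0" using x H.proj_car[OF M] H.proj_proj[OF M] by (simp add: H.op_linear[OF pM])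
    finally have "U (x - proj H M x) = 0"
      by (intro H.ip_kernel[OF U' K.inner c])
    then show ?thesis using x H.proj_car[OF M] by (simp add: adjp_linear[OF H.inner K.inner U'])
  qed
  show "proj H M (adj H K U k) = adj H K U k" if k: "k \<in> hcar K" for k
  proof (rule H.ip_ext)
    fix z assume z: "z \<in> hcar H"
    show "hip H z (proj H M (adj H K U k)) = hip H z (adj H K U k)"
      using z k by (simp add: Up H.proj_car[OF M] adjp_car[OF Us]
          flip: adjp_ip[OF pM] adjp_ip[OF U'])
  qed (use k H.proj_car[OF M] adjp_car[OF Us] in auto)
  show "adj H K Y k = op_abs H K Y (adj H K U k)" if k: "k \<in> hcar K" for k
  proof (rule H.ip_ext)
    fix z assume z: "z \<in> hcar H"
    show "hip H z (adj H K Y k) = hip H z (op_abs H K Y (adj H K U k))"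
      using z k by (simp add: Um adjp_car[OF m] adjp_car[OF Us]
          flip: adjp_ip[OF Y'] adjp_ip[OF m] adjp_ip[OF U'])
  qed (use k adjp_car[OF Ys] adjp_car[OF Us] adjp_car[OF m] in auto)
qed

text \<open>
  The operator \<open>U U*\<close> is a projection and its range is the closure of the range of \<open>Y\<close>: the identity
  \<open>Y* = |Y| U*\<close> gives \<open>U Y* = Y U*\<close>, so \<open>U\<close> maps the closure of the range of \<open>Y*\<close> into that of \<open>Y\<close>.
\<close>

lemma polar_range_complemented:
  assumes H: "hilbert_module H" and K: "hilbert_module K" and p: "polar_decomposition H K Y U"
  shows "orth_complemented K (hclosure K (op_ran H Y))"
proof -
  interpret H: cs_module H using H by (rule hilbert_module_cs)
  interpret K: cs_module K using K by (rule hilbert_module_cs)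
  define M where "M = hclosure H (op_ran K (adj H K Y))"
  note d = polar_decompositionD[OF H K p, folded M_def]
  note Y = adjointables_adjp[OF H.inner K.inner d(1)] and U = adjointables_adjp[OF H.inner K.inner d(2)]
  note Us = adjp_sym[OF H.inner K.inner U] and Ys = adjp_sym[OF H.inner K.inner Y]
  note m = H.posop_selfadj[OF op_abs_posop[OF H K d(1)]]
  note [simp] = adjp_car[OF Y] adjp_car[OF U] adjp_car[OF Us] adjp_car[OF Ys] H.op_linear[OF m] H.proj_car[OF d(3)]
  define q where "q k = U (adj H K U k)" for k
  have q: "adjp K K q q" unfolding q_def by (rule adjp_comp[OF Us U])
  have qq: "q (q k) = q k" if "k \<in> hcar K" for k
    using that by (simp add: q_def d(5,7))
  note c = K.idempotent_complemented[OF q qq]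
  have qY: "Y x \<in> q ` hcar K" if x: "x \<in> hcar H" for x
  proof (rule image_eqI)
    have "q (Y x) = U (proj H M (op_abs H K Y x))"
      using x by (simp add: q_def d(5) flip: d(4))
    then show "Y x = q (Y x)" using x by (simp add: d(4,6))
  qed (use x in simp)
  have "hclosure K (op_ran H Y) = q ` hcar K"
  proof
    show "hclosure K (op_ran H Y) \<subseteq> q ` hcar K"
      using K.hclosure_mono[of "op_ran H Y" "q ` hcar K"] qY K.complemented_closed[OF c(1)]
      by (auto simp: op_ran_def)
    have "q k \<in> hclosure K (op_ran H Y)" if k: "k \<in> hcar K" for k
    proof -
      have "adj H K U k \<in> M"
        using H.proj_in[OF d(3), of "adj H K U k"] d(7)[OF k] k by simp
      then have "q k \<in> hclosure K (U ` op_ran K (adj H K Y))"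
        unfolding q_def M_def by (intro hclosure_image[OF H.cs K.cs U]) (auto simp: op_ran_def)
      also have "\<dots> \<subseteq> hclosure K (op_ran H Y)"
        by (rule K.hclosure_mono) (auto simp: op_ran_def d(8) d(4))
      finally show ?thesis .
    qed
    then show "q ` hcar K \<subseteq> hclosure K (op_ran H Y)" by blast
  qed
  with c(1) show ?thesis by simp
qed

text \<open>
  The bound \<open>\<parallel>B x\<parallel> \<le> \<parallel>\<theta> x\<parallel>\<close>, which holds when \<open>\<theta>\<^sup>2 = B* B + C* C\<close>, takes the place of the closed graph
  argument in the general theorem of this kind. By it \<open>\<theta> x \<mapsto> B x\<close> extends to an operator \<open>Z\<close>, whose adjoint \<open>V\<close>
  is found by solving \<open>\<theta> V k = B* k\<close> for each \<open>k\<close>.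
\<close>

lemma reduced_solution_exists:
  assumes H: "hilbert_module H" and K: "hilbert_module K" and \<theta>: "\<theta> \<in> adjointables H H" "posop H \<theta>"
    and B: "B \<in> adjointables H K"
    and le: "\<And>x. x \<in> hcar H \<Longrightarrow> hnorm K (B x) \<le> hnorm H (\<theta> x)"
    and M: "orth_complemented H (hclosure H (op_ran H \<theta>))"
    and sub: "op_ran K (adj H K B) \<subseteq> op_ran H \<theta>"
  shows "\<exists>Z\<in>adjointables H K. reduced_solution K H H \<theta> (adj H K B) (adj H K Z)"
proof -
  interpret H: cs_module H using H by (rule hilbert_module_cs)
  interpret K: cs_module K using K by (rule hilbert_module_cs)
  let ?M = "hclosure H (op_ran H \<theta>)"
  note t = H.posop_selfadj[OF \<theta>(2)]
  note B' = adjointables_adjp[OF H.inner K.inner B]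
  have adj\<theta>: "adj H H \<theta> = \<theta>"
    using adj_eq[OF H.inner H.inner t] extensional_restrict[OF adjointables_extensional[OF \<theta>(1)]] by simp
  have "\<forall>k\<in>hcar K. \<exists>h\<in>hcar H. adj H K B k = \<theta> h"
    using sub unfolding op_ran_def by blast
  then obtain h where h: "\<And>k. k \<in> hcar K \<Longrightarrow> h k \<in> hcar H" "\<And>k. k \<in> hcar K \<Longrightarrow> adj H K B k = \<theta> (h k)"
    by metis
  define V where "V k = proj H ?M (h k)" for k
  have VM: "V k \<in> ?M" if "k \<in> hcar K" for k
    unfolding V_def by (rule H.proj_in[OF M h(1)[OF that]])
  then have Vc: "V k \<in> hcar H" if "k \<in> hcar K" for k
    using that H.complemented_subset[OF M] by blast
  have \<theta>V: "\<theta> (V k) = adj H K B k" if k: "k \<in> hcar K" for k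
  proof -
    have c: "h k - V k \<in> hcar H" using h(1)[OF k] Vc[OF k] by simp
    have "h k - V k \<in> orth H (hclosure H (\<theta> ` hcar H))"
      using H.proj_diff_orth[OF M h(1)[OF k]] by (simp add: V_def op_ran_def)
    then have "\<theta> (h k - V k) = 0" by (rule iffD2[OF adjp_ker_iff[OF H.cs H.cs t c]])
    then show ?thesis using h[OF k] Vc[OF k] by (simp add: H.op_linear[OF t])
  qed
  have ip: "hip H (\<theta> x) (V k) = hip K (B x) k" if "x \<in> hcar H" "k \<in> hcar K" for x k
    using that by (simp add: adjp_ip[OF t] adjp_ip[OF B'] Vc \<theta>V)
  then obtain W where W: "adjp H K W V"
    using dominated_adjoint[OF H.cs H.cs K.cs t B' le refl M[unfolded op_ran_def] VM[unfolded op_ran_def] ip]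
    by blast
  define Z where "Z = restrict W (hcar H)"
  have Z: "adjp H K Z V" by (rule adjp_cong[OF W]) (simp_all add: Z_def)
  have adjZ: "adj H K Z = restrict V (hcar K)" by (rule adj_eq[OF H.inner K.inner Z])
  have ZA: "Z \<in> adjointables H K" unfolding Z_def by (rule adjp_restrict_adjointables[OF W])
  moreover have "reduced_solution K H H \<theta> (adj H K B) (adj H K Z)"
    unfolding reduced_solution_def adj\<theta>
  proof (intro conjI \<theta>(1) adj_adjointables[OF H.inner K.inner] B ZA)
    show "compose (hcar K) \<theta> (adj H K Z) = adj H K B"
      using adjointables_extensional[OF adj_adjointables[OF H.inner K.inner B]] \<theta>V
      by (intro extensionalityI[of _ "hcar K"]) (auto simp: compose_eq adjZ)
    show "op_ran K (adj H K Z) \<subseteq> ?M" using VM by (auto simp: op_ran_def adjZ)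
  qed
  ultimately show ?thesis by blast
qed

section \<open>Transport of a polar decomposition along partial isometries\<close>

text \<open>
  The identities \<open>E* E Y = Y\<close> and \<open>F* F Y* = Y*\<close> say that \<open>E\<close> and \<open>F\<close> are isometric on the ranges of \<open>Y\<close>
  and \<open>Y*\<close>. They extend to \<open>E* E U = U\<close>, \<open>F* F |Y| = |Y|\<close> and \<open>F* F e = e\<close>, where \<open>e = U* U\<close>. Therefore
  \<open>X = E Y F*\<close> has modulus \<open>F |Y| F*\<close>, and \<open>W = E U F*\<close> satisfies \<open>W* W = F e F*\<close>, a projection whose range is the
  closure of the range of \<open>X* = F Y* E*\<close>.
\<close>

lemma polar_transport:
  fixes H :: "('a::cstar_algebra, 'h::complex_vector) hmod" and K :: "('a, 'k::complex_vector) hmod"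
    and H' :: "('a, 'm::complex_vector) hmod" and K' :: "('a, 'n::complex_vector) hmod"
  assumes H: "hilbert_module H" and K: "hilbert_module K"
    and H': "hilbert_module H'" and K': "hilbert_module K'"
    and p: "polar_decomposition H K Y U"
    and E: "adjp K K' E E'" and F: "adjp H H' F F'"
    and EY: "\<And>x. x \<in> hcar H \<Longrightarrow> E' (E (Y x)) = Y x"
    and FY: "\<And>k. k \<in> hcar K \<Longrightarrow> F' (F (adj H K Y k)) = adj H K Y k"
  shows "polar_decomposition H' K' (\<lambda>x\<in>hcar H'. E (Y (F' x))) (\<lambda>x\<in>hcar H'. E (U (F' x)))"
proof -
  interpret H: cs_module H using H by (rule hilbert_module_cs)
  interpret K: cs_module K using K by (rule hilbert_module_cs)
  interpret H': cs_module H' using H' by (rule hilbert_module_cs)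
  interpret K': cs_module K' using K' by (rule hilbert_module_cs)
  define M where "M = hclosure H (op_ran K (adj H K Y))"
  define m where "m = op_abs H K Y"
  define Us where "Us = adj H K U"
  define Ys where "Ys = adj H K Y"
  note d = polar_decompositionD[OF H K p, folded M_def m_def Us_def Ys_def]
  note Y = adjointables_adjp[OF H.inner K.inner d(1), folded Ys_def]
  note U = adjointables_adjp[OF H.inner K.inner d(2), folded Us_def]
  have pm: "posop H m" unfolding m_def by (rule op_abs_posop[OF H K d(1)])
  have mm: "m (m x) = Ys (Y x)" if "x \<in> hcar H" for x
    unfolding m_def Ys_def by (rule op_abs_square[OF H K d(1) that])
  note FY = FY[folded Ys_def]
  note m = H.posop_selfadj[OF pm]
  note Ys = adjp_sym[OF H.inner K.inner Y] and Us = adjp_sym[OF H.inner K.inner U]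
  note E' = adjp_sym[OF K.inner K'.inner E] and F' = adjp_sym[OF H.inner H'.inner F]
  note e = H.proj_adjp[OF d(3)]
  note [simp] = adjp_linear[OF H.inner K.inner Y] adjp_linear[OF H.inner K.inner U]
    adjp_linear[OF K.inner H.inner Ys] adjp_linear[OF K.inner H.inner Us] H.op_linear[OF m] H.op_linear[OF e]
    adjp_linear[OF K.inner K'.inner E] adjp_linear[OF K'.inner K.inner E']
    adjp_linear[OF H.inner H'.inner F] adjp_linear[OF H'.inner H.inner F']
  have FF: "adjp H H (\<lambda>x. F' (F x)) (\<lambda>x. F' (F x))" by (rule adjp_comp[OF F F'])
  have EE: "adjp K K (\<lambda>x. E' (E x)) (\<lambda>x. E' (E x))" by (rule adjp_comp[OF E E'])
  have M_sub: "op_ran K Ys \<subseteq> hcar H" by (auto simp: op_ran_def)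
  have YFF: "Y (F' (F x)) = Y x" if x: "x \<in> hcar H" for x
  proof (rule K.ip_ext)
    fix k assume k: "k \<in> hcar K"
    have "hip H (Ys k) (F' (F x)) = hip H (F' (F (Ys k))) x"
      using adjp_ip[OF FF, of "Ys k" x] k x by simp
    then show "hip K k (Y (F' (F x))) = hip K k (Y x)"
      using k x FY by (simp flip: adjp_ip[OF Ys])
  qed (use x in simp_all)
  have YEE: "Ys (E' (E k)) = Ys k" if k: "k \<in> hcar K" for k
  proof (rule H.ip_ext)
    fix h assume h: "h \<in> hcar H"
    have "hip K (Y h) (E' (E k)) = hip K (E' (E (Y h))) k"
      using adjp_ip[OF EE, of "Y h" k] k h by simp
    then show "hip H h (Ys (E' (E k))) = hip H h (Ys k)"
      using k h EY by (simp flip: adjp_ip[OF Y])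
  qed (use k in simp_all)
  have m0: "m x = 0 \<longleftrightarrow> Y x = 0" if "x \<in> hcar H" for x
    unfolding m_def by (rule op_abs_eq_0_iff[OF H K d(1) that])
  have FFm: "F' (F (m x)) = m x" if x: "x \<in> hcar H" for x
  proof (rule H.ip_ext)
    fix z assume z: "z \<in> hcar H"
    have "m (z - F' (F z)) = 0" using m0[of "z - F' (F z)"] YFF[OF z] z by simp
    then have "m (F' (F z)) = m z" using z by simp
    then have "hip H (m z) x = hip H (m (F' (F z))) x" by simp
    also have "\<dots> = hip H z (F' (F (m x)))"
      using x z adjp_ip[OF m, of "F' (F z)" x] adjp_ip[OF FF, of z "m x"] by simp
    finally show "hip H z (F' (F (m x))) = hip H z (m x)"
      using x z by (simp add: adjp_ip[OF m])
  qed (use x in simp_all)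
  have FFe: "F' (F (proj H M x)) = proj H M x" if x: "x \<in> hcar H" for x
    by (rule H.fixed_on_closure[OF FF M_sub])
      (use FY H.proj_in[OF d(3) x] in \<open>auto simp: M_def Ys_def op_ran_def\<close>)
  have EEU: "E' (E (U x)) = U x" if x: "x \<in> hcar H" for x
  proof (rule K.ip_ext)
    fix k assume k: "k \<in> hcar K"
    (* The adjoint of U sends w into the kernel of Y and into the closure of the range of its adjoint. *)
    define w where "w = k - E' (E k)"
    have w: "w \<in> hcar K" using k by (simp add: w_def)
    have "m (Us w) = Ys w" using d(8)[OF w] by simp
    also have "\<dots> = 0" using YEE[OF k] k by (simp add: w_def)
    finally have "Y (Us w) = 0" using m0[of "Us w"] w by simp
    then have "Us w \<in> orth H (op_ran K Ys)"
      using w by (auto simp: orth_def op_ran_def adjp_ip[OF Y, symmetric] H.ip_star[of "Ys _" "Us w"]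
        simp flip: adjp_ip[OF Y])
    moreover have "Us w \<in> hclosure H (op_ran K Ys)"
      using H.proj_in[OF d(3), of "Us w"] d(7)[OF w] w by (simp add: M_def Ys_def)
    ultimately have "Us w = 0" by (intro H.hclosure_inter_orth[OF M_sub])
    then have "Us (E' (E k)) = Us k" using k by (simp add: w_def)
    then have "hip H (Us (E' (E k))) x = hip H (Us k) x" by simp
    then show "hip K k (E' (E (U x))) = hip K k (U x)"
      using adjp_ip[OF Us, of "E' (E k)" x] adjp_ip[OF Us, of k x] adjp_ip[OF EE, of k "U x"] k x by simp
  qed (use x in simp_all)
  define X where "X = (\<lambda>x\<in>hcar H'. E (Y (F' x)))"
  define W where "W = (\<lambda>x\<in>hcar H'. E (U (F' x)))"
  have X: "adjp H' K' X (\<lambda>k. F (Ys (E' k)))"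
    by (rule adjp_cong[OF adjp_comp[OF F' adjp_comp[OF Y E]]]) (simp_all add: X_def)
  have W: "adjp H' K' W (\<lambda>k. F (Us (E' k)))"
    by (rule adjp_cong[OF adjp_comp[OF F' adjp_comp[OF U E]]]) (simp_all add: W_def)
  have XA: "X \<in> adjointables H' K'" and WA: "W \<in> adjointables H' K'"
    using adjointablesI[OF X] adjointablesI[OF W] by (simp_all add: X_def W_def)
  have X_eq: "X x = E (Y (F' x))" and W_eq: "W x = E (U (F' x))" if "x \<in> hcar H'" for x
    using that by (simp_all add: X_def W_def)
  note adjX = adj_apply[OF H'.inner K'.inner X] and adjW = adj_apply[OF H'.inner K'.inner W]
  have absX: "op_abs H' K' X = restrict (\<lambda>x. F (m (F' x))) (hcar H')"
  proof (rule op_abs_eqI[OF H' K' XA])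
    show "posop H' (\<lambda>x. F (m (F' x)))"
    proof (rule positive_ip_imp_posop[OF H'])
      show "adjp H' H' (\<lambda>x. F (m (F' x))) (\<lambda>x. F (m (F' x)))"
        by (rule adjp_comp[OF F' adjp_comp[OF m F]])
      show "cstar_pos (hip H' x (F (m (F' x))))" if x: "x \<in> hcar H'" for x
        using posop_imp_positive_ip[OF H pm, of "F' x"] adjp_ip[OF F', of x "m (F' x)"] x by simp
    qed
    show "F (m (F' (F (m (F' x))))) = adj H' K' X (X x)" if "x \<in> hcar H'" for x
      using that by (simp add: adjX X_eq EY FFm mm)
  qed
  define P where "P x = F (proj H M (F' x))" for x
  have P: "adjp H' H' P P" unfolding P_def by (rule adjp_comp[OF F' adjp_comp[OF e F]])
  have PP: "P (P x) = P x" if "x \<in> hcar H'" for x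
    using that by (simp add: P_def FFe H.proj_proj[OF d(3)])
  note c = H'.idempotent_complemented[OF P PP]
  have ran_sub: "P (F (Ys (E' k))) = F (Ys (E' k))" if k: "k \<in> hcar K'" for k
  proof -
    have "Ys (E' k) \<in> M"
      unfolding M_def Ys_def[symmetric]
      by (rule subsetD[OF H.subset_hclosure[OF M_sub]]) (use k in \<open>auto simp: op_ran_def\<close>)
    then show ?thesis using k by (simp add: P_def FY H.proj_of_mem[OF d(3)])
  qed
  have clos: "hclosure H' (op_ran K' (adj H' K' X)) = P ` hcar H'"
  proof
    have "op_ran K' (adj H' K' X) \<subseteq> P ` hcar H'"
    proof
      fix y assume "y \<in> op_ran K' (adj H' K' X)"
      then obtain k where k: "k \<in> hcar K'" "y = F (Ys (E' k))" by (auto simp: op_ran_def adjX)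
      then show "y \<in> P ` hcar H'" by (intro image_eqI[of _ P y]) (simp_all add: ran_sub)
    qed
    then show "hclosure H' (op_ran K' (adj H' K' X)) \<subseteq> P ` hcar H'"
      using H'.hclosure_mono H'.complemented_closed[OF c(1)] by blast
    have "P z \<in> hclosure H' (op_ran K' (adj H' K' X))" if z: "z \<in> hcar H'" for z
    proof -
      have "P z \<in> hclosure H' (F ` op_ran K Ys)"
        unfolding P_def
        by (rule hclosure_image[OF H.cs H'.cs F M_sub])
          (use H.proj_in[OF d(3), of "F' z"] z in \<open>simp add: M_def Ys_def\<close>)
      also have "\<dots> \<subseteq> hclosure H' (op_ran K' (adj H' K' X))"
      proof (rule H'.hclosure_mono, rule subsetI)
        fix y assume "y \<in> F ` op_ran K Ys"
        then obtain k where k: "k \<in> hcar K" "y = F (Ys k)" by (auto simp: op_ran_def)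
        then have "y = adj H' K' X (E k)" by (simp add: adjX YEE)
        then show "y \<in> op_ran K' (adj H' K' X)" using k by (auto simp: op_ran_def)
      qed
      finally show ?thesis .
    qed
    then show "P ` hcar H' \<subseteq> hclosure H' (op_ran K' (adj H' K' X))" by blast
  qed
  have WW: "compose (hcar H') (adj H' K' W) W = proj H' (P ` hcar H')"
  proof (rule extensionalityI[of _ "hcar H'"])
    fix x assume x: "x \<in> hcar H'"
    then show "compose (hcar H') (adj H' K' W) W x = proj H' (P ` hcar H') x"
      using c(2)[OF _ x] by (simp add: compose_eq adjW EEU d(5) P_def W_eq)
  qed (simp_all add: H'.proj_extensional[OF c(1)])
  have "polar_decomposition H' K' X W"
    unfolding polar_decomposition_def partial_isometry_def clos WW
  proof (intro conjI XA WA c(1) refl is_projection_proj[OF H' c(1)])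
    show "X = compose (hcar H') W (op_abs H' K' X)"
      unfolding absX
    proof (rule extensionalityI[of _ "hcar H'"])
      fix x assume x: "x \<in> hcar H'"
      then show "X x = compose (hcar H') W (restrict (\<lambda>x. F (m (F' x))) (hcar H')) x"
        by (simp add: compose_eq W_eq X_eq FFm d(4))
    qed (simp_all add: X_def)
  qed
  then show ?thesis unfolding X_def W_def .
qed

section \<open>Submodules, direct sums and corners of an operator\<close>

lemma subhmod_simps [simp]:
  "hcar (subhmod H M) = M" "hact (subhmod H M) = hact H" "hip (subhmod H M) = hip H"
  "hnorm (subhmod H M) = hnorm H"
  by (simp_all add: subhmod_def hnorm_def fun_eq_iff)

lemma hilbert_module_subhmod:
  fixes H :: "('a::cstar_algebra, 'b::complex_vector) hmod"
  assumes H: "hilbert_module H" and M: "submodule H M" and closed: "hclosure H M = M"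
  shows "hilbert_module (subhmod H M)"
proof -
  interpret H: hilbert_module H by fact
  interpret H: cs_module H using H by (rule hilbert_module_cs)
  have sub: "M \<subseteq> hcar H" using M by (simp add: submodule_def)
  show ?thesis
  proof (unfold_locales, unfold subhmod_simps)
    show "submodule (subhmod H M) M" using M by (simp add: submodule_def)
    show "hcomplete (subhmod H M)"
      unfolding hcomplete_def subhmod_simps
    proof (intro allI impI)
      fix s :: "nat \<Rightarrow> 'b" assume s: "(\<forall>n. s n \<in> M) \<and> (\<forall>e>0. \<exists>N. \<forall>m\<ge>N. \<forall>n\<ge>N. hnorm H (s m - s n) < e)"
      then obtain x where x: "x \<in> hcar H" "(\<lambda>n. hnorm H (s n - x)) \<longlonglongrightarrow> 0"
        using H.cauchy_convergent[of s] sub by blast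
      then have "x \<in> hclosure H M" using s sub by (intro H.hclosure_seqI[of s]) auto
      then show "\<exists>x\<in>M. (\<lambda>n. hnorm H (s n - x)) \<longlonglongrightarrow> 0" using x closed by blast
    qed
  qed (use sub in \<open>auto intro: H.act_add_left H.act_add_right H.act_mult H.act_scaleC_left
      H.act_scaleC_right H.ip_add H.ip_scaleC H.ip_act H.ip_star H.ip_pos H.ip_definite\<close>)
qed

lemma hsum_simps [simp]:
  "hcar (hsum H K) = hcar H \<times> hcar K"
  "hact (hsum H K) p a = (hact H (fst p) a, hact K (snd p) a)"
  "hip (hsum H K) p q = hip H (fst p) (fst q) + hip K (snd p) (snd q)"
  by (simp_all add: hsum_def split_beta)

lemma hilbert_module_hsum:
  fixes H :: "('a::cstar_algebra, 'h::complex_vector) hmod" and K :: "('a, 'k::complex_vector) hmod"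
  assumes H: "hilbert_module H" and K: "hilbert_module K"
  shows "hilbert_module (hsum H K)"
proof -
  interpret H: hilbert_module H by fact
  interpret K: hilbert_module K by fact
  interpret H: cs_module H using H by (rule hilbert_module_cs)
  interpret K: cs_module K using K by (rule hilbert_module_cs)
  let ?S = "hsum H K"
  have norm_le: "hnorm H (fst p) \<le> hnorm ?S p" "hnorm K (snd p) \<le> hnorm ?S p"
    if "p \<in> hcar ?S" for p
    using that cstar_pos_norm_mono[OF H.ip_pos[of "fst p"] K.ip_pos[of "snd p"]]
      cstar_pos_norm_mono[OF K.ip_pos[of "snd p"] H.ip_pos[of "fst p"]]
    by (auto simp: hnorm_def add.commute)
  have norm_ge: "hnorm ?S p \<le> hnorm H (fst p) + hnorm K (snd p)" for p
  proof -
    have "norm (hip ?S p p) \<le> (hnorm H (fst p))\<^sup>2 + (hnorm K (snd p))\<^sup>2"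
      by (simp add: H.hnorm_sq K.hnorm_sq norm_triangle_ineq)
    also have "\<dots> \<le> (hnorm H (fst p) + hnorm K (snd p))\<^sup>2"
      by (simp add: power2_sum)
    finally show ?thesis unfolding hnorm_def[of ?S] by (rule real_le_lsqrt[rotated -1]) simp_all
  qed
  show ?thesis
  proof
    show "submodule ?S (hcar ?S)"
      by (auto simp: submodule_def scaleC_prod_def zero_prod_def)
    show "hcomplete ?S"
      unfolding hcomplete_def
    proof (intro allI impI)
      fix s :: "nat \<Rightarrow> 'h \<times> 'k" assume s: "(\<forall>n. s n \<in> hcar ?S) \<and> (\<forall>e>0. \<exists>N. \<forall>m\<ge>N. \<forall>n\<ge>N. hnorm ?S (s m - s n) < e)"
      have car: "fst (s n) \<in> hcar H" "snd (s n) \<in> hcar K" for n using s by (auto simp: mem_Times_iff)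
      have diff: "s m - s n \<in> hcar ?S" for m n using car by (simp add: mem_Times_iff)
      have "\<exists>x\<in>hcar H. (\<lambda>n. hnorm H (fst (s n) - x)) \<longlonglongrightarrow> 0"
      proof (rule H.cauchy_convergent[OF car(1)])
        fix e :: real assume "e > 0"
        then obtain N where "\<And>m n. \<lbrakk>m \<ge> N; n \<ge> N\<rbrakk> \<Longrightarrow> hnorm ?S (s m - s n) < e" using s by blast
        then show "\<exists>N. \<forall>m\<ge>N. \<forall>n\<ge>N. hnorm H (fst (s m) - fst (s n)) < e"
          using norm_le(1)[OF diff] by (metis fst_diff order_le_less_trans)
      qed
      then obtain x where x: "x \<in> hcar H" "(\<lambda>n. hnorm H (fst (s n) - x)) \<longlonglongrightarrow> 0" by blast
      have "\<exists>y\<in>hcar K. (\<lambda>n. hnorm K (snd (s n) - y)) \<longlonglongrightarrow> 0"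
      proof (rule K.cauchy_convergent[OF car(2)])
        fix e :: real assume "e > 0"
        then obtain N where "\<And>m n. \<lbrakk>m \<ge> N; n \<ge> N\<rbrakk> \<Longrightarrow> hnorm ?S (s m - s n) < e" using s by blast
        then show "\<exists>N. \<forall>m\<ge>N. \<forall>n\<ge>N. hnorm K (snd (s m) - snd (s n)) < e"
          using norm_le(2)[OF diff] by (metis snd_diff order_le_less_trans)
      qed
      then obtain y where y: "y \<in> hcar K" "(\<lambda>n. hnorm K (snd (s n) - y)) \<longlonglongrightarrow> 0" by blast
      have "(\<lambda>n. hnorm ?S (s n - (x, y))) \<longlonglongrightarrow> 0"
      proof (rule Lim_null_comparison)
        show "\<forall>\<^sub>F n in sequentially. norm (hnorm ?S (s n - (x, y)))
            \<le> hnorm H (fst (s n) - x) + hnorm K (snd (s n) - y)"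
          using norm_ge[of "s n - (x, y)" for n] by (simp add: hnorm_def)
        show "(\<lambda>n. hnorm H (fst (s n) - x) + hnorm K (snd (s n) - y)) \<longlonglongrightarrow> 0"
          using tendsto_add[OF x(2) y(2)] by simp
      qed
      then show "\<exists>p\<in>hcar ?S. (\<lambda>n. hnorm ?S (s n - p)) \<longlonglongrightarrow> 0"
        using x(1) y(1) by (intro bexI[of _ "(x, y)"]) simp_all
    qed
  next
    fix p q assume "p \<in> hcar ?S" "q \<in> hcar ?S"
    then show "hip ?S q p = star (hip ?S p q)"
      by (auto simp: mem_Times_iff star_add H.ip_star[of "fst p" "fst q"] K.ip_star[of "snd p" "snd q"])
  next
    fix p assume "p \<in> hcar ?S"
    then show "cstar_pos (hip ?S p p)"
      by (auto simp: mem_Times_iff intro!: cstar_pos_add H.ip_pos K.ip_pos)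
  next
    fix p assume p: "p \<in> hcar ?S" and z: "hip ?S p p = 0"
    have "fst p \<in> hcar H" "snd p \<in> hcar K" using p by (auto simp: mem_Times_iff)
    moreover have "hip K (snd p) (snd p) = - hip H (fst p) (fst p)" using z by (simp add: add_eq_0_iff)
    ultimately have "hip H (fst p) (fst p) = 0" "hip K (snd p) (snd p) = 0"
      using cstar_pos_antisym[of "hip H (fst p) (fst p)"] H.ip_pos[of "fst p"] K.ip_pos[of "snd p"] by auto
    then show "p = 0" using H.ip_definite K.ip_definite p by (auto simp: mem_Times_iff prod_eq_iff)
  qed (auto simp: mem_Times_iff scaleC_prod_def H.act_add_left H.act_add_right H.act_mult
      H.act_scaleC_left H.act_scaleC_right K.act_add_left K.act_add_right K.act_mult
      K.act_scaleC_left K.act_scaleC_right H.ip_simps K.ip_simps H.ip_act K.ip_act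
      scaleC_add_right distrib_right)
qed

lemma adjp_column:
  assumes H: "inner_module H" and Z: "adjp H K Z Z'" and V: "adjp H L V V'"
  shows "adjp H (hsum K L) (\<lambda>x. (Z x, V x)) (\<lambda>p. Z' (fst p) + V' (snd p))"
proof -
  interpret inner_module H by fact
  show ?thesis using Z V by (auto simp: adjp_def ip_add)
qed

lemma hilbert_module_ran_ker:
  assumes H: "hilbert_module H" and M: "orth_complemented H M"
  shows "hilbert_module (subhmod H M)" "hilbert_module (subhmod H (orth H M))"
proof -
  interpret cs_module H using H by (rule hilbert_module_cs)
  show "hilbert_module (subhmod H M)"
    using M by (intro hilbert_module_subhmod[OF H]) (auto simp: orth_complemented_def)
  show "hilbert_module (subhmod H (orth H M))"
    using complemented_subset[OF M] by (intro hilbert_module_subhmod[OF H] submodule_orth hclosure_orth)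
qed

lemma adjp_split_op:
  assumes H: "hilbert_module H" and M: "orth_complemented H M"
  shows "adjp H (hsum (subhmod H M) (subhmod H (orth H M))) (split_op H (proj H M)) (\<lambda>p. fst p + snd p)"
proof -
  interpret cs_module H using H by (rule hilbert_module_cs)
  note p = proj_adjp[OF M]
  have M_sub: "u \<in> hcar H" if "u \<in> M" for u using that complemented_subset[OF M] by blast
  have orth_sub: "v \<in> hcar H" if "v \<in> orth H M" for v using that orth_subset by blast
  show ?thesis
  proof (rule adjpI)
    fix x q assume x: "x \<in> hcar H" and "q \<in> hcar (hsum (subhmod H M) (subhmod H (orth H M)))"
    then have q: "fst q \<in> M" "snd q \<in> orth H M" by (auto simp: mem_Times_iff)
    have u: "proj H M (fst q) = fst q" by (rule proj_of_mem[OF M q(1)])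
    have v: "proj H M (snd q) = 0" using proj_eq_0_iff[OF M] q(2) orth_sub by blast
    show "hip (hsum (subhmod H M) (subhmod H (orth H M))) (split_op H (proj H M) x) q
        = hip H x (fst q + snd q)"
      using x q M_sub orth_sub proj_car[OF M x]
      by (simp add: split_op_def ip_simps selfadj_ip[OF p] u v)
  qed (auto simp: split_op_def mem_Times_iff proj_in[OF M] proj_diff_orth[OF M] M_sub orth_sub)
qed

lemma adjp_corners:
  assumes H: "hilbert_module H" and M: "orth_complemented H M" and T: "adjp H H T S"
  defines "P \<equiv> proj H M"
  shows "adjp (subhmod H M) (subhmod H M) (\<lambda>x\<in>M. P (T (P x))) (\<lambda>y. P (S y))"
    and "adjp (subhmod H M) (subhmod H (orth H M)) (\<lambda>x\<in>M. T (P x) - P (T (P x))) (\<lambda>y. P (S y))"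
proof -
  interpret cs_module H using H by (rule hilbert_module_cs)
  note p = proj_adjp[OF M]
  have M_sub: "u \<in> hcar H" if "u \<in> M" for u using that complemented_subset[OF M] by blast
  have orth_sub: "v \<in> hcar H" if "v \<in> orth H M" for v using that orth_subset by blast
  have v: "proj H M y = 0" if "y \<in> orth H M" for y using proj_eq_0_iff[OF M] that orth_sub by blast
  show "adjp (subhmod H M) (subhmod H M) (\<lambda>x\<in>M. P (T (P x))) (\<lambda>y. P (S y))"
    unfolding P_def
    by (rule adjpI) (simp_all add: M_sub proj_in[OF M] proj_of_mem[OF M] proj_car[OF M] adjp_ip[OF p] adjp_ip[OF T]
        adjp_car[OF T] adjp_car'[OF T] flip: adjp_ip[OF p, of _ "S _"])
  show "adjp (subhmod H M) (subhmod H (orth H M)) (\<lambda>x\<in>M. T (P x) - P (T (P x))) (\<lambda>y. P (S y))"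
    unfolding P_def
    by (rule adjpI) (simp_all add: M_sub orth_sub proj_in[OF M] proj_of_mem[OF M] proj_car[OF M] adjp_ip[OF p] adjp_ip[OF T]
        adjp_car[OF T] adjp_car'[OF T] proj_diff_orth[OF M] ip_diff_left v flip: adjp_ip[OF p, of _ "S _"])
qed

text \<open>
  From \<open>\<langle>\<theta> x, \<theta> x\<rangle> = \<langle>B x, B x\<rangle> + \<langle>C x, C x\<rangle>\<close>, in which all terms are positive, \<open>\<theta>\<close> dominates both \<open>B\<close>
  and \<open>C\<close>.
\<close>

lemma theta:
  assumes H: "hilbert_module H" and K: "hilbert_module K" and L: "hilbert_module L"
    and B: "B \<in> adjointables H K" and C: "C \<in> adjointables H L"
  shows theta_posop: "posop H (theta H K L B C)"
    and theta_adjointables: "theta H K L B C \<in> adjointables H H"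
    and theta_ip: "\<lbrakk>x \<in> hcar H; y \<in> hcar H\<rbrakk> \<Longrightarrow>
      hip H (theta H K L B C x) (theta H K L B C y) = hip K (B x) (B y) + hip L (C x) (C y)"
    and theta_norm: "x \<in> hcar H \<Longrightarrow> hnorm K (B x) \<le> hnorm H (theta H K L B C x)"
      "x \<in> hcar H \<Longrightarrow> hnorm L (C x) \<le> hnorm H (theta H K L B C x)"
proof -
  interpret H: cs_module H using H by (rule hilbert_module_cs)
  have i: "inner_module K" "inner_module L" using K L by (auto intro: hilbert_module_inner)
  note B' = adjointables_adjp[OF H.inner i(1) B] and C' = adjointables_adjp[OF H.inner i(2) C]
  let ?S = "\<lambda>x\<in>hcar H. adj H K B (B x) + adj H L C (C x)"
  have pos: "posop H ?S"
    by (rule H.posop_cong[OF H.posop_plus[OF posop_adjoint_square[OF H K B'] posop_adjoint_square[OF H L C']]])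
      simp
  note s = op_sqrt[OF H _ pos, folded theta_def]
  show posop: "posop H (theta H K L B C)" and "theta H K L B C \<in> adjointables H H" using s by auto
  note t = H.posop_selfadj[OF posop]
  show ip: "hip H (theta H K L B C x) (theta H K L B C y) = hip K (B x) (B y) + hip L (C x) (C y)"
    if "x \<in> hcar H" "y \<in> hcar H" for x y
    using that adjp_car[OF B'] adjp_car[OF C'] adjp_car'[OF B'] adjp_car'[OF C']
    by (simp add: adjp_ip[OF t] adjp_car[OF t] s(2) H.ip_add adjp_ip[OF B'] adjp_ip[OF C'])
  assume x: "x \<in> hcar H"
  have p: "cstar_pos (hip K (B x) (B x))" "cstar_pos (hip L (C x) (C x))"
    using hilbert_module.ip_pos[OF K] hilbert_module.ip_pos[OF L] adjp_car[OF B' x] adjp_car[OF C' x] by auto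
  show "hnorm K (B x) \<le> hnorm H (theta H K L B C x)" "hnorm L (C x) \<le> hnorm H (theta H K L B C x)"
    using cstar_pos_norm_mono[OF p] cstar_pos_norm_mono[OF p(2,1)] x
    by (simp_all add: hnorm_def ip add.commute)
qed

lemma reduced_solutionD:
  assumes H: "hilbert_module H" and K: "hilbert_module K" and \<theta>: "adjp H H \<theta> \<theta>"
    and B: "B \<in> adjointables H K" and Z: "Z \<in> adjointables H K"
    and r: "reduced_solution K H H \<theta> (adj H K B) (adj H K Z)"
  shows "k \<in> hcar K \<Longrightarrow> \<theta> (adj H K Z k) = adj H K B k"
    and "x \<in> hcar H \<Longrightarrow> Z (\<theta> x) = B x"
    and "k \<in> hcar K \<Longrightarrow> adj H K Z k \<in> hclosure H (op_ran H \<theta>)"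
proof -
  interpret H: cs_module H using H by (rule hilbert_module_cs)
  interpret K: cs_module K using K by (rule hilbert_module_cs)
  note B' = adjointables_adjp[OF H.inner K.inner B] and Z' = adjointables_adjp[OF H.inner K.inner Z]
  have "compose (hcar K) \<theta> (adj H K Z) = adj H K B" using r by (simp add: reduced_solution_def)
  then show *: "\<theta> (adj H K Z k) = adj H K B k" if "k \<in> hcar K" for k
    using that by (metis compose_eq)
  show "adj H K Z k \<in> hclosure H (op_ran H \<theta>)" if "k \<in> hcar K"
  proof -
    have "op_ran H (adj H H \<theta>) = op_ran H \<theta>"
      unfolding op_ran_def adj_eq[OF H.inner H.inner \<theta>] by auto
    then show ?thesis using r that by (auto simp: reduced_solution_def op_ran_def)
  qed
  show "Z (\<theta> x) = B x" if x: "x \<in> hcar H"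
  proof (rule K.ip_ext)
    fix k assume k: "k \<in> hcar K"
    show "hip K k (Z (\<theta> x)) = hip K k (B x)"
      using x k adjp_car[OF \<theta>] adjp_car'[OF Z'] *[OF k]
        adjp_ip[OF adjp_sym[OF H.inner K.inner Z'], of k "\<theta> x"]
        adjp_ip[OF adjp_sym[OF H.inner K.inner B'], of k x] adjp_ip[OF \<theta>, of "adj H K Z k" x] by simp
  qed (use x adjp_car[OF \<theta>] adjp_car[OF Z'] adjp_car[OF B'] in auto)
qed

text \<open>
  By \<open>B = Z\<^sub>1 \<theta>\<close> and \<open>C = Z\<^sub>2 \<theta>\<close> the column of \<open>Z\<^sub>1\<close> and \<open>Z\<^sub>2\<close> preserves inner products on the range of \<open>\<theta>\<close>.
  The left-hand side differs from \<open>\<theta> x\<close> by a vector that is orthogonal to this range and, by the range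
  condition on reduced solutions, lies in its closure.
\<close>

lemma theta_column_isometry:
  assumes H: "hilbert_module H" and K: "hilbert_module K" and L: "hilbert_module L"
    and B: "B \<in> adjointables H K" and C: "C \<in> adjointables H L"
    and \<theta>: "\<theta> = theta H K L B C"
    and M: "orth_complemented H (hclosure H (op_ran H \<theta>))"
    and Z1: "Z1 \<in> adjointables H K" and Z2: "Z2 \<in> adjointables H L"
    and r1: "reduced_solution K H H \<theta> (adj H K B) (adj H K Z1)"
    and r2: "reduced_solution L H H \<theta> (adj H L C) (adj H L Z2)"
    and x: "x \<in> hcar H"
  shows "adj H K Z1 (Z1 (\<theta> x)) + adj H L Z2 (Z2 (\<theta> x)) = \<theta> x"
proof -
  interpret H: cs_module H using H by (rule hilbert_module_cs)
  interpret K: cs_module K using K by (rule hilbert_module_cs)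
  interpret L: cs_module L using L by (rule hilbert_module_cs)
  let ?M = "hclosure H (op_ran H \<theta>)"
  note th = theta[OF H K L B C, folded \<theta>]
  note t = H.posop_selfadj[OF th(1)]
  note R1 = reduced_solutionD[OF H K t B Z1 r1] and R2 = reduced_solutionD[OF H L t C Z2 r2]
  note Z1' = adjointables_adjp[OF H.inner K.inner Z1] and Z2' = adjointables_adjp[OF H.inner L.inner Z2]
  note [simp] = adjp_car[OF Z1'] adjp_car'[OF Z1'] adjp_car[OF Z2'] adjp_car'[OF Z2'] adjp_car[OF t]
    adjp_car[OF adjointables_adjp[OF H.inner K.inner B]] adjp_car[OF adjointables_adjp[OF H.inner L.inner C]]
  have sub: "op_ran H \<theta> \<subseteq> hcar H" by (auto simp: op_ran_def)
  let ?v = "adj H K Z1 (Z1 (\<theta> x)) + adj H L Z2 (Z2 (\<theta> x)) - \<theta> x"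
  have "submodule H ?M" using M by (simp add: orth_complemented_def)
  then have "adj H K Z1 (Z1 (\<theta> x)) + adj H L Z2 (Z2 (\<theta> x)) \<in> ?M"
    using R1(3) R2(3) x by (auto simp: submodule_def)
  moreover have "\<theta> x \<in> ?M" using H.subset_hclosure[OF sub] x by (auto simp: op_ran_def)
  ultimately have "?v \<in> ?M" by (rule H.complemented_diff[OF M])
  moreover have "?v \<in> orth H (op_ran H \<theta>)"
    unfolding orth_def
  proof (intro CollectI conjI ballI)
    fix y assume "y \<in> op_ran H \<theta>"
    then obtain z where z: "z \<in> hcar H" "y = \<theta> z" by (auto simp: op_ran_def)
    have "hip H (adj H K Z1 (Z1 (\<theta> x))) (\<theta> z) = hip K (B x) (B z)"
      using adjp_ip[OF adjp_sym[OF H.inner K.inner Z1'], of "Z1 (\<theta> x)" "\<theta> z"] x z R1(2) by simp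
    moreover have "hip H (adj H L Z2 (Z2 (\<theta> x))) (\<theta> z) = hip L (C x) (C z)"
      using adjp_ip[OF adjp_sym[OF H.inner L.inner Z2'], of "Z2 (\<theta> x)" "\<theta> z"] x z R2(2) by simp
    ultimately show "hip H ?v y = 0"
      using x z th(3)[OF x z(1)] by (simp add: H.ip_simps)
  qed (use x in simp)
  ultimately have "?v = 0" by (intro H.hclosure_inter_orth[OF sub])
  then show ?thesis by simp
qed

section \<open>The polar decomposition of the compressed product\<close>

theorem theorem3p3:
  fixes H :: "('a::cstar_algebra, 'h::complex_vector) hmod"
    and K :: "('a, 'k::complex_vector) hmod"
    and T E F M P Q A B C D G \<theta>BC \<theta>DG Y X
    and H1 H2 :: "('a, 'h) hmod" and K1 K2 :: "('a, 'k) hmod"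
  assumes H: "hilbert_module H" and K: "hilbert_module K"
    and T: "T \<in> adjointables H K"
    and T_polar: "\<exists>U. polar_decomposition H K T U"
    and P: "P = proj H (hclosure H (op_ran K (adj H K T)))"
    and Q: "Q = proj K (hclosure K (op_ran H T))"
    and H1: "H1 = subhmod H (op_ran H P)" and H2: "H2 = subhmod H (op_ker H P)"
    and K1: "K1 = subhmod K (op_ran K Q)" and K2: "K2 = subhmod K (op_ker K Q)"
    and nonzero: "hcar H1 \<noteq> {0}" "hcar H2 \<noteq> {0}" "hcar K1 \<noteq> {0}" "hcar K2 \<noteq> {0}"
    and E: "E \<in> adjointables K K" and F: "F \<in> adjointables H H"
    and M: "M = compose (hcar H) E (compose (hcar H) T (adj H H F))"
    and A: "A = (\<lambda>x\<in>hcar H1. Q (T (P x)))"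
    and B: "B = (\<lambda>y\<in>hcar K1. Q (E (Q y)))"
    and C: "C = (\<lambda>y\<in>hcar K1. E (Q y) - Q (E (Q y)))"
    and D: "D = (\<lambda>x\<in>hcar H1. P (F (P x)))"
    and G: "G = (\<lambda>x\<in>hcar H1. F (P x) - P (F (P x)))"
    and \<theta>BC: "\<theta>BC = theta K1 K1 K2 B C"
    and \<theta>DG: "\<theta>DG = theta H1 H1 H2 D G"
    and Y: "Y = compose (hcar H1) \<theta>BC (compose (hcar H1) A \<theta>DG)"
    and X: "X = compose (hcar (hsum H1 H2)) (split_op K Q)
                  (compose (hcar (hsum H1 H2)) M (adj H (hsum H1 H2) (split_op H P)))"
    and i: "orth_complemented K1 (hclosure K1 (op_ran K1 \<theta>BC))"
           "orth_complemented H1 (hclosure H1 (op_ran H1 \<theta>DG))"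
    and ii: "op_ran K1 (adj K1 K1 B) \<subseteq> op_ran K1 \<theta>BC" "op_ran K2 (adj K1 K2 C) \<subseteq> op_ran K1 \<theta>BC"
            "op_ran H1 (adj H1 H1 D) \<subseteq> op_ran H1 \<theta>DG" "op_ran H2 (adj H1 H2 G) \<subseteq> op_ran H1 \<theta>DG"
    and iii: "orth_complemented H1 (hclosure H1 (op_ran K1 (adj H1 K1 Y)))"
             "orth_complemented K1 (hclosure K1 (op_ran H1 Y))"
  shows "(\<exists>UY. polar_decomposition H1 K1 Y UY)
    \<and> (\<exists>Z1 \<in> adjointables K1 K1. reduced_solution K1 K1 K1 \<theta>BC (adj K1 K1 B) (adj K1 K1 Z1))
    \<and> (\<exists>Z2 \<in> adjointables K1 K2. reduced_solution K2 K1 K1 \<theta>BC (adj K1 K2 C) (adj K1 K2 Z2))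
    \<and> (\<exists>Z3 \<in> adjointables H1 H1. reduced_solution H1 H1 H1 \<theta>DG (adj H1 H1 D) (adj H1 H1 Z3))
    \<and> (\<exists>Z4 \<in> adjointables H1 H2. reduced_solution H2 H1 H1 \<theta>DG (adj H1 H2 G) (adj H1 H2 Z4))
    \<and> (\<forall>UY. \<forall>Z1 \<in> adjointables K1 K1. \<forall>Z2 \<in> adjointables K1 K2.
        \<forall>Z3 \<in> adjointables H1 H1. \<forall>Z4 \<in> adjointables H1 H2.
        polar_decomposition H1 K1 Y UY
        \<and> reduced_solution K1 K1 K1 \<theta>BC (adj K1 K1 B) (adj K1 K1 Z1)
        \<and> reduced_solution K2 K1 K1 \<theta>BC (adj K1 K2 C) (adj K1 K2 Z2)
        \<and> reduced_solution H1 H1 H1 \<theta>DG (adj H1 H1 D) (adj H1 H1 Z3)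
        \<and> reduced_solution H2 H1 H1 \<theta>DG (adj H1 H2 G) (adj H1 H2 Z4)
        \<longrightarrow> polar_decomposition (hsum H1 H2) (hsum K1 K2) X
              (block_op H1 H2
                (compose (hcar H1) Z1 (compose (hcar H1) UY (adj H1 H1 Z3)))
                (compose (hcar H2) Z1 (compose (hcar H2) UY (adj H1 H2 Z4)))
                (compose (hcar H1) Z2 (compose (hcar H1) UY (adj H1 H1 Z3)))
                (compose (hcar H2) Z2 (compose (hcar H2) UY (adj H1 H2 Z4)))))"
proof -
  interpret H: cs_module H using H by (rule hilbert_module_cs)
  interpret K: cs_module K using K by (rule hilbert_module_cs)
  obtain UT where UT: "polar_decomposition H K T UT" using T_polar by blast
  define MH where "MH = hclosure H (op_ran K (adj H K T))"
  define MK where "MK = hclosure K (op_ran H T)"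
  have MH: "orth_complemented H MH" unfolding MH_def by (rule polar_decompositionD(3)[OF H K UT])
  have MK: "orth_complemented K MK" unfolding MK_def by (rule polar_range_complemented[OF H K UT])
  note P = P[folded MH_def] and Q = Q[folded MK_def]
  have H1: "H1 = subhmod H MH" and H2: "H2 = subhmod H (orth H MH)"
    using H1 H2 by (simp_all add: P H.op_ran_proj[OF MH] H.op_ker_proj[OF MH])
  have K1: "K1 = subhmod K MK" and K2: "K2 = subhmod K (orth K MK)"
    using K1 K2 by (simp_all add: Q K.op_ran_proj[OF MK] K.op_ker_proj[OF MK])
  have hm: "hilbert_module H1" "hilbert_module H2" "hilbert_module K1" "hilbert_module K2"
    unfolding H1 H2 K1 K2 using hilbert_module_ran_ker[OF H MH] hilbert_module_ran_ker[OF K MK] by auto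
  interpret H1: cs_module H1 using hm(1) by (rule hilbert_module_cs)
  interpret H2: cs_module H2 using hm(2) by (rule hilbert_module_cs)
  interpret K1: cs_module K1 using hm(3) by (rule hilbert_module_cs)
  interpret K2: cs_module K2 using hm(4) by (rule hilbert_module_cs)
  note T' = adjointables_adjp[OF H.inner K.inner T]
  note E' = adjointables_adjp[OF K.inner K.inner E] and F' = adjointables_adjp[OF H.inner H.inner F]
  have car: "hcar H1 = MH" "hcar H2 = orth H MH" "hcar K1 = MK" "hcar K2 = orth K MK"
    by (simp_all add: H1 H2 K1 K2)
  have sub: "x \<in> MH \<Longrightarrow> x \<in> hcar H" "x \<in> orth H MH \<Longrightarrow> x \<in> hcar H" for x
    using H.complemented_subset[OF MH] H.orth_subset by blast+
  have subK: "x \<in> MK \<Longrightarrow> x \<in> hcar K" "x \<in> orth K MK \<Longrightarrow> x \<in> hcar K" for x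
    using K.complemented_subset[OF MK] K.orth_subset by blast+
  have ip: "hip H1 = hip H" "hip K1 = hip K" by (simp_all add: H1 K1)
  have P_in: "P x \<in> MH" if "x \<in> hcar H" for x unfolding P using H.proj_in[OF MH that] .
  have Q_in: "Q x \<in> MK" if "x \<in> hcar K" for x unfolding Q using K.proj_in[OF MK that] .
  have P_id: "P x = x" if "x \<in> MH" for x unfolding P using H.proj_of_mem[OF MH that] .
  have Q_id: "Q x = x" if "x \<in> MK" for x unfolding Q using K.proj_of_mem[OF MK that] .
  note [simp] = adjp_car[OF T'] adjp_car'[OF T'] adjp_car[OF E'] adjp_car[OF F'] adjp_car'[OF F']
  have B': "adjp K1 K1 B (\<lambda>y. Q (adj K K E y))" and C': "adjp K1 K2 C (\<lambda>y. Q (adj K K E y))"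
    using adjp_corners[OF K MK E'] by (simp_all add: B C car K1 K2 Q)
  have D': "adjp H1 H1 D (\<lambda>y. P (adj H H F y))" and G': "adjp H1 H2 G (\<lambda>y. P (adj H H F y))"
    using adjp_corners[OF H MH F'] by (simp_all add: D G car H1 H2 P)
  have A': "adjp H1 K1 A (\<lambda>y. P (adj H K T y))"
  proof (rule adjpI)
    fix x y assume x: "x \<in> hcar H1" and y: "y \<in> hcar K1"
    then have xy: "x \<in> hcar H" "y \<in> hcar K" "P x = x" "Q y = y"
      using sub(1) subK(1) P_id Q_id by (auto simp: car)
    have "hip K (Q (T x)) y = hip K (T x) y"
      using adjp_ip[OF K.proj_adjp[OF MK, folded Q], of "T x" y] xy by simp
    also have "\<dots> = hip H x (P (adj H K T y))"
      using adjp_ip[OF T' xy(1,2)] adjp_ip[OF H.proj_adjp[OF MH, folded P], of x "adj H K T y"] xy by simp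
    finally show "hip K1 (A x) y = hip H1 x (P (adj H K T y))" using x xy by (simp add: A ip)
  qed (auto simp: A car P_id sub subK intro!: P_in Q_in)
  have BA: "B \<in> adjointables K1 K1" and CA: "C \<in> adjointables K1 K2"
    and DA: "D \<in> adjointables H1 H1" and GA: "G \<in> adjointables H1 H2"
    using adjointablesI[OF B'] adjointablesI[OF C'] adjointablesI[OF D'] adjointablesI[OF G']
    by (simp_all add: B C D G)
  note tB = theta[OF hm(3,3,4) BA CA, folded \<theta>BC]
  note tD = theta[OF hm(1,1,2) DA GA, folded \<theta>DG]
  note sB = K1.posop_selfadj[OF tB(1)] and sD = H1.posop_selfadj[OF tD(1)]
  have Y': "adjp H1 K1 Y (\<lambda>k. \<theta>DG (P (adj H K T (\<theta>BC k))))"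
    by (rule adjp_cong[OF adjp_comp[OF sD adjp_comp[OF A' sB]]]) (simp_all add: Y compose_eq)
  have YA: "Y \<in> adjointables H1 K1" using adjointablesI[OF Y'] by (simp add: Y compose_extensional)
  have Y_eq: "Y x = \<theta>BC (A (\<theta>DG x))" if "x \<in> hcar H1" for x using that by (simp add: Y compose_eq)
  have "polar_decomposition (hsum H1 H2) (hsum K1 K2) X
      (block_op H1 H2
        (compose (hcar H1) Z1 (compose (hcar H1) UY (adj H1 H1 Z3)))
        (compose (hcar H2) Z1 (compose (hcar H2) UY (adj H1 H2 Z4)))
        (compose (hcar H1) Z2 (compose (hcar H1) UY (adj H1 H1 Z3)))
        (compose (hcar H2) Z2 (compose (hcar H2) UY (adj H1 H2 Z4))))"
    if Z: "Z1 \<in> adjointables K1 K1" "Z2 \<in> adjointables K1 K2" "Z3 \<in> adjointables H1 H1" "Z4 \<in> adjointables H1 H2"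
      and pY: "polar_decomposition H1 K1 Y UY"
      and r: "reduced_solution K1 K1 K1 \<theta>BC (adj K1 K1 B) (adj K1 K1 Z1)"
        "reduced_solution K2 K1 K1 \<theta>BC (adj K1 K2 C) (adj K1 K2 Z2)"
        "reduced_solution H1 H1 H1 \<theta>DG (adj H1 H1 D) (adj H1 H1 Z3)"
        "reduced_solution H2 H1 H1 \<theta>DG (adj H1 H2 G) (adj H1 H2 Z4)"
    for UY Z1 Z2 Z3 Z4
  proof -
    note Z1' = adjointables_adjp[OF K1.inner K1.inner Z(1)] and Z2' = adjointables_adjp[OF K1.inner K2.inner Z(2)]
    note Z3' = adjointables_adjp[OF H1.inner H1.inner Z(3)] and Z4' = adjointables_adjp[OF H1.inner H2.inner Z(4)]
    note R1 = reduced_solutionD[OF hm(3,3) sB BA Z(1) r(1)] and R2 = reduced_solutionD[OF hm(3,4) sB CA Z(2) r(2)]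
    note R3 = reduced_solutionD[OF hm(1,1) sD DA Z(3) r(3)] and R4 = reduced_solutionD[OF hm(1,2) sD GA Z(4) r(4)]
    define ZE where "ZE x = (Z1 x, Z2 x)" for x
    define ZE' where "ZE' p = adj K1 K1 Z1 (fst p) + adj K1 K2 Z2 (snd p)" for p
    define ZF where "ZF x = (Z3 x, Z4 x)" for x
    define ZF' where "ZF' p = adj H1 H1 Z3 (fst p) + adj H1 H2 Z4 (snd p)" for p
    have ZE: "adjp K1 (hsum K1 K2) ZE ZE'" unfolding ZE_def ZE'_def by (rule adjp_column[OF K1.inner Z1' Z2'])
    have ZF: "adjp H1 (hsum H1 H2) ZF ZF'" unfolding ZF_def ZF'_def by (rule adjp_column[OF H1.inner Z3' Z4'])
    have isoE: "ZE' (ZE (\<theta>BC x)) = \<theta>BC x" if "x \<in> hcar K1" for x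
      using theta_column_isometry[OF hm(3,3,4) BA CA \<theta>BC i(1) Z(1,2) r(1,2) that] by (simp add: ZE_def ZE'_def)
    have isoF: "ZF' (ZF (\<theta>DG x)) = \<theta>DG x" if "x \<in> hcar H1" for x
      using theta_column_isometry[OF hm(1,1,2) DA GA \<theta>DG i(2) Z(3,4) r(3,4) that] by (simp add: ZF_def ZF'_def)
    have main: "polar_decomposition (hsum H1 H2) (hsum K1 K2)
        (\<lambda>p\<in>hcar (hsum H1 H2). ZE (Y (ZF' p))) (\<lambda>p\<in>hcar (hsum H1 H2). ZE (UY (ZF' p)))"
    proof (rule polar_transport[OF hm(1,3) hilbert_module_hsum[OF hm(1,2)] hilbert_module_hsum[OF hm(3,4)] pY ZE ZF])
      show "ZE' (ZE (Y x)) = Y x" if "x \<in> hcar H1" for x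
        using that by (simp add: Y_eq isoE adjp_car[OF A'] adjp_car[OF sD])
      show "ZF' (ZF (adj H1 K1 Y k)) = adj H1 K1 Y k" if "k \<in> hcar K1" for k
        using that isoF[OF adjp_car'[OF A' adjp_car[OF sB that]]]
        by (simp add: adj_apply[OF H1.inner K1.inner Y'])
    qed
    have X_eq: "X = (\<lambda>p\<in>hcar (hsum H1 H2). ZE (Y (ZF' p)))"
    proof (rule extensionalityI[of _ "hcar (hsum H1 H2)"])
      fix p assume p: "p \<in> hcar (hsum H1 H2)"
      define u where "u = fst p"
      define v where "v = snd p"
      have uv: "u \<in> hcar H1" "v \<in> hcar H2" using p by (auto simp: u_def v_def)
      then have uv': "u \<in> hcar H" "v \<in> hcar H" using sub by (auto simp: car)
      have adjP: "adj H (hsum H1 H2) (split_op H P) p = u + v"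
        using adj_apply[OF H.inner hilbert_module_inner[OF hilbert_module_hsum[OF hm(1,2)]] _ p]
          adjp_split_op[OF H MH] by (simp add: H1 H2 P u_def v_def)
      (* X p depends on w only through P w, since T vanishes on the range of 1 - P;
         and P w = D* u + G* v factors through the adjoint of the column ZF. *)
      define w where "w = adj H H F (u + v)"
      have w: "w \<in> hcar H" using uv' by (simp add: w_def)
      define y where "y = \<theta>DG (ZF' p)"
      have ZFp: "ZF' p \<in> hcar H1" by (rule adjp_car'[OF ZF p])
      have y: "y \<in> hcar H1" unfolding y_def by (rule adjp_car[OF sD ZFp])
      have "P w = P (adj H H F u) + P (adj H H F v)"
        using uv' by (simp add: w_def adjp_linear[OF H.inner H.inner adjp_sym[OF H.inner H.inner F']]
            H.op_linear[OF H.proj_adjp[OF MH, folded P]])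
      also have "\<dots> = adj H1 H1 D u + adj H1 H2 G v"
        using uv by (simp add: adj_apply[OF H1.inner H1.inner D'] adj_apply[OF H1.inner H2.inner G'])
      also have "\<dots> = \<theta>DG (adj H1 H1 Z3 u) + \<theta>DG (adj H1 H2 Z4 v)" using uv by (simp add: R3(1) R4(1))
      also have "\<dots> = y"
        using uv adjp_car'[OF Z3'] adjp_car'[OF Z4'] by (simp add: y_def ZF'_def u_def v_def H1.op_linear[OF sD])
      finally have Pw: "P w = y" .
      have "T (w - P w) = 0"
      proof (rule iffD2[OF adjp_ker_iff[OF H.cs K.cs T']])
        show "w - P w \<in> hcar H" using w P_in[OF w] sub(1) by blast
        show "w - P w \<in> orth H (hclosure H (adj H K T ` hcar K))"
          using H.proj_diff_orth[OF MH w] by (simp add: P MH_def op_ran_def)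
      qed
      then have Tw: "T w = T y"
        using w y sub(1) Pw by (simp add: adjp_linear[OF H.inner K.inner T'] car)
      have "T y \<in> op_ran H T" using y sub(1) by (auto simp: op_ran_def car)
      moreover have "op_ran H T \<subseteq> hcar K" by (auto simp: op_ran_def)
      ultimately have Ty: "T y \<in> MK" using K.subset_hclosure unfolding MK_def by blast
      then have Ay: "A y = T y" using y by (simp add: A car P_id Q_id)
      define z where "z = A y"
      have z: "z \<in> hcar K1" using Ty Ay by (simp add: z_def car)
      have "X p = split_op K Q (E (T w))"
        using p uv' by (simp add: X M compose_eq adjP w_def)
      also have "\<dots> = split_op K Q (E z)" using Tw Ay by (simp add: z_def)
      also have "\<dots> = (B z, C z)"
        using z by (simp add: split_op_def B C car Q_id subK)
      also have "\<dots> = (Z1 (\<theta>BC z), Z2 (\<theta>BC z))" using z by (simp add: R1(2) R2(2))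
      also have "\<theta>BC z = Y (ZF' p)" using ZFp by (simp add: z_def y_def Y_eq)
      finally show "X p = (\<lambda>p\<in>hcar (hsum H1 H2). ZE (Y (ZF' p))) p"
        using p by (simp add: ZE_def)
    qed (simp_all add: X compose_extensional del: hsum_simps)
    note UY' = adjointables_adjp[OF H1.inner K1.inner polar_decompositionD(2)[OF hm(1,3) pY]]
    have block: "block_op H1 H2
        (compose (hcar H1) Z1 (compose (hcar H1) UY (adj H1 H1 Z3)))
        (compose (hcar H2) Z1 (compose (hcar H2) UY (adj H1 H2 Z4)))
        (compose (hcar H1) Z2 (compose (hcar H1) UY (adj H1 H1 Z3)))
        (compose (hcar H2) Z2 (compose (hcar H2) UY (adj H1 H2 Z4)))
      = (\<lambda>p\<in>hcar (hsum H1 H2). ZE (UY (ZF' p)))" (is "?W = _")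
    proof (rule extensionalityI[of _ "hcar (hsum H1 H2)"])
      fix p assume p: "p \<in> hcar (hsum H1 H2)"
      then show "?W p
        = (\<lambda>p\<in>hcar (hsum H1 H2). ZE (UY (ZF' p))) p"
        using adjp_car'[OF Z3'] adjp_car'[OF Z4']
        by (auto simp: block_op_def compose_eq ZE_def ZF'_def adjp_linear[OF H1.inner K1.inner UY']
            adjp_linear[OF K1.inner K1.inner Z1'] adjp_linear[OF K1.inner K2.inner Z2'])
    qed (simp_all add: block_op_def)
    show ?thesis unfolding X_eq block by (rule main)
  qed
  moreover have "\<exists>UY. polar_decomposition H1 K1 Y UY"
    by (rule polar_decomposition_exists[OF hm(1,3) YA iii])
  moreover have "\<exists>Z1 \<in> adjointables K1 K1. reduced_solution K1 K1 K1 \<theta>BC (adj K1 K1 B) (adj K1 K1 Z1)"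
    by (rule reduced_solution_exists[OF hm(3,3) tB(2,1) BA tB(4) i(1) ii(1)])
  moreover have "\<exists>Z2 \<in> adjointables K1 K2. reduced_solution K2 K1 K1 \<theta>BC (adj K1 K2 C) (adj K1 K2 Z2)"
    by (rule reduced_solution_exists[OF hm(3,4) tB(2,1) CA tB(5) i(1) ii(2)])
  moreover have "\<exists>Z3 \<in> adjointables H1 H1. reduced_solution H1 H1 H1 \<theta>DG (adj H1 H1 D) (adj H1 H1 Z3)"
    by (rule reduced_solution_exists[OF hm(1,1) tD(2,1) DA tD(4) i(2) ii(3)])
  moreover have "\<exists>Z4 \<in> adjointables H1 H2. reduced_solution H2 H1 H1 \<theta>DG (adj H1 H2 G) (adj H1 H2 Z4)"
    by (rule reduced_solution_exists[OF hm(1,2) tD(2,1) GA tD(5) i(2) ii(4)])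
  ultimately show ?thesis by blast
qed

end
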